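(* Let $a,b$ be two distinct points in $\mathbb{C}^2$ such that the complex line $\Lambda(a,b)$ meets $\mathbb{B}$. Suppose that if one of the points $a,b$ is in $\mathbb{B}$ and the other in $\mathbb{C}^2\setminus\overline{\mathbb{B}}$ then $\langle a|b\rangle\neq 1$. Assume that a continuous function $f$ on $b\mathbb{B}$ extends holomorphically into $\mathbb{B}$ along every complex line $L\in\mathcal{L}(a)\cup\mathcal{L}(b)$. Then for any $c\in\Lambda(a,b)\cap\mathbb{B}$, the function $f$ extends holomorphically into $\mathbb{B}$ along any complex line $L\in\mathcal{L}(c)$.
   Context: $\mathbb{B}$ is the open unit ball in $\mathbb{C}^2$, $b\mathbb{B}$ its boundary (the unit sphere), $\overline{\mathbb{B}}$ its closure. $\langle a|b\rangle=a_1\overline{b_1}+a_2\overline{b_2}$ is the standard Hermitian inner product on $\mathbb{C}^2$. For $a\in\mathbb{C}^2$, $\mathcal{L}(a)$ is the family of all complex lines (complex affine lines) in $\mathbb{C}^2$ passing through $a$. For $a\neq b$, $\Lambda(a,b)$ is the complex line passing through $a$ and $b$. A continuous function $f$ on $b\mathbb{B}$ extends holomorphically into $\mathbb{B}$ along a complex line $L$ if the restriction of $f$ to $L\cap b\mathbb{B}$ extends to a continuous function on $L\cap\overline{\mathbb{B}}$ that is holomorphic on $L\cap\mathbb{B}$ (this is vacuous if $L$ does not meet $\mathbb{B}$). *)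

theory Defs
  imports "HOL-Analysis.Analysis"
begin

(* The space of pairs of complex numbers is complex ^ 2, whose norm is the Euclidean one (see
   norm_complex2 below), so that ball 0 1, sphere 0 1 and cball 0 1 are the open unit ball, the unit
   sphere and the closed unit ball. Scalar multiplication by complex numbers is *s. *)

definition hermitian_inner :: "complex ^ 2 \<Rightarrow> complex ^ 2 \<Rightarrow> complex" where
  "hermitian_inner a b = a $ 1 * cnj (b $ 1) + a $ 2 * cnj (b $ 2)"

lemma norm_complex2: "norm (a :: complex ^ 2) = sqrt ((cmod (a $ 1))\<^sup>2 + (cmod (a $ 2))\<^sup>2)"
  by (simp add: norm_vec_def L2_set_def sum_2)

lemma hermitian_inner_self: "hermitian_inner a a = of_real ((norm a)\<^sup>2)"
  unfolding hermitian_inner_def norm_complex2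
  by (simp add: complex_norm_square[symmetric])

(* A line only when v is nonzero. *)
definition cline :: "complex ^ 2 \<Rightarrow> complex ^ 2 \<Rightarrow> (complex ^ 2) set" where
  "cline p v = range (\<lambda>z. p + z *s v)"

definition complex_lines_through :: "complex ^ 2 \<Rightarrow> (complex ^ 2) set set" where
  "complex_lines_through a = {L. \<exists>v. v \<noteq> 0 \<and> L = cline a v}"

(* A line only when a and b are distinct. *)
definition complex_line_join :: "complex ^ 2 \<Rightarrow> complex ^ 2 \<Rightarrow> (complex ^ 2) set" where
  "complex_line_join a b = cline a (b - a)"

lemma complex_line_join_unique:
  assumes "a \<noteq> b"
  shows "L \<in> complex_lines_through a \<and> b \<in> L \<longleftrightarrow> L = complex_line_join a b"
proof
  assume "L \<in> complex_lines_through a \<and> b \<in> L"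
  then obtain v z where L: "L = cline a v" and b: "b = a + z *s v"
    by (auto simp: complex_lines_through_def cline_def)
  have z: "z \<noteq> 0" using assms b by auto
  have "a + x *s v = a + (x / z) *s (b - a)" for x
    using z b by (simp add: vector_smult_assoc)
  then have "L \<subseteq> complex_line_join a b"
    unfolding L complex_line_join_def cline_def by blast
  moreover have "a + x *s (b - a) = a + (x * z) *s v" for x
    using b by (simp add: vector_smult_assoc)
  then have "complex_line_join a b \<subseteq> L"
    unfolding L complex_line_join_def cline_def by blast
  ultimately show "L = complex_line_join a b" by blast
next
  assume L: "L = complex_line_join a b"
  have "a + 1 *s (b - a) \<in> L"
    unfolding L complex_line_join_def cline_def by (rule rangeI)
  moreover have "L \<in> complex_lines_through a"
    using assms unfolding L complex_lines_through_def complex_line_join_def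
    by (intro CollectI exI[of _ "b - a"]) simp
  ultimately show "L \<in> complex_lines_through a \<and> b \<in> L" by simp
qed

(* Holomorphy on the relatively open subset L \<inter> U of a complex line L: holomorphy in the
   affine coordinate z of L. All affine coordinates are required, but one suffices
   (holomorphic_on_line_iff). *)
definition holomorphic_on_line ::
    "(complex ^ 2 \<Rightarrow> complex) \<Rightarrow> (complex ^ 2) set \<Rightarrow> (complex ^ 2) set \<Rightarrow> bool" where
  "holomorphic_on_line g L U \<longleftrightarrow>
     (\<forall>p v. v \<noteq> 0 \<and> L = cline p v \<longrightarrow>
        (\<lambda>z. g (p + z *s v)) holomorphic_on {z. p + z *s v \<in> U})"

lemma holomorphic_on_line_iff:
  assumes "v \<noteq> 0"
  shows "holomorphic_on_line g (cline p v) U \<longleftrightarrow>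
    (\<lambda>z. g (p + z *s v)) holomorphic_on {z. p + z *s v \<in> U}"
proof
  assume hol: "(\<lambda>z. g (p + z *s v)) holomorphic_on {z. p + z *s v \<in> U}"
  show "holomorphic_on_line g (cline p v) U"
    unfolding holomorphic_on_line_def
  proof (intro allI impI, elim conjE)
    fix q w assume w: "w \<noteq> 0" and eq: "cline p v = cline q w"
    have "q + 0 *s w \<in> cline p v" "q + 1 *s w \<in> cline p v"
      unfolding eq unfolding cline_def by (rule rangeI)+
    then obtain s t where s0: "q + 0 *s w = p + s *s v" and t: "q + 1 *s w = p + t *s v"
      unfolding cline_def by blast
    from s0 have s: "q = p + s *s v" by simp
    have w': "w = (t - s) *s v"
      using s t by (simp add: vec_eq_iff algebra_simps)
    have param: "q + z *s w = p + (s + z * (t - s)) *s v" for z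
      unfolding w' s by (simp add: vec_eq_iff algebra_simps)
    have "(\<lambda>z. g (p + z *s v)) \<circ> (\<lambda>z. s + z * (t - s)) holomorphic_on {z. q + z *s w \<in> U}"
      by (rule holomorphic_on_compose_gen[OF _ hol]) (auto simp: param intro!: holomorphic_intros)
    then show "(\<lambda>z. g (q + z *s w)) holomorphic_on {z. q + z *s w \<in> U}"
      by (simp add: o_def param)
  qed
qed (use assms in \<open>auto simp: holomorphic_on_line_def\<close>)

(* Only the values of f on the unit sphere and of g on L \<inter> cball 0 1 matter. *)
definition extends_holomorphically_along ::
    "(complex ^ 2 \<Rightarrow> complex) \<Rightarrow> (complex ^ 2) set \<Rightarrow> bool" where
  "extends_holomorphically_along f L \<longleftrightarrow>
     (\<exists>g. continuous_on (L \<inter> cball 0 1) g \<and>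
          holomorphic_on_line g L (ball 0 1) \<and>
          (\<forall>x \<in> L \<inter> sphere 0 1. g x = f x))"

end

theory Submission
  imports Defs "HOL-Complex_Analysis.Conformal_Mappings" "HOL-Real_Asymp.Real_Asymp"
begin

text \<open>
  The ball is the set of projective points on which the form
  \<open>\<bar>x\<bar>\<^sup>2 + \<bar>y\<bar>\<^sup>2 - \<bar>s\<bar>\<^sup>2\<close> on \<open>\<complex>\<^sup>3\<close> is negative, so the linear isometries of this form act by
  projective maps that preserve the ball, the sphere and the complex lines. A suitable one moves
  \<open>\<Lambda>(a,b)\<close> to the axis \<open>w = 0\<close> of the coordinates \<open>(z,w)\<close>, and the two points to real points
  \<open>(\<alpha>,0)\<close> and \<open>(\<beta>,0)\<close> with \<open>\<alpha> < 0 < \<beta>\<close> (\<open>normal_frame\<close>). The excluded case, in which one point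
  lies inside, the other outside and \<open>\<langle>a|b\<rangle> = 1\<close>, is the one where the two points can only be moved
  to the centre and to infinity.

  Rotations in \<open>w\<close> preserve both pencils of lines. Hence the Fourier components of the function in
  the angle of \<open>w\<close> extend along the same lines, and since Fejer means converge uniformly and the
  conclusion survives uniform limits, one may assume that the function is one such component:
  \<open>g(z,w) = w\<^sup>k F(z)\<close> on the sphere \<open>\<bar>z\<bar>\<^sup>2 + \<bar>w\<bar>\<^sup>2 = 1\<close>. The core is \<open>polyanalytic_structure\<close>:
  \<open>F = 0\<close> if \<open>k < 0\<close>, and otherwise \<open>F(z)\<close> is a polynomial of degree at most \<open>k\<close> in
  \<open>vertex z = cnj z / (1 - \<bar>z\<bar>\<^sup>2)\<close> with coefficients holomorphic in the disc. This gives the theorem: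
  where a line \<open>w = t (z - \<gamma>)\<close> meets the sphere, \<open>vertex z\<close> is a holomorphic function divided by
  \<open>z - \<gamma>\<close>, and the factor \<open>w\<^sup>k\<close> cancels the resulting pole (\<open>component_disc_extends\<close>).

  For the core, let \<open>h\<^sub>t\<close> be the extension along \<open>w = t (z - \<alpha>)\<close>, \<open>t > 0\<close>, written in the coordinate
  \<open>z\<close>, and put \<open>G(z,t) = h\<^sub>t(z) / (t (z - \<alpha>))\<^sup>k\<close>. For fixed \<open>z\<close> the slope \<open>t\<close> runs up to the value
  \<open>max_slope\<close> at which the line meets the sphere over \<open>z\<close>, and there \<open>G = F(z)\<close>. In the variable
  \<open>v = ray \<alpha> z t\<close>, affine in \<open>1/t\<^sup>2\<close> with coefficients holomorphic in \<open>z\<close>, the slopes fill a ray that starts at \<open>vertex z\<close>,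
  whatever \<open>\<alpha>\<close> is. Over the real \<open>z\<close> near \<open>0\<close> the two rays point in opposite directions
  and fill the real line, so that the two functions \<open>G\<close> glue to one continuous function of \<open>v\<close>;
  it is a polynomial of degree at most \<open>k\<close> (\<open>polynomial_on_real_line\<close>).

  To see this, integrate \<open>G\<close> over the ray against rational functions of \<open>v\<close> that are holomorphic near
  the rays of all points of a half disc. The integrand is holomorphic in \<open>z\<close>, so that the
  \<open>\<partial>/\<partial>cnj z\<close> derivative of the integral comes from its end point only and is the same for \<open>\<alpha>\<close> and for
  \<open>\<beta>\<close>. The difference of the two integrals is therefore holomorphic in the half disc. It vanishes
  to second order at the bounding arc, so extending it by zero gives a holomorphic function on a half plane
  that vanishes outside the disc, hence everywhere (\<open>K_eq_half_disc\<close>). In the limit at real points, after a Cayley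
  transform, these equalities say that the Fourier coefficients of the glued function outside
  a finite range vanish. Finally Lagrange interpolation at \<open>k + 1\<close> points of each ray and the
  identity theorem carry the polynomials from a real interval to the disc
  (\<open>polynomial_continuation\<close>).
\<close>

section \<open>A weak Cauchy-Riemann operator\<close>

text \<open>\<open>b\<close> is the value of \<open>\<partial>u/\<partial>cnj z\<close> at \<open>z0\<close>, in a sense that does not require \<open>u\<close> to be
  differentiable: on each small disc \<open>u\<close> differs from a holomorphic function by
  \<open>b cnj (z - z0)\<close> up to an error that is small compared with the radius. The ray integrals below
  have a derivative of this kind only, because the functions in them are merely continuous up to the
  boundary; Goursat's argument needs no more.\<close>

definition has_dbar :: "(complex \<Rightarrow> complex) \<Rightarrow> complex \<Rightarrow> complex \<Rightarrow> bool" where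
  "has_dbar u b z0 \<longleftrightarrow> (\<forall>e>0. \<exists>d>0. \<forall>r. 0 < r \<and> r < d \<longrightarrow>
     (\<exists>g. g holomorphic_on ball z0 r \<and>
          (\<forall>z\<in>ball z0 r. cmod (u z - g z - b * cnj (z - z0)) \<le> e * r)))"

lemma has_dbarE:
  assumes "has_dbar u b z0" "e > 0"
  obtains d where "d > 0" "\<And>r. 0 < r \<Longrightarrow> r < d \<Longrightarrow> \<exists>g. g holomorphic_on ball z0 r \<and>
      (\<forall>z\<in>ball z0 r. cmod (u z - g z - b * cnj (z - z0)) \<le> e * r)"
proof -
  from assms(1)[unfolded has_dbar_def, rule_format, OF assms(2)]
  obtain d where d: "d > 0" "\<forall>r. 0 < r \<and> r < d \<longrightarrow> (\<exists>g. g holomorphic_on ball z0 r \<and>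
      (\<forall>z\<in>ball z0 r. cmod (u z - g z - b * cnj (z - z0)) \<le> e * r))"
    by (elim exE conjE)
  show thesis
    by (rule that[OF d(1)]) (rule d(2)[rule_format], simp)
qed

lemma has_dbar_diff:
  assumes "has_dbar u b z0" "has_dbar v c z0"
  shows "has_dbar (\<lambda>z. u z - v z) (b - c) z0"
  unfolding has_dbar_def
proof (intro allI impI)
  fix e :: real assume e: "e > 0"
  obtain d1 where d1: "d1 > 0" "\<And>r. 0 < r \<Longrightarrow> r < d1 \<Longrightarrow> \<exists>g. g holomorphic_on ball z0 r \<and>
      (\<forall>z\<in>ball z0 r. cmod (u z - g z - b * cnj (z - z0)) \<le> e/2 * r)"
    using has_dbarE[OF assms(1), of "e/2"] e by auto
  obtain d2 where d2: "d2 > 0" "\<And>r. 0 < r \<Longrightarrow> r < d2 \<Longrightarrow> \<exists>g. g holomorphic_on ball z0 r \<and>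
      (\<forall>z\<in>ball z0 r. cmod (v z - g z - c * cnj (z - z0)) \<le> e/2 * r)"
    using has_dbarE[OF assms(2), of "e/2"] e by auto
  show "\<exists>d>0. \<forall>r. 0 < r \<and> r < d \<longrightarrow> (\<exists>g. g holomorphic_on ball z0 r \<and>
      (\<forall>z\<in>ball z0 r. cmod (u z - v z - g z - (b - c) * cnj (z - z0)) \<le> e * r))"
  proof (intro exI[of _ "min d1 d2"] conjI allI impI)
    fix r assume r: "0 < r \<and> r < min d1 d2"
    obtain g1 g2 where g: "g1 holomorphic_on ball z0 r" "g2 holomorphic_on ball z0 r"
      "\<And>z. z \<in> ball z0 r \<Longrightarrow> cmod (u z - g1 z - b * cnj (z - z0)) \<le> e/2 * r"
      "\<And>z. z \<in> ball z0 r \<Longrightarrow> cmod (v z - g2 z - c * cnj (z - z0)) \<le> e/2 * r"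
      using d1(2)[of r] d2(2)[of r] r by auto
    show "\<exists>g. g holomorphic_on ball z0 r \<and>
      (\<forall>z\<in>ball z0 r. cmod (u z - v z - g z - (b - c) * cnj (z - z0)) \<le> e * r)"
    proof (intro exI[of _ "\<lambda>z. g1 z - g2 z"] conjI ballI)
      show "(\<lambda>z. g1 z - g2 z) holomorphic_on ball z0 r" by (intro holomorphic_intros g)
      fix z assume z: "z \<in> ball z0 r"
      have "u z - v z - (g1 z - g2 z) - (b - c) * cnj (z - z0)
        = (u z - g1 z - b * cnj (z - z0)) - (v z - g2 z - c * cnj (z - z0))"
        by (simp add: algebra_simps)
      also have "cmod \<dots> \<le> e/2 * r + e/2 * r"
        by (rule order_trans[OF norm_triangle_ineq4]) (intro add_mono g z)
      finally show "cmod (u z - v z - (g1 z - g2 z) - (b - c) * cnj (z - z0)) \<le> e * r" by simp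
    qed
  qed (use d1 d2 in auto)
qed

lemma has_dbar_zero_of_quadratic_bound:
  assumes "C > 0" "d > 0" "\<And>z. dist z z1 < d \<Longrightarrow> cmod (u z) \<le> C * (dist z z1)\<^sup>2"
  shows "has_dbar u 0 z1"
  unfolding has_dbar_def
proof (intro allI impI)
  fix e :: real assume e: "e > 0"
  show "\<exists>d>0. \<forall>r. 0 < r \<and> r < d \<longrightarrow>
      (\<exists>g. g holomorphic_on ball z1 r \<and> (\<forall>z\<in>ball z1 r. cmod (u z - g z - 0 * cnj (z - z1)) \<le> e * r))"
  proof (intro exI[of _ "min d (e / C)"] conjI allI impI)
    show "0 < min d (e / C)" using assms e by simp
    fix r assume r: "0 < r \<and> r < min d (e / C)"
    show "\<exists>g. g holomorphic_on ball z1 r \<and> (\<forall>z\<in>ball z1 r. cmod (u z - g z - 0 * cnj (z - z1)) \<le> e * r)"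
    proof (intro exI[of _ "\<lambda>_. 0"] conjI ballI)
      fix z assume z: "z \<in> ball z1 r"
      have "cmod (u z) \<le> C * (dist z z1)\<^sup>2" using z r by (intro assms(3)) (auto simp: dist_commute)
      also have "\<dots> \<le> C * r\<^sup>2" using z assms(1) by (intro mult_left_mono power_mono) (auto simp: dist_commute)
      also have "\<dots> \<le> e * r" using r assms(1) by (simp add: power2_eq_square field_simps)
      finally show "cmod (u z - 0 - 0 * cnj (z - z1)) \<le> e * r" by simp
    qed simp
  qed
qed

lemma has_dbar_transform:
  assumes "has_dbar u b z0" "open S" "z0 \<in> S" "\<And>z. z \<in> S \<Longrightarrow> v z = u z"
  shows "has_dbar v b z0"
  unfolding has_dbar_def
proof (intro allI impI)
  fix e :: real assume e: "e > 0"
  obtain d where d: "d > 0" "\<And>r. 0 < r \<Longrightarrow> r < d \<Longrightarrow> \<exists>g. g holomorphic_on ball z0 r \<and>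
      (\<forall>z\<in>ball z0 r. cmod (u z - g z - b * cnj (z - z0)) \<le> e * r)"
    by (rule has_dbarE[OF assms(1) e]) blast
  obtain d' where d': "d' > 0" "ball z0 d' \<subseteq> S" using assms(2,3) open_contains_ball by blast
  show "\<exists>d>0. \<forall>r. 0 < r \<and> r < d \<longrightarrow> (\<exists>g. g holomorphic_on ball z0 r \<and>
      (\<forall>z\<in>ball z0 r. cmod (v z - g z - b * cnj (z - z0)) \<le> e * r))"
  proof (intro exI[of _ "min d d'"] conjI allI impI)
    fix r assume r: "0 < r \<and> r < min d d'"
    then obtain g where g: "g holomorphic_on ball z0 r"
      "\<And>z. z\<in>ball z0 r \<Longrightarrow> cmod (u z - g z - b * cnj (z - z0)) \<le> e * r"
      using d(2)[of r] by auto
    have "v z = u z" if "z \<in> ball z0 r" for z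
      using that r d' assms(4) by (auto simp: subset_iff)
    then show "\<exists>g. g holomorphic_on ball z0 r \<and>
        (\<forall>z\<in>ball z0 r. cmod (v z - g z - b * cnj (z - z0)) \<le> e * r)"
      using g by (intro exI[of _ g]) auto
  qed (use d d' in auto)
qed

lemma has_dbar_imp_continuous:
  assumes "has_dbar u b z0"
  shows "isCont u z0"
  unfolding continuous_at_eps_delta
proof (intro allI impI)
  fix e :: real assume e: "e > 0"
  obtain d where d: "d > 0" "\<And>r. 0 < r \<Longrightarrow> r < d \<Longrightarrow> \<exists>g. g holomorphic_on ball z0 r \<and>
      (\<forall>z\<in>ball z0 r. cmod (u z - g z - b * cnj (z - z0)) \<le> 1 * r)"
    using has_dbarE[OF assms, of 1] by auto
  define r where "r = min (d/2) (e/6)"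
  have r: "0 < r" "r < d" "r \<le> e/6" using d e by (auto simp: r_def)
  obtain g where g: "g holomorphic_on ball z0 r"
      "\<And>z. z\<in>ball z0 r \<Longrightarrow> cmod (u z - g z - b * cnj (z - z0)) \<le> 1 * r"
    using d(2)[OF r(1,2)] by auto
  have "continuous_on (ball z0 r) (\<lambda>z. g z + b * cnj (z - z0))"
    by (intro continuous_intros holomorphic_on_imp_continuous_on g)
  then have "isCont (\<lambda>z. g z + b * cnj (z - z0)) z0"
    using r by (simp add: continuous_on_eq_continuous_at)
  then obtain d2 where d2: "d2 > 0" "\<And>z. dist z z0 < d2 \<Longrightarrow>
      dist (g z + b * cnj (z - z0)) (g z0 + b * cnj (z0 - z0)) < e/3"
    unfolding continuous_at_eps_delta using e by (metis zero_less_divide_iff zero_less_numeral)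
  show "\<exists>d>0. \<forall>x'. dist x' z0 < d \<longrightarrow> dist (u x') (u z0) < e"
  proof (intro exI[of _ "min d2 r"] conjI allI impI)
    fix z assume z: "dist z z0 < min d2 r"
    then have zb: "z \<in> ball z0 r" by (simp add: dist_commute)
    have "u z - u z0 = (u z - g z - b * cnj (z - z0)) - (u z0 - g z0 - b * cnj (z0 - z0))
      + ((g z + b * cnj (z - z0)) - (g z0 + b * cnj (z0 - z0)))" by simp
    also have "cmod \<dots> < 1 * r + 1 * r + e/3"
    proof -
      have "cmod ((u z - g z - b * cnj (z - z0)) - (u z0 - g z0 - b * cnj (z0 - z0))) \<le> 1*r+1*r"
        by (rule order_trans[OF norm_triangle_ineq4]) (intro add_mono g zb, use r in auto)
      moreover have "cmod ((g z + b * cnj (z - z0)) - (g z0 + b * cnj (z0 - z0))) < e/3"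
        using d2(2)[of z] z by (simp add: dist_norm)
      ultimately show ?thesis by (meson add_le_less_mono norm_add_less norm_triangle_ineq order_le_less_trans)
    qed
    also have "\<dots> \<le> e" using r by linarith
    finally show "dist (u z) (u z0) < e" by (simp add: dist_norm)
  qed (use d2 r in auto)
qed

text \<open>The integral of the approximating holomorphic function around the triangle is zero, and the error is
  small compared with the diameter and is integrated over a path of length comparable to it.\<close>

lemma dbar_zero_small_triangle:
  assumes u: "has_dbar u 0 x" "continuous_on S u" and "open S" "x \<in> S" and e: "0 < e"
  shows "\<exists>k>0. \<forall>a b c K. K > 0 \<and> K \<le> k \<and> dist a b \<le> K \<and> dist b c \<le> K \<and> dist c a \<le> K \<and>
      x \<in> convex hull {a,b,c} \<longrightarrow>
      cmod (contour_integral (linepath a b) u + contour_integral (linepath b c) u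
        + contour_integral (linepath c a) u) \<le> e * K\<^sup>2"
proof -
  obtain d where d: "d > 0" "\<And>r. 0 < r \<Longrightarrow> r < d \<Longrightarrow> \<exists>g. g holomorphic_on ball x r \<and>
      (\<forall>z\<in>ball x r. cmod (u z - g z - 0 * cnj (z - x)) \<le> e/6 * r)"
    using has_dbarE[OF u(1), of "e/6"] e by auto
  obtain d' where d': "d' > 0" "ball x d' \<subseteq> S" using assms(3,4) open_contains_ball by blast
  define k where "k = min d d' / 4"
  have "cmod (contour_integral (linepath a b) u + contour_integral (linepath b c) u
        + contour_integral (linepath c a) u) \<le> e * K\<^sup>2"
    if K: "K > 0" "K \<le> k" and D: "dist a b \<le> K" "dist b c \<le> K" "dist c a \<le> K"
      and x: "x \<in> convex hull {a,b,c}" for a b c K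
  proof -
    have r: "0 < 2*K" "2*K < d" "2*K < d'" using K d d' by (auto simp: k_def min_def split: if_splits)
    obtain g where g: "g holomorphic_on ball x (2*K)"
       and gu: "\<And>z. z\<in>ball x (2*K) \<Longrightarrow> cmod (u z - g z) \<le> e/6 * (2*K)"
      using d(2)[OF r(1,2)] by auto
    have sub: "convex hull {a,b,c} \<subseteq> ball x (2*K)"
    proof
      fix y assume y: "y \<in> convex hull {a,b,c}"
      have "norm (x - y) \<le> K" using triangle_points_closer[OF x y] D unfolding dist_norm by linarith
      then show "y \<in> ball x (2*K)" using K by (simp add: dist_norm)
    qed
    have segs: "closed_segment a b \<subseteq> convex hull {a,b,c}" "closed_segment b c \<subseteq> convex hull {a,b,c}"
      "closed_segment c a \<subseteq> convex hull {a,b,c}"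
      by (rule segments_subset_convex_hull)+
    have ballS: "ball x (2*K) \<subseteq> S" using d' r by (auto simp: subset_iff)
    have cu: "continuous_on (convex hull {a,b,c}) u"
      using u(2) sub ballS continuous_on_subset by blast
    have gh: "g holomorphic_on (convex hull {a,b,c})" using g sub holomorphic_on_subset by blast
    have cg: "continuous_on (convex hull {a,b,c}) g" using gh holomorphic_on_imp_continuous_on by blast
    have iu: "u contour_integrable_on linepath a b" "u contour_integrable_on linepath b c" "u contour_integrable_on linepath c a"
      by (meson contour_integrable_continuous_linepath continuous_on_subset cu segs)+
    have ig: "g contour_integrable_on linepath a b" "g contour_integrable_on linepath b c" "g contour_integrable_on linepath c a"
      by (meson contour_integrable_continuous_linepath continuous_on_subset cg segs)+
    have g0: "contour_integral (linepath a b) g + contour_integral (linepath b c) g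
        + contour_integral (linepath c a) g = 0"
      using Cauchy_theorem_triangle[OF gh] has_chain_integral_chain_integral3 by blast
    have bound: "cmod (contour_integral (linepath p q) (\<lambda>z. u z - g z)) \<le> e/6 * (2*K) * K"
      if "u contour_integrable_on linepath p q" "g contour_integrable_on linepath p q"
        "closed_segment p q \<subseteq> convex hull {a,b,c}" "dist p q \<le> K" for p q
    proof -
      have "cmod (contour_integral (linepath p q) (\<lambda>z. u z - g z)) \<le> e/6 * (2*K) * cmod (q - p)"
        by (rule contour_integral_bound_linepath)
           (use that e K gu sub in \<open>auto intro!: contour_integrable_diff simp: subset_iff\<close>)
      also have "\<dots> \<le> e/6 * (2*K) * K"
        using that(4) e K by (intro mult_left_mono) (auto simp: dist_norm norm_minus_commute)
      finally show ?thesis .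
    qed
    have "contour_integral (linepath a b) u + contour_integral (linepath b c) u
        + contour_integral (linepath c a) u = contour_integral (linepath a b) (\<lambda>z. u z - g z)
        + contour_integral (linepath b c) (\<lambda>z. u z - g z) + contour_integral (linepath c a) (\<lambda>z. u z - g z)"
      using g0 by (simp add: contour_integral_diff iu ig algebra_simps)
    also have "cmod \<dots> \<le> e/6 * (2*K) * K + e/6 * (2*K) * K + e/6 * (2*K) * K"
      by (intro order_trans[OF norm_triangle_ineq] add_mono bound iu ig segs D)
    also have "\<dots> = e * K\<^sup>2" by (simp add: power2_eq_square)
    finally show ?thesis .
  qed
  moreover have "k > 0" using d d' by (auto simp: k_def)
  ultimately show ?thesis by blast
qed

text \<open>Goursat's proof of Cauchy's theorem by repeated quadrisection uses differentiability at the limit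
  point only through the smallness of integrals around small triangles, which
  \<open>dbar_zero_small_triangle\<close> supplies; Morera's theorem does the rest.\<close>

lemma has_dbar_zero_imp_holomorphic:
  assumes "open S" and u: "\<And>z. z \<in> S \<Longrightarrow> has_dbar u 0 z"
  shows "u holomorphic_on S"
proof -
  have cont: "continuous_on S u"
    by (meson continuous_at_imp_continuous_on has_dbar_imp_continuous u)
  have "u analytic_on S"
  proof (rule Morera_triangle[OF cont \<open>open S\<close>], intro allI impI)
    fix a b c assume abc: "convex hull {a,b,c} \<subseteq> S"
    let ?I = "\<lambda>x y z. contour_integral (linepath x y) u + contour_integral (linepath y z) u
       + contour_integral (linepath z x) u"
    show "?I a b c = 0"
    proof (rule ccontr)
      assume nz: "?I a b c \<noteq> 0"
      define K where "K = 1 + max (dist a b) (max (dist b c) (dist c a))"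
      have K1: "K \<ge> 1"  by (simp add: K_def max.coboundedI1)
      define e where "e = norm (?I a b c) / K^2"
      have e: "e > 0" unfolding e_def using nz K1 by simp
      define At where "At x y z n \<longleftrightarrow>
          convex hull {x,y,z} \<subseteq> convex hull {a,b,c} \<and>
          dist x y \<le> K/2^n \<and> dist y z \<le> K/2^n \<and> dist z x \<le> K/2^n \<and>
          norm (?I x y z) \<ge> e*(K/2^n)^2" for x y z n
      have At0: "At a b c 0"
      proof -
        have "dist a b \<le> K" "dist b c \<le> K" "dist c a \<le> K" unfolding K_def by linarith+
        moreover have "e * K^2 = norm (?I a b c)" using K1 by (simp add: e_def)
        ultimately show ?thesis unfolding At_def by simp
      qed
      have AtSuc: "\<exists>x' y' z'. At x' y' z' (Suc n) \<and> convex hull {x',y',z'} \<subseteq> convex hull {x,y,z}"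
        if At: "At x y z n" for x y z n
      proof -
        have "continuous_on (convex hull {x,y,z}) u"
          using cont abc At unfolding At_def by (meson continuous_on_subset)
        from Cauchy_theorem_quadrisection[OF this, of "K/2^n" e] At
        have "\<exists>x' y' z'. x' \<in> convex hull {x,y,z} \<and> y' \<in> convex hull {x,y,z} \<and> z' \<in> convex hull {x,y,z} \<and>
           dist x' y' \<le> K/2^n/2 \<and> dist y' z' \<le> K/2^n/2 \<and> dist z' x' \<le> K/2^n/2 \<and>
           e * (K/2^n/2)^2 \<le> norm (?I x' y' z')" unfolding At_def by simp
        then obtain x' y' z' where *: "x' \<in> convex hull {x,y,z}" "y' \<in> convex hull {x,y,z}" "z' \<in> convex hull {x,y,z}"
           "dist x' y' \<le> K/2^n/2" "dist y' z' \<le> K/2^n/2" "dist z' x' \<le> K/2^n/2"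
           "e * (K/2^n/2)^2 \<le> norm (?I x' y' z')"
          by (elim exE conjE)
        have "convex hull {x',y',z'} \<subseteq> convex hull {x,y,z}"
          using * by (intro hull_minimal) auto
        moreover have "K/2^n/2 = K/2^Suc n" by simp
        ultimately have "At x' y' z' (Suc n)" using * At unfolding At_def by (metis subset_trans)
        then show ?thesis using \<open>convex hull {x',y',z'} \<subseteq> convex hull {x,y,z}\<close> by blast
      qed
      obtain fa fb fc where fs: "fa 0 = a" "fb 0 = b" "fc 0 = c"
          "\<And>n. At (fa n) (fb n) (fc n) n"
          "\<And>n. convex hull {fa(Suc n), fb(Suc n), fc(Suc n)} \<subseteq> convex hull {fa n, fb n, fc n}"
        by (rule Chain3 [of At, OF At0 AtSuc]) auto
      obtain x where x: "\<And>n. x \<in> convex hull {fa n, fb n, fc n}"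
      proof (rule bounded_closed_nest)
        show "\<And>n. closed (convex hull {fa n, fb n, fc n})"
          by (simp add: compact_imp_closed finite_imp_compact_convex_hull)
        show "\<And>m n. m \<le> n \<Longrightarrow> convex hull {fa n, fb n, fc n} \<subseteq> convex hull {fa m, fb m, fc m}"
          by (erule transitive_stepwise_le) (auto simp: fs)
      qed (fastforce intro: finite_imp_bounded_convex_hull)+
      then have xS: "x \<in> S" using abc fs by blast
      from dbar_zero_small_triangle[OF u[OF xS] cont \<open>open S\<close> xS half_gt_zero[OF e]]
      obtain k where k: "k > 0" "\<forall>a b c K. K > 0 \<and> K \<le> k \<and> dist a b \<le> K \<and> dist b c \<le> K \<and> dist c a \<le> K \<and>
          x \<in> convex hull {a,b,c} \<longrightarrow> cmod (?I a b c) \<le> e/2 * K\<^sup>2"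
        by (elim exE conjE)
      obtain n where "K / k < 2 ^ n" using real_arch_pow[of 2 "K/k"] by auto
      then have "K / 2 ^ n \<le> k" using k by (simp add: field_simps)
      moreover have "K / 2 ^ n > 0" using K1 by simp
      ultimately have "cmod (?I (fa n) (fb n) (fc n)) \<le> e/2 * (K/2^n)\<^sup>2"
        using k(2)[rule_format, of "K/2^n" "fa n" "fb n" "fc n"] fs(4)[of n] x[of n] unfolding At_def by simp
      moreover have "norm (?I (fa n) (fb n) (fc n)) \<ge> e*(K/2^n)^2" using fs(4)[of n] unfolding At_def by blast
      moreover have "e * (K/2^n)\<^sup>2 > 0" using e K1 by simp
      ultimately show False by linarith
    qed
  qed
  then show ?thesis by (rule analytic_imp_holomorphic)
qed

text \<open>Differentiation under the integral sign without a continuity assumption on the derivative: by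
  Fubini and Cauchy the integral over a triangle vanishes, and Morera's theorem applies.\<close>

lemma holomorphic_integral_param:
  fixes f :: "complex \<Rightarrow> real \<Rightarrow> complex"
  assumes "open U" and cont: "continuous_on (U \<times> {a..b}) (\<lambda>(z,t). f z t)"
    and hol: "\<And>t. t \<in> {a..b} \<Longrightarrow> (\<lambda>z. f z t) holomorphic_on U"
  shows "(\<lambda>z. integral {a..b} (f z)) holomorphic_on U"
proof (cases "a < b")
  case False
  then have "{a..b} = {} \<or> {a..b} = {a}" by force
  then show ?thesis by auto
next
  case True
  let ?F = "\<lambda>z w. f z (Re w)"
  let ?h = "linepath (complex_of_real a) (complex_of_real b)"
  have img: "path_image ?h = of_real ` {a..b}"
    using True by (simp only: path_image_linepath closed_segment_of_real) (simp add: closed_segment_eq_real_ivl)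
  have contF: "continuous_on (U \<times> path_image ?h) (\<lambda>(z,w). ?F z w)"
  proof -
    have "continuous_on (U \<times> path_image ?h) ((\<lambda>(z,t). f z t) \<circ> (\<lambda>(z,w). (z, Re w)))"
      by (rule continuous_on_compose[OF _ continuous_on_subset[OF cont]])
         (unfold img, auto simp: split_beta simp del: linepath_of_real intro!: continuous_intros)
    then show ?thesis by (simp add: o_def split_beta)
  qed
  have fz: "continuous_on {a..b} (f z)" if "z \<in> U" for z
  proof -
    have "continuous_on {a..b} (\<lambda>t. (\<lambda>(z,t). f z t) (z,t))"
      by (rule continuous_on_compose2[OF cont]) (use that in \<open>auto intro!: continuous_intros\<close>)
    then show ?thesis by simp
  qed
  have eq: "contour_integral ?h (?F z) = integral {a..b} (f z)" if "z \<in> U" for z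
  proof (rule contour_integral_unique)
    show "(?F z has_contour_integral integral {a..b} (f z)) ?h"
      using True integrable_integral[OF integrable_continuous_real[OF fz[OF that]]]
      by (subst has_contour_integral_linepath_Reals_iff) simp_all
  qed
  have contI: "continuous_on U (\<lambda>z. integral {a..b} (f z))"
    using integral_continuous_on_param[of U a b f] cont by (simp add: cbox_interval)
  have "(\<lambda>z. integral {a..b} (f z)) analytic_on U"
  proof (rule Morera_triangle[OF contI \<open>open U\<close>], intro allI impI)
    fix p q r assume pqr: "convex hull {p,q,r} \<subseteq> U"
    have seg: "closed_segment p q \<subseteq> U" "closed_segment q r \<subseteq> U" "closed_segment r p \<subseteq> U"
      by (rule order_trans[OF _ pqr], rule segments_subset_convex_hull)+
    have sw: "contour_integral (linepath x y) (\<lambda>z. integral {a..b} (f z)) =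
        contour_integral ?h (\<lambda>w. contour_integral (linepath x y) (\<lambda>z. ?F z w))
        \<and> (\<lambda>w. contour_integral (linepath x y) (\<lambda>z. ?F z w)) contour_integrable_on ?h"
      if "closed_segment x y \<subseteq> U" for x y
    proof
      have c: "continuous_on (path_image (linepath x y) \<times> path_image ?h) (\<lambda>(z,w). ?F z w)"
        by (rule continuous_on_subset[OF contF]) (use that in auto)
      have "contour_integral (linepath x y) (\<lambda>z. integral {a..b} (f z)) =
        contour_integral (linepath x y) (\<lambda>z. contour_integral ?h (?F z))"
        by (rule contour_integral_eq) (use that eq in auto)
      also have "\<dots> = contour_integral ?h (\<lambda>w. contour_integral (linepath x y) (\<lambda>z. ?F z w))"
        by (rule contour_integral_swap[OF c]) (auto intro!: continuous_intros simp: vector_derivative_linepath_at)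
      finally show "contour_integral (linepath x y) (\<lambda>z. integral {a..b} (f z)) = \<dots>" .
      have c2: "continuous_on (path_image ?h \<times> cbox 0 1) (\<lambda>(w,s). ?F (linepath x y s) w * (y - x))"
      proof -
        have ci: "continuous_on (path_image ?h \<times> {0..1}) (\<lambda>u. (linepath x y (snd u), fst u))"
          by (auto simp: linepath_def intro!: continuous_intros)
        have "continuous_on (path_image ?h \<times> {0..1}) (\<lambda>u. (\<lambda>(z,w). ?F z w) (linepath x y (snd u), fst u))"
          by (rule continuous_on_compose2[OF c ci]) (auto simp: path_image_def)
        then show ?thesis by (auto simp: split_beta cbox_interval intro!: continuous_intros)
      qed
      have "continuous_on (path_image ?h) (\<lambda>w. contour_integral (linepath x y) (\<lambda>z. ?F z w))"
        using integral_continuous_on_param[OF c2]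
        by (simp add: contour_integral_integral cbox_interval)
      then show "(\<lambda>w. contour_integral (linepath x y) (\<lambda>z. ?F z w)) contour_integrable_on ?h"
        by (intro contour_integrable_continuous_linepath) (simp only: path_image_linepath)
    qed
    let ?J = "\<lambda>x y w. contour_integral (linepath x y) (\<lambda>z. ?F z w)"
    have z0: "?J p q w + ?J q r w + ?J r p w = 0" if "w \<in> path_image ?h" for w
    proof -
      have "(\<lambda>z. ?F z w) holomorphic_on convex hull {p,q,r}"
        using that hol[of "Re w"] pqr unfolding img by (auto intro: holomorphic_on_subset)
      from Cauchy_theorem_triangle[OF this] show ?thesis
        using has_chain_integral_chain_integral3 by blast
    qed
    have "contour_integral ?h (?J p q) + contour_integral ?h (?J q r) + contour_integral ?h (?J r p)
      = contour_integral ?h (\<lambda>w. ?J p q w + ?J q r w + ?J r p w)"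
      using sw[OF seg(1)] sw[OF seg(2)] sw[OF seg(3)]
      by (simp add: contour_integral_add contour_integrable_add)
    also have "\<dots> = contour_integral ?h (\<lambda>w. 0)"
      by (rule contour_integral_eq) (use z0 in auto)
    finally show "contour_integral (linepath p q) (\<lambda>z. integral {a..b} (f z)) +
       contour_integral (linepath q r) (\<lambda>z. integral {a..b} (f z)) +
       contour_integral (linepath r p) (\<lambda>z. integral {a..b} (f z)) = 0"
      using sw[OF seg(1)] sw[OF seg(2)] sw[OF seg(3)] by simp
  qed
  then show ?thesis by (rule analytic_imp_holomorphic)
qed

text \<open>Leibniz' rule: the integrand is holomorphic in \<open>z\<close>, so only the moving end point \<open>T z\<close>
  contributes to the derivative in \<open>cnj z\<close>. As \<open>W\<close> is only continuous at the end point, the integral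
  is compared with the integral up to the fixed limit \<open>A = T z0 - L r\<close>, which lies below \<open>T z\<close> on the
  whole disc of radius \<open>r\<close>; on the short remaining piece \<open>W\<close> is nearly the constant \<open>w0\<close>.\<close>

lemma has_dbar_integral_upper_limit:
  fixes T :: "complex \<Rightarrow> real" and W :: "complex \<Rightarrow> real \<Rightarrow> complex"
  assumes U: "open U" "z0 \<in> U" and Tpos: "\<And>z. z \<in> U \<Longrightarrow> T z > 0"
    and Tder: "(T has_derivative T') (at z0)"
    and contW: "continuous_on {(z,t). z \<in> U \<and> 0 \<le> t \<and> t \<le> T z} (\<lambda>(z,t). W z t)"
    and holW: "\<And>t V. 0 \<le> t \<Longrightarrow> open V \<Longrightarrow> V \<subseteq> U \<Longrightarrow> (\<And>z. z \<in> V \<Longrightarrow> t < T z) \<Longrightarrow> (\<lambda>z. W z t) holomorphic_on V"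
    and T': "\<And>h. complex_of_real (T' h) = a * h + b * cnj h"
  shows "has_dbar (\<lambda>z. integral {0..T z} (W z)) (W z0 (T z0) * b) z0"
  unfolding has_dbar_def
proof (intro allI impI)
  fix e :: real assume e: "e > 0"
  define w0 where "w0 = W z0 (T z0)"
  interpret T': bounded_linear T' using Tder by (rule has_derivative_bounded_linear)
  obtain B where B: "\<And>h. norm (T' h) \<le> norm h * B" "B > 0" using T'.pos_bounded by blast
  \<comment> \<open>a Lipschitz constant of \<open>T\<close> near \<open>z0\<close>\<close>
  define L where "L = B + 1"
  have L: "L > 1" using B by (simp add: L_def)
  define e1 where "e1 = min 1 (e / (2 * (cmod w0 + 1)))"
  define e2 where "e2 = e / (4 * L)"
  have e1: "0 < e1" "e1 \<le> 1" "cmod w0 * e1 \<le> e/2"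
  proof -
    show "0 < e1" using e by (auto simp: e1_def intro!: divide_pos_pos add_nonneg_pos)
    show "e1 \<le> 1" by (simp add: e1_def)
    have "cmod w0 * e1 \<le> (cmod w0 + 1) * (e / (2 * (cmod w0 + 1)))"
      using e by (intro mult_mono) (auto simp: e1_def)
    also have "\<dots> = e/2" using norm_ge_zero[of w0] by (simp add: field_simps del: norm_ge_zero)
    finally show "cmod w0 * e1 \<le> e/2" .
  qed
  have e2: "0 < e2" using e L by (simp add: e2_def)
  obtain d1 where d1: "d1 > 0" "\<And>z. norm (z - z0) < d1 \<Longrightarrow> norm (T z - T z0 - T' (z - z0)) \<le> e1 * norm (z - z0)"
    using Tder e1(1) unfolding has_derivative_at_alt by blast
  have in0: "(z0, T z0) \<in> {(z,t). z \<in> U \<and> 0 \<le> t \<and> t \<le> T z}" using U Tpos[of z0] by auto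
  obtain d2 where d2: "d2 > 0" "\<And>z t. z \<in> U \<Longrightarrow> 0 \<le> t \<Longrightarrow> t \<le> T z \<Longrightarrow> dist (z,t) (z0, T z0) < d2
      \<Longrightarrow> dist (W z t) w0 < e2"
    using contW[unfolded continuous_on_iff, rule_format, OF in0 e2] unfolding w0_def by force
  obtain d3 where d3: "d3 > 0" "ball z0 d3 \<subseteq> U" using U open_contains_ball by blast
  define d where "d = min (min d1 d3) (min (d2/(2*L)) (T z0 / L))"
  have dpos: "d > 0" using d1 d2 d3 L Tpos[OF U(2)] by (auto simp: d_def)
  show "\<exists>d>0. \<forall>r. 0 < r \<and> r < d \<longrightarrow> (\<exists>g. g holomorphic_on ball z0 r \<and>
     (\<forall>z\<in>ball z0 r. cmod (integral {0..T z} (W z) - g z - W z0 (T z0) * b * cnj (z - z0)) \<le> e * r))"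
  proof (intro exI[of _ d] conjI allI impI dpos)
    fix r assume r: "0 < r \<and> r < d"
    then have r: "0 < r" "r < d1" "r < d3" "2 * L * r < d2" "L * r < T z0"
      using L by (auto simp: d_def field_simps)
    define A where "A = T z0 - L * r"
    have A: "A > 0" using r by (simp add: A_def)
    have sub: "ball z0 r \<subseteq> U" using d3 r by (auto simp: subset_iff)
    have lin: "\<bar>T z - T z0 - T' (z - z0)\<bar> \<le> e1 * r" "\<bar>T z - T z0\<bar> < L * r" if "z \<in> ball z0 r" for z
    proof -
      have n: "norm (z - z0) < r" using that by (simp add: dist_norm norm_minus_commute)
      have 1: "\<bar>T z - T z0 - T' (z - z0)\<bar> \<le> e1 * norm (z - z0)" using d1(2)[of z] n r by simp
      also have "\<dots> \<le> e1 * r" using n e1 by (intro mult_left_mono) auto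
      finally show "\<bar>T z - T z0 - T' (z - z0)\<bar> \<le> e1 * r" .
      have "\<bar>T' (z - z0)\<bar> \<le> norm (z - z0) * B" using B(1)[of "z - z0"] by simp
      moreover have "e1 * norm (z - z0) \<le> 1 * norm (z - z0)" using e1 by (intro mult_right_mono) auto
      ultimately have "\<bar>T z - T z0\<bar> \<le> norm (z - z0) * L" using 1 by (simp add: L_def algebra_simps)
      also have "\<dots> < r * L" using n L by simp
      finally show "\<bar>T z - T z0\<bar> < L * r" by (simp add: mult.commute)
    qed
    have AT: "A < T z" if "z \<in> ball z0 r" for z using lin(2)[OF that] by (simp add: A_def)
    have contz: "continuous_on {0..T z} (W z)" if "z \<in> U" for z
    proof -
      have "continuous_on {0..T z} (\<lambda>t. (\<lambda>(z,t). W z t) (z,t))"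
        by (rule continuous_on_compose2[OF contW]) (use that in \<open>auto intro!: continuous_intros\<close>)
      then show ?thesis by simp
    qed
    \<comment> \<open>the holomorphic part: the linearisation of \<open>w0 (T z - A)\<close> without its \<open>cnj z\<close> term\<close>
    define g where "g z = integral {0..A} (W z) + w0 * (of_real (L * r) + a * (z - z0))" for z
    have hol: "(\<lambda>z. integral {0..A} (W z)) holomorphic_on ball z0 r"
    proof (rule holomorphic_integral_param)
      show "continuous_on (ball z0 r \<times> {0..A}) (\<lambda>(z,t). W z t)"
        by (rule continuous_on_subset[OF contW]) (use sub AT in \<open>force simp: subset_iff\<close>)
      show "(\<lambda>z. W z t) holomorphic_on ball z0 r" if "t \<in> {0..A}" for t
        by (rule holW) (use that sub AT in force)+
    qed auto
    have bound: "cmod (integral {0..T z} (W z) - g z - w0 * b * cnj (z - z0)) \<le> e * r"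
      if z: "z \<in> ball z0 r" for z
    proof -
      have zU: "z \<in> U" using z sub by blast
      have ii: "W z integrable_on {0..T z}" by (rule integrable_continuous_real[OF contz[OF zU]])
      have ii2: "W z integrable_on {A..T z}"
        by (rule integrable_continuous_real, rule continuous_on_subset[OF contz[OF zU]]) (use A in auto)
      have "integral {0..T z} (W z) = integral {0..A} (W z) + integral {A..T z} (W z)"
        using Henstock_Kurzweil_Integration.integral_combine[of 0 A "T z" "W z"] A AT[OF z] ii by simp
      moreover have "integral {A..T z} (W z) = integral {A..T z} (\<lambda>t. W z t - w0) + of_real (T z - A) * w0"
        using ii2 AT[OF z] by (subst integral_diff) (auto simp: scaleR_conv_of_real)
      moreover have "g z = integral {0..A} (W z) + w0 * (of_real (L * r) + (of_real (T' (z - z0)) - b * cnj (z - z0)))"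
        unfolding g_def using T'[of "z - z0"] by simp
      ultimately have "integral {0..T z} (W z) - g z - w0 * b * cnj (z - z0)
         = integral {A..T z} (\<lambda>t. W z t - w0) + w0 * of_real (T z - T z0 - T' (z - z0))"
        by (simp add: algebra_simps A_def)
      also have "cmod \<dots> \<le> e2 * (2 * L * r) + cmod w0 * (e1 * r)"
      proof (rule order_trans[OF norm_triangle_ineq], rule add_mono)
        have "cmod (integral {A..T z} (\<lambda>t. W z t - w0)) \<le> e2 * (T z - A)"
        proof (rule integral_bound)
          show "continuous_on {A..T z} (\<lambda>t. W z t - w0)"
            by (intro continuous_intros continuous_on_subset[OF contz[OF zU]]) (use A in auto)
          fix t assume t: "t \<in> {A..T z}"
          have "dist (z,t) (z0, T z0) \<le> dist z z0 + dist t (T z0)"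
            by (simp add: dist_Pair_Pair sqrt_sum_squares_le_sum)
          also have "\<dots> < r + L * r"
          proof (rule add_less_le_mono)
            show "dist z z0 < r" using z by (simp add: dist_commute)
            show "dist t (T z0) \<le> L * r" using t lin(2)[OF z] by (auto simp: dist_real_def A_def abs_if split: if_splits)
          qed
          also have "\<dots> \<le> 2 * L * r" using L r by (simp add: algebra_simps)
          also have "\<dots> < d2" using r by simp
          finally have "dist (W z t) w0 < e2" using t A by (intro d2(2) zU) auto
          then show "cmod (W z t - w0) \<le> e2" by (simp add: dist_norm)
        qed (use AT[OF z] in auto)
        also have "\<dots> \<le> e2 * (2 * L * r)"
          using lin(2)[OF z] e2 by (intro mult_left_mono) (auto simp: A_def abs_if split: if_splits)
        finally show "cmod (integral {A..T z} (\<lambda>t. W z t - w0)) \<le> e2 * (2 * L * r)" .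
        show "cmod (w0 * of_real (T z - T z0 - T' (z - z0))) \<le> cmod w0 * (e1 * r)"
          unfolding norm_mult norm_of_real by (rule mult_left_mono[OF lin(1)[OF z]]) simp
      qed
      also have "e2 * (2 * L * r) = e/2 * r" using L by (simp add: e2_def)
      also have "cmod w0 * (e1 * r) \<le> e/2 * r" using e1(3) r by (simp add: mult.assoc[symmetric])
      finally show ?thesis by (simp add: algebra_simps)
    qed
    show "\<exists>g. g holomorphic_on ball z0 r \<and>
     (\<forall>z\<in>ball z0 r. cmod (integral {0..T z} (W z) - g z - W z0 (T z0) * b * cnj (z - z0)) \<le> e * r)"
    proof (intro exI[of _ g] conjI ballI)
      show "g holomorphic_on ball z0 r" unfolding g_def by (intro holomorphic_intros hol)
    qed (use bound in \<open>simp add: w0_def\<close>)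
  qed
qed

section \<open>Disc extensions depending on a parameter\<close>

lemma maximum_modulus_disc:
  assumes "continuous_on (cball c \<rho>) f" "f holomorphic_on ball c \<rho>" "\<rho> > 0"
    and "\<And>z. z \<in> sphere c \<rho> \<Longrightarrow> cmod (f z) \<le> B" and "w \<in> cball c \<rho>"
  shows "cmod (f w) \<le> B"
  by (rule maximum_modulus_frontier[of f "cball c \<rho>"]) (use assms in auto)

text \<open>By the maximum principle the distance of \<open>h s\<close> and \<open>h s0\<close> on the disc is attained on the circle, where
  compactness makes it uniformly small.\<close>

lemma disc_extensions_jointly_continuous_unit:
  fixes h :: "'a::metric_space \<Rightarrow> complex \<Rightarrow> complex"
  assumes c: "\<And>s. s \<in> S \<Longrightarrow> continuous_on (cball 0 1) (h s)"
    and hol: "\<And>s. s \<in> S \<Longrightarrow> h s holomorphic_on ball 0 1"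
    and b: "continuous_on (S \<times> sphere 0 1) (\<lambda>(s,z). h s z)"
  shows "continuous_on (S \<times> cball 0 1) (\<lambda>(s,z). h s z)"
  unfolding continuous_on_iff
proof (intro ballI allI impI)
  fix x e assume x: "x \<in> S \<times> cball (0::complex) 1" and e: "(0::real) < e"
  obtain s0 z0 where x0: "x = (s0,z0)" "s0 \<in> S" "z0 \<in> cball 0 1" using x by auto
  obtain X0 where X0: "s0 \<in> X0" "open X0"
    "\<forall>s\<in>X0 \<inter> S. \<forall>z\<in>sphere 0 1. dist (case (s,z) of (s,z) \<Rightarrow> h s z) (case (s0,z) of (s,z) \<Rightarrow> h s z) \<le> e/2"
    by (rule continuous_on_prod_compactE[OF b _ x0(2), of "e/2"]) (use e in auto)
  obtain d1 where d1: "d1 > 0" "ball s0 d1 \<subseteq> X0" using X0 open_contains_ball by blast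
  obtain d2 where d2: "d2 > 0" "\<And>z. z \<in> cball 0 1 \<Longrightarrow> dist z z0 < d2 \<Longrightarrow> dist (h s0 z) (h s0 z0) < e/2"
    using c[OF x0(2)] x0(3) e unfolding continuous_on_iff by (meson half_gt_zero)
  show "\<exists>d>0. \<forall>x'\<in>S \<times> cball 0 1. dist x' x < d \<longrightarrow>
      dist (case x' of (s, z) \<Rightarrow> h s z) (case x of (s, z) \<Rightarrow> h s z) < e"
  proof (intro exI[of _ "min d1 d2"] conjI ballI impI)
    fix x' assume x': "x' \<in> S \<times> cball (0::complex) 1" "dist x' x < min d1 d2"
    obtain s z where sz: "x' = (s,z)" "s \<in> S" "z \<in> cball 0 1" using x' by auto
    have "dist s s0 < d1" "dist z z0 < d2"
      using x'(2) dist_fst_le[of x' x] dist_snd_le[of x' x] unfolding sz x0 by auto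
    then have s: "s \<in> X0" using d1(2) by (auto simp: dist_commute)
    have "cmod (h s z - h s0 z) \<le> e/2"
    proof (rule maximum_modulus_disc[of 0 1 "\<lambda>z. h s z - h s0 z"])
      show "cmod (h s z - h s0 z) \<le> e/2" if "z \<in> sphere 0 1" for z
        using X0(3) s sz(2) that by (auto simp: dist_norm)
    qed (use sz x0 in \<open>auto intro!: continuous_intros holomorphic_intros c hol\<close>)
    moreover have "dist (h s0 z) (h s0 z0) < e/2" using d2(2)[OF sz(3)] \<open>dist z z0 < d2\<close> .
    ultimately have "dist (h s z) (h s0 z0) < e"
      using dist_triangle[of "h s z" "h s0 z0" "h s0 z"] unfolding dist_norm by linarith
    then show "dist (case x' of (s, z) \<Rightarrow> h s z) (case x of (s, z) \<Rightarrow> h s z) < e" by (simp add: sz x0)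
  qed (use d1 d2 in auto)
qed

lemma disc_extensions_jointly_continuous:
  fixes h :: "'a::metric_space \<Rightarrow> complex \<Rightarrow> complex" and c :: "'a \<Rightarrow> complex" and \<rho> :: "'a \<Rightarrow> real"
  assumes c: "continuous_on S c" and \<rho>: "continuous_on S \<rho>" "\<And>s. s \<in> S \<Longrightarrow> \<rho> s > 0"
    and h: "\<And>s. s \<in> S \<Longrightarrow> continuous_on (cball (c s) (\<rho> s)) (h s)"
    and hol: "\<And>s. s \<in> S \<Longrightarrow> h s holomorphic_on ball (c s) (\<rho> s)"
    and b: "continuous_on {(s,z). s \<in> S \<and> z \<in> sphere (c s) (\<rho> s)} (\<lambda>(s,z). h s z)"
  shows "continuous_on {(s,z). s \<in> S \<and> z \<in> cball (c s) (\<rho> s)} (\<lambda>(s,z). h s z)"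
proof -
  let ?k = "\<lambda>s (\<zeta>::complex). h s (c s + complex_of_real (\<rho> s) * \<zeta>)"
  have c2: "continuous_on (S \<times> X) (\<lambda>u. c (fst u) + complex_of_real (\<rho> (fst u)) * snd u)" for X :: "complex set"
    by (intro continuous_intros continuous_on_compose2[OF c] continuous_on_compose2[OF \<rho>(1)]) auto
  have "continuous_on (S \<times> cball 0 1) (\<lambda>(s,\<zeta>). ?k s \<zeta>)"
  proof (rule disc_extensions_jointly_continuous_unit)
    fix s assume s: "s \<in> S"
    show "continuous_on (cball 0 1) (?k s)"
      by (rule continuous_on_compose2[OF h[OF s]])
         (use \<rho>(2)[OF s] in \<open>auto intro!: continuous_intros simp: dist_norm norm_mult\<close>)
    have "h s \<circ> (\<lambda>\<zeta>. c s + complex_of_real (\<rho> s) * \<zeta>) holomorphic_on ball 0 1"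
      by (rule holomorphic_on_compose_gen[OF _ hol[OF s]])
         (use \<rho>(2)[OF s] in \<open>auto intro!: holomorphic_intros simp: dist_norm norm_mult\<close>)
    then show "?k s holomorphic_on ball 0 1" by (simp add: o_def)
  next
    have "continuous_on (S \<times> sphere 0 1) (\<lambda>u. (\<lambda>(s,z). h s z) (fst u, c (fst u) + complex_of_real (\<rho> (fst u)) * snd u))"
      by (rule continuous_on_compose2[OF b])
         (use \<rho>(2) in \<open>auto intro!: continuous_intros c2 simp: dist_norm norm_mult abs_of_pos\<close>)
    then show "continuous_on (S \<times> sphere 0 1) (\<lambda>(s,\<zeta>). ?k s \<zeta>)" by (simp add: split_beta)
  qed
  then have *: "continuous_on (S \<times> cball 0 1) (\<lambda>u. ?k (fst u) (snd u))" by (simp add: split_beta)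
  let ?D = "{(s,z). s \<in> S \<and> z \<in> cball (c s) (\<rho> s)}"
  have "continuous_on ?D (\<lambda>u. (\<lambda>u. ?k (fst u) (snd u)) (fst u, (snd u - c (fst u)) / \<rho> (fst u)))"
  proof (rule continuous_on_compose2[OF *])
    show "continuous_on ?D (\<lambda>u. (fst u, (snd u - c (fst u)) / complex_of_real (\<rho> (fst u))))"
      by (intro continuous_intros continuous_on_compose2[OF c] continuous_on_compose2[OF \<rho>(1)])
         (use \<rho>(2) in \<open>force+\<close>)
    show "(\<lambda>u. (fst u, (snd u - c (fst u)) / complex_of_real (\<rho> (fst u)))) ` ?D \<subseteq> S \<times> cball 0 1"
      using \<rho>(2) by (auto simp: dist_norm norm_divide norm_minus_commute divide_le_eq_1 abs_of_pos)
  qed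
  then show ?thesis
    by (rule continuous_on_eq) (use \<rho>(2) in force)
qed

section \<open>Fejer means and Fourier coefficients\<close>

definition fourier_coeff :: "(real \<Rightarrow> complex) \<Rightarrow> int \<Rightarrow> complex" where
  "fourier_coeff u k = integral {-pi..pi} (\<lambda>\<theta>. u \<theta> * cis (- (of_int k * \<theta>))) / (2 * pi)"

text \<open>The mean of the first \<open>N\<close> symmetric partial sums of the Fourier series at \<open>0\<close>: the double sum
  counts the coefficient of index \<open>d\<close> exactly \<open>N - \<bar>d\<bar>\<close> times. In this form it is visibly the integral
  against the square \<open>fejer_kernel\<close>.\<close>

definition fejer_mean :: "nat \<Rightarrow> (real \<Rightarrow> complex) \<Rightarrow> complex" where
  "fejer_mean N u = (\<Sum>j<N. \<Sum>l<N. fourier_coeff u (int j - int l)) / N"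

definition fejer_kernel :: "nat \<Rightarrow> real \<Rightarrow> real" where
  "fejer_kernel N \<theta> = (cmod (\<Sum>j<N. cis (of_nat j * \<theta>)))\<^sup>2"

lemma continuous_on_cis_real [continuous_intros]:
  "continuous_on A f \<Longrightarrow> continuous_on A (\<lambda>x. cis (f x))"
  unfolding cis_conv_exp by (intro continuous_intros)

lemma integral_cis_period:
  fixes k :: int assumes "k \<noteq> 0"
  shows "((\<lambda>\<theta>. cis (of_int k * \<theta>)) has_integral 0) {-pi..pi}"
proof -
  have "((\<lambda>\<theta>. cis (of_int k * \<theta>)) has_integral
      (cis (of_int k * pi) / (\<i> * of_int k) - cis (of_int k * (-pi)) / (\<i> * of_int k))) {-pi..pi}"
  proof (rule fundamental_theorem_of_calculus)
    fix x :: real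
    have "((\<lambda>z. exp (\<i> * (of_int k * z)) / (\<i> * of_int k)) has_field_derivative
        exp (\<i> * (of_int k * of_real x))) (at (of_real x))"
      using assms by (auto intro!: derivative_eq_intros simp: field_simps)
    then have "((\<lambda>\<theta>. exp (\<i> * (of_int k * of_real \<theta>)) / (\<i> * of_int k)) has_vector_derivative
        exp (\<i> * (of_int k * of_real x))) (at x within {-pi..pi})"
      by (rule has_vector_derivative_real_field)
    then show "((\<lambda>\<theta>. cis (of_int k * \<theta>) / (\<i> * of_int k)) has_vector_derivative cis (of_int k * x)) (at x within {-pi..pi})"
      by (simp add: cis_conv_exp mult_ac)
  qed simp
  moreover have "cis (of_int k * pi) = cis (of_int k * (-pi))"
    by (simp add: complex_eq_iff sin_times_pi_eq_0 sin_integer_2pi)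
  ultimately show ?thesis by simp
qed

lemma fejer_kernel_expand:
  "of_real (fejer_kernel N \<theta>) = (\<Sum>j<N. \<Sum>l<N. cis (- (of_int (int j - int l) * \<theta>)))"
proof -
  have "of_real (fejer_kernel N \<theta>) = (\<Sum>j<N. cis (of_nat j * \<theta>)) * cnj (\<Sum>j<N. cis (of_nat j * \<theta>))"
    unfolding fejer_kernel_def by (rule complex_norm_square)
  also have "\<dots> = (\<Sum>l<N. \<Sum>j<N. cis (of_nat l * \<theta>) * cis (- (of_nat j * \<theta>)))"
    by (simp add: cis_cnj sum_product)
  also have "\<dots> = (\<Sum>j<N. \<Sum>l<N. cis (of_nat l * \<theta>) * cis (- (of_nat j * \<theta>)))"
    by (rule sum.swap)
  finally show ?thesis by (simp add: cis_mult algebra_simps)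
qed

lemma continuous_on_fejer_kernel [continuous_intros]: "continuous_on A (fejer_kernel N)"
  unfolding fejer_kernel_def by (intro continuous_intros)

lemma fejer_mean_kernel:
  assumes "continuous_on {-pi..pi} u"
  shows "fejer_mean N u = integral {-pi..pi} (\<lambda>\<theta>. u \<theta> * of_real (fejer_kernel N \<theta>)) / (2 * pi * N)"
proof -
  have "integral {-pi..pi} (\<lambda>\<theta>. u \<theta> * of_real (fejer_kernel N \<theta>))
     = integral {-pi..pi} (\<lambda>\<theta>. \<Sum>j<N. \<Sum>l<N. u \<theta> * cis (- (of_int (int j - int l) * \<theta>)))"
    by (simp only: fejer_kernel_expand sum_distrib_left)
  also have "\<dots> = (\<Sum>j<N. integral {-pi..pi} (\<lambda>\<theta>. \<Sum>l<N. u \<theta> * cis (- (of_int (int j - int l) * \<theta>))))"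
    by (intro integral_sum integrable_continuous_real continuous_intros assms) auto
  also have "\<dots> = (\<Sum>j<N. \<Sum>l<N. integral {-pi..pi} (\<lambda>\<theta>. u \<theta> * cis (- (of_int (int j - int l) * \<theta>))))"
    by (intro sum.cong refl integral_sum integrable_continuous_real continuous_intros assms) auto
  finally show ?thesis unfolding fejer_mean_def fourier_coeff_def
    by (simp add: sum_divide_distrib mult_ac)
qed

lemma integral_fejer_kernel: "(fejer_kernel N has_integral 2 * pi * N) {-pi..pi}"
proof -
  have c: "((\<lambda>\<theta>. cis (- (of_int (int j - int l) * \<theta>))) has_integral (if j = l then 2 * of_real pi else 0)) {-pi..pi}" for j l
  proof (cases "j = l")
    case True
    then show ?thesis using has_integral_const_real[of "1::complex" "-pi" pi] by (simp add: scaleR_conv_of_real)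
  next
    case False
    then show ?thesis using integral_cis_period[of "int l - int j"] by (simp add: algebra_simps)
  qed
  have "((\<lambda>\<theta>. complex_of_real (fejer_kernel N \<theta>)) has_integral
     (\<Sum>j<N. \<Sum>l<N. if j = l then 2 * of_real pi else 0)) {-pi..pi}"
    unfolding fejer_kernel_expand by (intro has_integral_sum c) auto
  then have "((\<lambda>\<theta>. complex_of_real (fejer_kernel N \<theta>)) has_integral of_real (2 * pi * N)) {-pi..pi}"
    by (simp add: sum.delta mult_ac)
  from has_integral_linear[OF this bounded_linear_Re] show ?thesis by (simp add: o_def)
qed

text \<open>The geometric sum \<open>(1 - cis \<theta> ^ N) / (1 - cis \<theta>)\<close> is bounded independently of \<open>N\<close> away from
  \<open>\<theta> = 0\<close>.\<close>

lemma fejer_kernel_bound: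
  assumes "0 < \<delta>" "\<delta> \<le> \<bar>\<theta>\<bar>" "\<bar>\<theta>\<bar> \<le> pi"
  shows "fejer_kernel N \<theta> \<le> 4 / (2 - 2 * cos \<delta>)"
proof -
  have cd: "cos \<theta> \<le> cos \<delta>" "cos \<delta> < 1"
  proof -
    have "cos \<bar>\<theta>\<bar> \<le> cos \<delta>" using assms by (intro cos_monotone_0_pi_le) auto
    then show "cos \<theta> \<le> cos \<delta>" by simp
    show "cos \<delta> < 1" using cos_monotone_0_pi[of 0 \<delta>] assms by simp
  qed
  have n: "(cmod (1 - cis \<theta>))\<^sup>2 = 2 - 2 * cos \<theta>"
  proof -
    have "(cmod (1 - cis \<theta>))\<^sup>2 = (1 - cos \<theta>)\<^sup>2 + (sin \<theta>)\<^sup>2" by (simp add: cmod_power2)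
    also have "\<dots> = 1 - 2 * cos \<theta> + ((sin \<theta>)\<^sup>2 + (cos \<theta>)\<^sup>2)" by (simp add: power2_eq_square algebra_simps)
    finally show ?thesis by simp
  qed
  have "(1 - cis \<theta>) * (\<Sum>j<N. cis (of_nat j * \<theta>)) = 1 - cis \<theta> ^ N"
    unfolding one_diff_power_eq[of "cis \<theta>" N] by (simp add: Complex.DeMoivre)
  then have "cmod (1 - cis \<theta>) * cmod (\<Sum>j<N. cis (of_nat j * \<theta>)) \<le> 2"
    using norm_triangle_ineq4[of 1 "cis \<theta> ^ N"] by (simp add: norm_mult[symmetric] norm_power)
  then have "(cmod (1 - cis \<theta>) * cmod (\<Sum>j<N. cis (of_nat j * \<theta>)))\<^sup>2 \<le> 2\<^sup>2"
    by (intro power_mono) auto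
  then have le: "(2 - 2 * cos \<theta>) * fejer_kernel N \<theta> \<le> 4"
    by (simp add: power_mult_distrib n fejer_kernel_def)
  have "(2 - 2 * cos \<delta>) * fejer_kernel N \<theta> \<le> (2 - 2 * cos \<theta>) * fejer_kernel N \<theta>"
    using cd by (intro mult_right_mono) (auto simp: fejer_kernel_def)
  with le cd show ?thesis by (simp add: field_simps)
qed

text \<open>An explicit bound, because it will be needed uniformly in a family of functions \<open>u\<close> with a
  common modulus of continuity.\<close>

lemma fejer_mean_approx:
  assumes u: "continuous_on {-pi..pi} u" and \<delta>: "0 < \<delta>" "\<delta> \<le> pi"
    and B: "\<And>\<theta>. \<bar>\<theta>\<bar> \<le> pi \<Longrightarrow> cmod (u \<theta>) \<le> B"
    and e: "\<And>\<theta>. \<bar>\<theta>\<bar> \<le> \<delta> \<Longrightarrow> cmod (u \<theta> - u 0) \<le> e" and N: "N > 0"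
  shows "cmod (fejer_mean N u - u 0) \<le> e + 8 * B / (2 - 2 * cos \<delta>) / N"
proof -
  define M where "M = 4 / (2 - 2 * cos \<delta>)"
  have e0: "e \<ge> 0" using e[of 0] \<delta> by simp
  have B0: "B \<ge> 0" using B[of 0] order_trans[OF norm_ge_zero, of "u 0" B] by simp
  have k0: "fejer_kernel N \<theta> \<ge> 0" for \<theta> by (simp add: fejer_kernel_def)
  have M0: "M \<ge> 0" unfolding M_def by simp
  have pt: "cmod ((u \<theta> - u 0) * of_real (fejer_kernel N \<theta>)) \<le> e * fejer_kernel N \<theta> + 2 * B * M"
    if "\<theta> \<in> {-pi..pi}" for \<theta>
  proof (cases "\<bar>\<theta>\<bar> \<le> \<delta>")
    case True
    have "cmod ((u \<theta> - u 0) * of_real (fejer_kernel N \<theta>)) \<le> e * fejer_kernel N \<theta>"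
      unfolding norm_mult using e[OF True] k0[of \<theta>] by (simp add: mult_right_mono)
    also have "\<dots> \<le> e * fejer_kernel N \<theta> + 2 * B * M" using B0 M0 by simp
    finally show ?thesis .
  next
    case False
    have "cmod (u \<theta> - u 0) \<le> 2 * B"
      using norm_triangle_ineq4[of "u \<theta>" "u 0"] B[of \<theta>] B[of 0] that by force
    then have "cmod ((u \<theta> - u 0) * of_real (fejer_kernel N \<theta>)) \<le> 2 * B * M"
      unfolding norm_mult using k0[of \<theta>] fejer_kernel_bound[of \<delta> \<theta> N] False that \<delta> B0
      by (intro mult_mono) (auto simp: M_def)
    also have "\<dots> \<le> e * fejer_kernel N \<theta> + 2 * B * M" using e0 k0 by simp
    finally show ?thesis .
  qed
  have kc: "((\<lambda>\<theta>. complex_of_real (fejer_kernel N \<theta>)) has_integral of_real (2 * pi * N)) {-pi..pi}"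
    using has_integral_linear[OF integral_fejer_kernel bounded_linear_of_real] by (simp add: o_def)
  have ik: "integral {-pi..pi} (\<lambda>\<theta>. u 0 * of_real (fejer_kernel N \<theta>)) = u 0 * of_real (2 * pi * N)"
    using has_integral_mult_right[OF kc, of "u 0"] by (rule integral_unique)
  have "integral {-pi..pi} (\<lambda>\<theta>. (u \<theta> - u 0) * of_real (fejer_kernel N \<theta>))
     = integral {-pi..pi} (\<lambda>\<theta>. u \<theta> * of_real (fejer_kernel N \<theta>)) - u 0 * of_real (2 * pi * N)"
    unfolding ik[symmetric] left_diff_distrib
    by (intro integral_diff integrable_continuous_real continuous_intros u)
  then have eq: "fejer_mean N u - u 0 = integral {-pi..pi} (\<lambda>\<theta>. (u \<theta> - u 0) * of_real (fejer_kernel N \<theta>)) / (2 * pi * N)"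
    using N unfolding fejer_mean_kernel[OF u] by (simp add: field_simps)
  have hi: "((\<lambda>\<theta>. e * fejer_kernel N \<theta> + 2 * B * M) has_integral (e * (2 * pi * N) + (2 * pi) * (2 * B * M))) {-pi..pi}"
    using has_integral_add[OF has_integral_mult_right[OF integral_fejer_kernel, of e]
       has_integral_const_real[of "2 * B * M" "-pi" pi]] by simp
  have "cmod (integral {-pi..pi} (\<lambda>\<theta>. (u \<theta> - u 0) * of_real (fejer_kernel N \<theta>))) \<le> e * (2 * pi * N) + (2 * pi) * (2 * B * M)"
    unfolding integral_unique[OF hi, symmetric]
    by (rule integral_norm_bound_integral) (auto intro!: integrable_continuous_real continuous_intros u pt)
  then have "cmod (fejer_mean N u - u 0) \<le> (e * (2 * pi * N) + (2 * pi) * (2 * B * M)) / (2 * pi * N)"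
    unfolding eq norm_divide using N by (simp add: norm_mult divide_right_mono)
  also have "\<dots> = e + 2 * B * M / N" using N by (simp add: field_simps)
  finally show ?thesis by (simp add: M_def)
qed

lemma integral_periodic_shift:
  fixes u :: "real \<Rightarrow> complex"
  assumes u: "continuous_on UNIV u" and per: "\<And>\<theta>. u (\<theta> + 2 * pi) = u \<theta>" and c: "0 \<le> c" "c \<le> 2 * pi"
  shows "integral {-pi..pi} (\<lambda>\<theta>. u (\<theta> + c)) = integral {-pi..pi} u"
proof -
  have ii: "u integrable_on {a..b}" for a b
    by (rule integrable_continuous_real, rule continuous_on_subset[OF u]) auto
  have "integral {-pi..pi} (\<lambda>\<theta>. u (\<theta> + c)) = integral {-pi+c..pi+c} u"
    using integral_shift[of "-pi" c pi u] continuous_on_subset[OF u] by (simp add: o_def)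
  also have "\<dots> = integral {-pi+c..pi} u + integral {pi..pi+c} u"
    using Henstock_Kurzweil_Integration.integral_combine[of "-pi+c" pi "pi+c" u] ii c by simp
  also have "integral {pi..pi+c} u = integral {-pi+2*pi..(-pi+c)+2*pi} u" by (simp add: algebra_simps)
  also have "\<dots> = integral {-pi..-pi+c} (u \<circ> (\<lambda>x. x + 2 * pi))"
    by (rule integral_shift[symmetric]) (rule continuous_on_subset[OF u], auto)
  also have "\<dots> = integral {-pi..-pi+c} u" by (simp add: o_def per)
  also have "integral {-pi+c..pi} u + integral {-pi..-pi+c} u = integral {-pi..pi} u"
    using Henstock_Kurzweil_Integration.integral_combine[of "-pi" "-pi+c" pi u] ii c by (simp add: add.commute)
  finally show ?thesis .
qed

lemma integral_0_2pi:
  fixes u :: "real \<Rightarrow> complex"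
  assumes u: "continuous_on UNIV u" and per: "\<And>\<theta>. u (\<theta> + 2 * pi) = u \<theta>"
  shows "integral {0..2 * pi} u = integral {-pi..pi} u"
proof -
  have "integral {-pi..pi} (u \<circ> (\<lambda>x. x + pi)) = integral {-pi + pi..pi + pi} u"
    by (rule integral_shift) (rule continuous_on_subset[OF u], simp)
  then show ?thesis using integral_periodic_shift[OF u per, of pi] by (simp add: o_def)
qed

lemma fourier_coeff_shift:
  assumes u: "continuous_on UNIV u" and per: "\<And>\<theta>. u (\<theta> + 2 * pi) = u \<theta>" and c: "0 \<le> c" "c \<le> 2 * pi"
  shows "fourier_coeff (\<lambda>\<theta>. u (\<theta> + c)) k = cis (of_int k * c) * fourier_coeff u k"
proof -
  let ?v = "\<lambda>\<theta>. u \<theta> * cis (- (of_int k * \<theta>))"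
  have per': "cis (- (of_int k * (\<theta> + 2 * pi))) = cis (- (of_int k * \<theta>))" for \<theta>
  proof -
    have "cis (- (of_int k * (\<theta> + 2 * pi))) = cis (- (of_int k * \<theta>)) * cis (2 * pi * of_int (-k))"
      by (simp add: cis_mult algebra_simps)
    also have "cis (2 * pi * of_int (-k)) = 1" by (rule cis_multiple_2pi) simp
    finally show ?thesis by simp
  qed
  have "integral {-pi..pi} (\<lambda>\<theta>. ?v (\<theta> + c)) = integral {-pi..pi} ?v"
    by (rule integral_periodic_shift[OF _ _ c]) (auto intro!: continuous_intros u simp: per per')
  moreover have "u (\<theta> + c) * cis (- (of_int k * \<theta>)) = cis (of_int k * c) * ?v (\<theta> + c)" for \<theta>
  proof -
    have "cis (- (of_int k * \<theta>)) = cis (of_int k * c) * cis (- (of_int k * (\<theta> + c)))"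
      by (simp add: cis_mult algebra_simps)
    then show ?thesis by (simp only: mult_ac)
  qed
  ultimately show ?thesis unfolding fourier_coeff_def by (simp only: integral_mult_right times_divide_eq_right)
qed

text \<open>All Fejer means of all rotations vanish, and those of a rotation converge to its value at \<open>1\<close>.\<close>

lemma circle_function_eq_0_if_fourier_coeffs_0:
  assumes y: "continuous_on (sphere 0 1) y" and 0: "\<And>k. fourier_coeff (\<lambda>\<theta>. y (cis \<theta>)) k = 0"
    and z: "z \<in> sphere 0 1"
  shows "y z = 0"
proof -
  have cy: "continuous_on UNIV (\<lambda>\<theta>. y (cis \<theta>))"
    by (rule continuous_on_compose2[OF y]) (auto intro!: continuous_intros)
  have "compact (y ` sphere 0 1)" using y by (intro compact_continuous_image) auto
  then obtain B where B: "\<And>z. z \<in> sphere 0 1 \<Longrightarrow> cmod (y z) \<le> B"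
    using compact_imp_bounded bounded_iff by (metis imageI)
  obtain c where c: "0 \<le> c" "c < 2 * pi" "z = cis c"
  proof -
    have "z = cis (Arg2pi z)" using Arg2pi_eq[of z] z by (simp add: cis_conv_exp)
    then show ?thesis using that[of "Arg2pi z"] Arg2pi_ge_0 Arg2pi_lt_2pi by auto
  qed
  let ?u = "\<lambda>\<theta>. y (cis (\<theta> + c))"
  have per: "cis (\<theta> + 2 * pi) = cis \<theta>" for \<theta> by (simp add: complex_eq_iff)
  have cu: "continuous_on UNIV ?u"
    by (rule continuous_on_compose2[OF y]) (auto intro!: continuous_intros)
  have "fourier_coeff ?u k = 0" for k
    using fourier_coeff_shift[OF cy, of c k] per c 0[of k] by simp
  then have f0: "fejer_mean N ?u = 0" for N by (simp add: fejer_mean_def)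
  have "cmod (?u 0) \<le> e" if e: "e > 0" for e
  proof -
    have "isCont ?u 0" using cu by (simp add: continuous_on_eq_continuous_at)
    then obtain d where d: "d > 0" "\<And>\<theta>. \<bar>\<theta>\<bar> < d \<Longrightarrow> cmod (?u \<theta> - ?u 0) < e/2"
    proof -
      obtain d where "d > 0" "\<forall>\<theta>. dist \<theta> 0 < d \<longrightarrow> dist (?u \<theta>) (?u 0) < e/2"
        using \<open>isCont ?u 0\<close> e unfolding continuous_at_eps_delta by (meson half_gt_zero)
      then show ?thesis using that[of d] by (simp add: dist_norm)
    qed
    define \<delta> where "\<delta> = min (d/2) pi"
    have \<delta>: "0 < \<delta>" "\<delta> \<le> pi" "\<delta> < d" using d(1) by (auto simp: \<delta>_def)
    obtain N :: nat where N: "N > 0" "8 * B / (2 - 2 * cos \<delta>) / N < e/2"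
    proof -
      have "(\<lambda>n. 8 * B / (2 - 2 * cos \<delta>) / real n) \<longlonglongrightarrow> 0" by (rule lim_const_over_n)
      then have "\<forall>\<^sub>F n in sequentially. 8 * B / (2 - 2 * cos \<delta>) / real n < e/2"
        using e by (intro order_tendstoD(2)) auto
      then have "\<forall>\<^sub>F n in sequentially. n > 0 \<and> 8 * B / (2 - 2 * cos \<delta>) / real n < e/2"
        using eventually_gt_at_top[of 0] by eventually_elim auto
      then show ?thesis using that by (auto simp: eventually_sequentially)
    qed
    have "cmod (fejer_mean N ?u - ?u 0) \<le> e/2 + 8 * B / (2 - 2 * cos \<delta>) / N"
    proof (rule fejer_mean_approx[OF _ \<delta>(1,2) _ _ N(1)])
      show "continuous_on {-pi..pi} ?u" by (rule continuous_on_subset[OF cu]) simp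
      show "cmod (?u \<theta>) \<le> B" for \<theta> by (rule B) simp
      show "cmod (?u \<theta> - ?u 0) \<le> e/2" if "\<bar>\<theta>\<bar> \<le> \<delta>" for \<theta>
        by (rule less_imp_le, rule d(2)) (use that \<delta>(3) in linarith)
    qed
    also have "\<dots> \<le> e" using N by simp
    finally show ?thesis by (simp add: f0)
  qed
  then have "cmod (?u 0) \<le> 0" by (meson dense_ge)
  then show ?thesis by (simp add: c)
qed

lemma circle_function_polynomial_if_fourier_coeffs_0:
  assumes y: "continuous_on (sphere 0 1) y"
    and 0: "\<And>k. k < 0 \<or> k > int m \<Longrightarrow> fourier_coeff (\<lambda>\<theta>. y (cis \<theta>)) k = 0"
  obtains c where "\<And>z. z \<in> sphere 0 1 \<Longrightarrow> y z = (\<Sum>j\<le>m. c j * z ^ j)"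
proof -
  define c where "c j = fourier_coeff (\<lambda>\<theta>. y (cis \<theta>)) (int j)" for j
  let ?r = "\<lambda>z. y z - (\<Sum>j\<le>m. c j * z ^ j)"
  have cy: "continuous_on UNIV (\<lambda>\<theta>. y (cis \<theta>))"
    by (rule continuous_on_compose2[OF y]) (auto intro!: continuous_intros)
  have mono: "((\<lambda>\<theta>. c j * cis \<theta> ^ j * cis (- (of_int k * \<theta>))) has_integral
      (if int j = k then 2 * pi * c j else 0)) {-pi..pi}" for j k
  proof (cases "int j = k")
    case True
    have "c j * cis \<theta> ^ j * cis (- (of_int k * \<theta>)) = c j" for \<theta>
    proof -
      have "cis \<theta> ^ j * cis (- (of_int k * \<theta>)) = 1"
        unfolding True[symmetric] Complex.DeMoivre cis_mult by simp
      then show ?thesis by (simp only: mult.assoc mult_1_right)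
    qed
    note eq = this
    show ?thesis unfolding eq using True has_integral_const_real[of "c j" "-pi" pi] by (simp add: scaleR_conv_of_real)
  next
    case False
    have "c j * cis \<theta> ^ j * cis (- (of_int k * \<theta>)) = c j * cis (of_int (int j - k) * \<theta>)" for \<theta>
    proof -
      have "cis \<theta> ^ j * cis (- (of_int k * \<theta>)) = cis (of_int (int j - k) * \<theta>)"
        unfolding Complex.DeMoivre cis_mult by (simp add: left_diff_distrib)
      then show ?thesis by (simp only: mult.assoc)
    qed
    note eq = this
    show ?thesis unfolding eq using False has_integral_mult_right[OF integral_cis_period[of "int j - k"], of "c j"] by simp
  qed
  have "fourier_coeff (\<lambda>\<theta>. ?r (cis \<theta>)) k = 0" for k
  proof -
    have "((\<lambda>\<theta>. y (cis \<theta>) * cis (- (of_int k * \<theta>)) - (\<Sum>j\<le>m. c j * cis \<theta> ^ j * cis (- (of_int k * \<theta>)))) has_integral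
       (integral {-pi..pi} (\<lambda>\<theta>. y (cis \<theta>) * cis (- (of_int k * \<theta>))) - (\<Sum>j\<le>m. if int j = k then 2 * pi * c j else 0))) {-pi..pi}"
      by (intro has_integral_diff has_integral_sum mono integrable_integral integrable_continuous_real
           continuous_intros continuous_on_subset[OF cy]) auto
    then have "fourier_coeff (\<lambda>\<theta>. ?r (cis \<theta>)) k
      = fourier_coeff (\<lambda>\<theta>. y (cis \<theta>)) k - (\<Sum>j\<le>m. if int j = k then 2 * pi * c j else 0) / (2 * pi)"
      unfolding fourier_coeff_def by (simp add: integral_unique left_diff_distrib sum_distrib_right diff_divide_distrib)
    also have "\<dots> = 0"
    proof (cases "k < 0 \<or> k > int m")
      case True
      then have "(\<Sum>j\<le>m. if int j = k then 2 * pi * c j else 0) = 0" by (intro sum.neutral) auto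
      then show ?thesis using 0[OF True] by simp
    next
      case False
      then obtain n where n: "k = int n" "n \<le> m" by (metis int_nat_eq linorder_not_less nat_le_iff)
      then have "(\<Sum>j\<le>m. if int j = k then 2 * pi * c j else 0) = 2 * pi * c n" by (simp add: sum.delta)
      then show ?thesis by (simp add: c_def n)
    qed
    finally show ?thesis .
  qed
  moreover have "continuous_on (sphere 0 1) ?r" by (intro continuous_intros y)
  ultimately have "?r z = 0" if "z \<in> sphere 0 1" for z
    using circle_function_eq_0_if_fourier_coeffs_0 that by blast
  then show ?thesis using that[of c] by simp
qed

section \<open>Slices of the ball by the lines through a point\<close>

text \<open>The three sets below are the parts of the line \<open>w = t (z - \<alpha>)\<close> in the open ball, the closed ball and
  the sphere, in the coordinate \<open>z\<close>. They depend on \<open>\<bar>t\<bar>\<close> only.\<close>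

definition slice_disc :: "real \<Rightarrow> real \<Rightarrow> complex set" where
  "slice_disc \<alpha> t = {z. (cmod z)\<^sup>2 + t\<^sup>2 * (cmod (z - \<alpha>))\<^sup>2 < 1}"

definition slice_cdisc :: "real \<Rightarrow> real \<Rightarrow> complex set" where
  "slice_cdisc \<alpha> t = {z. (cmod z)\<^sup>2 + t\<^sup>2 * (cmod (z - \<alpha>))\<^sup>2 \<le> 1}"

definition slice_circle :: "real \<Rightarrow> real \<Rightarrow> complex set" where
  "slice_circle \<alpha> t = {z. (cmod z)\<^sup>2 + t\<^sup>2 * (cmod (z - \<alpha>))\<^sup>2 = 1}"

definition slice_centre :: "real \<Rightarrow> real \<Rightarrow> real" where
  "slice_centre \<alpha> t = t\<^sup>2 * \<alpha> / (1 + t\<^sup>2)"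

definition slice_radius :: "real \<Rightarrow> real \<Rightarrow> real" where
  "slice_radius \<alpha> t = sqrt (1 + t\<^sup>2 - t\<^sup>2 * \<alpha>\<^sup>2) / (1 + t\<^sup>2)"

text \<open>The positive slope of a line through \<open>(\<alpha>,0)\<close> that meets the sphere over \<open>z\<close>.\<close>

definition max_slope :: "real \<Rightarrow> complex \<Rightarrow> real" where
  "max_slope \<alpha> z = sqrt ((1 - (cmod z)\<^sup>2) / (cmod (z - \<alpha>))\<^sup>2)"

lemma slice_radius_pos: "t\<^sup>2 * (\<alpha>\<^sup>2 - 1) < 1 \<Longrightarrow> slice_radius \<alpha> t > 0"
  unfolding slice_radius_def
  by (intro divide_pos_pos real_sqrt_gt_zero) (auto simp: algebra_simps add_pos_nonneg)

lemma slice_identity: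
  fixes z :: complex
  assumes "t\<^sup>2 * (\<alpha>\<^sup>2 - 1) < 1"
  shows "(cmod z)\<^sup>2 + t\<^sup>2 * (cmod (z - \<alpha>))\<^sup>2 - 1
    = (1 + t\<^sup>2) * ((cmod (z - slice_centre \<alpha> t))\<^sup>2 - (slice_radius \<alpha> t)\<^sup>2)"
proof -
  have p: "1 + t\<^sup>2 > 0" by (simp add: add_pos_nonneg)
  have "1 + t\<^sup>2 - t\<^sup>2 * \<alpha>\<^sup>2 \<ge> 0" using assms by (simp add: algebra_simps)
  then have r: "(slice_radius \<alpha> t)\<^sup>2 = (1 + t\<^sup>2 - t\<^sup>2 * \<alpha>\<^sup>2) / (1 + t\<^sup>2)\<^sup>2"
    by (simp add: slice_radius_def power_divide)
  have n: "(cmod (z - of_real x))\<^sup>2 = (cmod z)\<^sup>2 - 2 * x * Re z + x\<^sup>2" for x :: real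
    unfolding cmod_power2 by (simp add: power2_eq_square algebra_simps)
  show ?thesis unfolding n r slice_centre_def using p
    by (simp add: divide_simps) (simp add: power2_eq_square power4_eq_xxxx algebra_simps)
qed

lemma slice_sets_eq:
  assumes "t\<^sup>2 * (\<alpha>\<^sup>2 - 1) < 1"
  shows "slice_disc \<alpha> t = ball (of_real (slice_centre \<alpha> t)) (slice_radius \<alpha> t)" (is ?A)
    and "slice_cdisc \<alpha> t = cball (of_real (slice_centre \<alpha> t)) (slice_radius \<alpha> t)" (is ?B)
    and "slice_circle \<alpha> t = sphere (of_real (slice_centre \<alpha> t)) (slice_radius \<alpha> t)" (is ?C)
proof -
  let ?c = "complex_of_real (slice_centre \<alpha> t)" and ?r = "slice_radius \<alpha> t"
  let ?q = "\<lambda>z. (cmod z)\<^sup>2 + t\<^sup>2 * (cmod (z - \<alpha>))\<^sup>2"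
  have p: "1 + t\<^sup>2 > 0" by (simp add: add_pos_nonneg)
  have r: "?r > 0" by (rule slice_radius_pos[OF assms])
  have id: "?q z - 1 = (1 + t\<^sup>2) * ((cmod (z - ?c))\<^sup>2 - ?r\<^sup>2)" for z
    by (rule slice_identity[OF assms])
  have "?q z < 1 \<longleftrightarrow> (cmod (z - ?c))\<^sup>2 < ?r\<^sup>2" for z
  proof -
    have "?q z < 1 \<longleftrightarrow> (1 + t\<^sup>2) * ((cmod (z - ?c))\<^sup>2 - ?r\<^sup>2) < 0" using id[of z] by linarith
    then show ?thesis using p by (simp add: mult_less_0_iff)
  qed
  moreover have "(cmod (z - ?c))\<^sup>2 < ?r\<^sup>2 \<longleftrightarrow> cmod (z - ?c) < ?r" for z
    using r by (metis norm_ge_zero power2_less_imp_less power_strict_mono less_imp_le zero_less_numeral)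
  ultimately show ?A by (auto simp: slice_disc_def dist_norm norm_minus_commute)
  have C1: "?q z = 1 \<longleftrightarrow> (cmod (z - ?c))\<^sup>2 = ?r\<^sup>2" for z
  proof -
    have "?q z = 1 \<longleftrightarrow> (1 + t\<^sup>2) * ((cmod (z - ?c))\<^sup>2 - ?r\<^sup>2) = 0" using id[of z] by linarith
    then show ?thesis using p by simp
  qed
  have C2: "(cmod (z - ?c))\<^sup>2 = ?r\<^sup>2 \<longleftrightarrow> cmod (z - ?c) = ?r" for z
    using r by (simp add: power2_eq_iff_nonneg)
  show ?C
    unfolding slice_circle_def C1 C2 by (simp add: set_eq_iff dist_norm norm_minus_commute)
  have "slice_cdisc \<alpha> t = slice_disc \<alpha> t \<union> slice_circle \<alpha> t"
    by (auto simp: slice_cdisc_def slice_disc_def slice_circle_def)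
  then show ?B unfolding \<open>?A\<close> \<open>?C\<close> by (simp add: set_eq_iff le_less)
qed

lemma max_slope_sq: "cmod z < 1 \<Longrightarrow> (max_slope \<alpha> z)\<^sup>2 = (1 - (cmod z)\<^sup>2) / (cmod (z - \<alpha>))\<^sup>2"
  unfolding max_slope_def using power_le_one[of "cmod z" 2] by simp

lemma max_slope_pos: "cmod z < 1 \<Longrightarrow> z \<noteq> \<alpha> \<Longrightarrow> max_slope \<alpha> z > 0"
  unfolding max_slope_def by (simp add: abs_square_less_1)

lemma max_slope_less_iff:
  assumes "cmod z < 1" "z \<noteq> \<alpha>" "t \<ge> 0"
  shows "t < max_slope \<alpha> z \<longleftrightarrow> z \<in> slice_disc \<alpha> t"
proof -
  have "t < max_slope \<alpha> z \<longleftrightarrow> t\<^sup>2 < (max_slope \<alpha> z)\<^sup>2"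
    using max_slope_pos[OF assms(1,2)] assms(3) power_strict_mono[of t "max_slope \<alpha> z" 2] power2_less_imp_less[of t "max_slope \<alpha> z"] by auto
  then show ?thesis using assms by (simp add: max_slope_sq slice_disc_def field_simps)
qed

lemma max_slope_le_iff:
  assumes "cmod z < 1" "z \<noteq> \<alpha>" "t \<ge> 0"
  shows "t \<le> max_slope \<alpha> z \<longleftrightarrow> z \<in> slice_cdisc \<alpha> t"
proof -
  have "t \<le> max_slope \<alpha> z \<longleftrightarrow> t\<^sup>2 \<le> (max_slope \<alpha> z)\<^sup>2"
    using max_slope_pos[OF assms(1,2)] assms(3) power_mono[of t "max_slope \<alpha> z" 2] power2_le_imp_le[of t "max_slope \<alpha> z"] by auto
  then show ?thesis using assms by (simp add: max_slope_sq slice_cdisc_def field_simps)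
qed

lemma max_slope_in_circle:
  assumes "cmod z < 1" "z \<noteq> \<alpha>"
  shows "z \<in> slice_circle \<alpha> (max_slope \<alpha> z)"
  using assms by (simp add: max_slope_sq slice_circle_def field_simps)

text \<open>The inequality \<open>t\<^sup>2 (\<alpha>\<^sup>2 - 1) < 1\<close> says that the line of slope \<open>t\<close> meets the open ball. A line that meets the closed ball
  only in a tangency point touches it over \<open>z = 1/\<alpha>\<close>, as the identity
  \<open>\<bar>1 - \<alpha> z\<bar>\<^sup>2 = \<bar>z - \<alpha>\<bar>\<^sup>2 - (1 - \<bar>z\<bar>\<^sup>2)(\<alpha>\<^sup>2 - 1)\<close> shows.\<close>

lemma slope_admissible:
  assumes z: "cmod z < 1" "\<alpha> * z \<noteq> 1" and t: "z \<in> slice_cdisc \<alpha> t" "z \<noteq> \<alpha>"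
  shows "t\<^sup>2 * (\<alpha>\<^sup>2 - 1) < 1"
proof -
  have pos: "(cmod (z - \<alpha>))\<^sup>2 > 0" using t by simp
  have "(cmod (1 - \<alpha> * z))\<^sup>2 > 0" using z by simp
  moreover have "(cmod (1 - \<alpha> * z))\<^sup>2 = (cmod (z - \<alpha>))\<^sup>2 - (1 - (cmod z)\<^sup>2) * (\<alpha>\<^sup>2 - 1)"
    unfolding cmod_power2 by (simp add: power2_eq_square algebra_simps)
  ultimately have 1: "(1 - (cmod z)\<^sup>2) * (\<alpha>\<^sup>2 - 1) < (cmod (z - \<alpha>))\<^sup>2" by simp
  have 2: "t\<^sup>2 * (cmod (z - \<alpha>))\<^sup>2 \<le> 1 - (cmod z)\<^sup>2" using t by (simp add: slice_cdisc_def)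
  show ?thesis
  proof (cases "\<alpha>\<^sup>2 \<ge> 1")
    case True
    have "t\<^sup>2 * (cmod (z - \<alpha>))\<^sup>2 * (\<alpha>\<^sup>2 - 1) \<le> (1 - (cmod z)\<^sup>2) * (\<alpha>\<^sup>2 - 1)"
      using 2 True by (intro mult_right_mono) auto
    with 1 have "(t\<^sup>2 * (\<alpha>\<^sup>2 - 1)) * (cmod (z - \<alpha>))\<^sup>2 < 1 * (cmod (z - \<alpha>))\<^sup>2" by (simp add: mult_ac)
    then show ?thesis using pos by (simp only: mult_less_cancel_right_pos)
  next
    case False
    then have "t\<^sup>2 * (\<alpha>\<^sup>2 - 1) \<le> 0" by (simp add: mult_nonneg_nonpos)
    then show ?thesis by simp
  qed
qed

text \<open>The left-hand side of the slice inequality is smallest on the real axis, where completing the square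
  at the centre of the slice bounds it below by \<open>t\<^sup>2 \<alpha>\<^sup>2 / (1 + t\<^sup>2)\<close>.\<close>

lemma slice_disc_admissible:
  assumes "z \<in> slice_disc \<alpha> t"
  shows "t\<^sup>2 * (\<alpha>\<^sup>2 - 1) < 1"
proof -
  have "(Re z)\<^sup>2 + t\<^sup>2 * (Re z - \<alpha>)\<^sup>2 \<le> (cmod z)\<^sup>2 + t\<^sup>2 * (cmod (z - of_real \<alpha>))\<^sup>2"
    unfolding cmod_power2 by (simp add: algebra_simps)
  also have "\<dots> < 1" using assms by (simp add: slice_disc_def)
  finally have lt: "(Re z)\<^sup>2 + t\<^sup>2 * (Re z - \<alpha>)\<^sup>2 < 1" .
  define q where "q = (1 + t\<^sup>2) * ((Re z)\<^sup>2 + t\<^sup>2 * (Re z - \<alpha>)\<^sup>2)"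
  have "q < (1 + t\<^sup>2) * 1"
    unfolding q_def using lt by (intro mult_strict_left_mono) (auto simp: add_pos_nonneg)
  moreover have "q - t\<^sup>2 * \<alpha>\<^sup>2 = ((1 + t\<^sup>2) * Re z - t\<^sup>2 * \<alpha>)\<^sup>2"
    by (simp add: q_def power2_eq_square algebra_simps)
  then have "q - t\<^sup>2 * \<alpha>\<^sup>2 \<ge> 0" by (simp only: zero_le_power2)
  ultimately have "t\<^sup>2 * \<alpha>\<^sup>2 < (1 + t\<^sup>2) * 1" by (simp only: diff_ge_0_iff_ge order_le_less_trans)
  then show ?thesis by (simp add: algebra_simps)
qed

lemma slice_disc_cmod:
  assumes "z \<in> slice_disc \<alpha> t" shows "cmod z < 1"
proof -
  have "t\<^sup>2 * (cmod (z - of_real \<alpha>))\<^sup>2 \<ge> 0" by simp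
  then have "(cmod z)\<^sup>2 < 1" using assms unfolding slice_disc_def mem_Collect_eq by linarith
  then show ?thesis by (simp add: abs_square_less_1)
qed

lemma slice_disc_ball: obtains c r where "slice_disc \<alpha> t = ball c r"
proof (cases "slice_disc \<alpha> t = {}")
  case True
  then show ?thesis using that[of 0 0] by simp
next
  case False
  then show ?thesis using that slice_disc_admissible slice_sets_eq(1) by blast
qed

text \<open>The Fourier components in the angle of \<open>w\<close> of a continuous function on the sphere have this form.\<close>

locale homogeneous_sphere_function =
  fixes g :: "complex \<Rightarrow> complex \<Rightarrow> complex" and k :: int
  assumes cont: "continuous_on {(z,w). (cmod z)\<^sup>2 + (cmod w)\<^sup>2 = 1} (\<lambda>(z,w). g z w)"
    and homogeneous: "\<And>z w u. (cmod z)\<^sup>2 + (cmod w)\<^sup>2 = 1 \<Longrightarrow> cmod u = 1 \<Longrightarrow> g z (u * w) = u powi k * g z w"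
begin

text \<open>The quotient \<open>g z w / w\<^sup>k\<close>, which by homogeneity depends on \<open>z\<close> only.\<close>

definition F :: "complex \<Rightarrow> complex" where
  "F z = (let r = of_real (sqrt (1 - (cmod z)\<^sup>2)) in g z r * r powi (-k))"

lemma F_eq:
  assumes "(cmod z)\<^sup>2 + (cmod w)\<^sup>2 = 1" "w \<noteq> 0"
  shows "g z w * w powi (-k) = F z"
proof -
  have r: "sqrt (1 - (cmod z)\<^sup>2) = cmod w" using assms(1) by (simp add: real_sqrt_unique)
  define u where "u = w / cmod w"
  have l: "cmod u = 1" "w = u * cmod w" using assms(2) by (auto simp: u_def norm_divide)
  have "g z w = u powi k * g z (cmod w)"
    using homogeneous[of z "of_real (cmod w)" u] l assms(1) by simp
  moreover have "w powi (-k) = u powi (-k) * of_real (cmod w) powi (-k)"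
    by (metis l(2) power_int_mult_distrib)
  moreover have "u powi k * u powi (-k) = 1" 
  proof -
    have "u \<noteq> 0" using l(1) by auto
    then show ?thesis by (simp add: power_int_minus)
  qed
  ultimately have "g z w * w powi (-k) = g z (cmod w) * of_real (cmod w) powi (-k)" by (simp add: mult_ac)
  then show ?thesis by (simp only: F_def r Let_def)
qed

lemma bounded: obtains C where "C > 0" "\<And>z w. (cmod z)\<^sup>2 + (cmod w)\<^sup>2 = 1 \<Longrightarrow> cmod (g z w) \<le> C"
proof -
  let ?S = "{(z,w). (cmod z)\<^sup>2 + (cmod w)\<^sup>2 = 1}"
  have "?S = sphere (0::complex \<times> complex) 1" by (auto simp: norm_Pair)
  then have "compact ?S" using compact_sphere[of "0::complex \<times> complex" 1] by simp
  then have "compact ((\<lambda>(z,w). g z w) ` ?S)" by (rule compact_continuous_image[OF cont])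
  then obtain C where C: "C > 0" "\<And>x. x \<in> (\<lambda>(z,w). g z w) ` ?S \<Longrightarrow> norm x \<le> C"
    using compact_imp_bounded bounded_pos by metis
  show ?thesis
  proof (rule that[OF C(1)])
    fix z w assume "(cmod z)\<^sup>2 + (cmod w)\<^sup>2 = 1"
    then have "(\<lambda>(z,w). g z w) (z,w) \<in> (\<lambda>(z,w). g z w) ` ?S" by (intro imageI) simp
    then show "cmod (g z w) \<le> C" using C(2) by fastforce
  qed
qed

end

text \<open>\<open>h t\<close> is the extension along the line \<open>w = t (z - \<alpha>)\<close>, in the coordinate \<open>z\<close>. Positive slopes
  suffice since \<open>g\<close> is homogeneous.\<close>

locale pencil = homogeneous_sphere_function g k for g k +
  fixes \<alpha> :: real and h :: "real \<Rightarrow> complex \<Rightarrow> complex"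
  assumes h_cont: "\<And>t. t > 0 \<Longrightarrow> t\<^sup>2 * (\<alpha>\<^sup>2 - 1) < 1 \<Longrightarrow> continuous_on (slice_cdisc \<alpha> t) (h t)"
    and h_hol: "\<And>t. t > 0 \<Longrightarrow> t\<^sup>2 * (\<alpha>\<^sup>2 - 1) < 1 \<Longrightarrow> h t holomorphic_on slice_disc \<alpha> t"
    and h_eq: "\<And>t z. t > 0 \<Longrightarrow> t\<^sup>2 * (\<alpha>\<^sup>2 - 1) < 1 \<Longrightarrow> z \<in> slice_circle \<alpha> t \<Longrightarrow> h t z = g z (of_real t * (z - of_real \<alpha>))"
begin

text \<open>The division by \<open>w\<^sup>k\<close> turns the boundary values of all slices into the one function \<open>F\<close>
  (\<open>boundary_value\<close> below).\<close>

definition G :: "complex \<Rightarrow> real \<Rightarrow> complex" where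
  "G z t = h t z * (of_real t * (z - of_real \<alpha>)) powi (-k)"

lemma circle_sphere: "z \<in> slice_circle \<alpha> t \<Longrightarrow> (cmod z)\<^sup>2 + (cmod (of_real t * (z - of_real \<alpha>)))\<^sup>2 = 1"
  by (simp add: slice_circle_def norm_mult power_mult_distrib)

lemma h_bounded: obtains C where "C > 0" "\<And>t z. t > 0 \<Longrightarrow> t\<^sup>2 * (\<alpha>\<^sup>2 - 1) < 1 \<Longrightarrow> z \<in> slice_cdisc \<alpha> t \<Longrightarrow> cmod (h t z) \<le> C"
proof -
  obtain C where C: "C > 0" "\<And>z w. (cmod z)\<^sup>2 + (cmod w)\<^sup>2 = 1 \<Longrightarrow> cmod (g z w) \<le> C" using bounded by blast
  show ?thesis
  proof (rule that[OF C(1)])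
    fix t z assume t: "t > 0" "t\<^sup>2 * (\<alpha>\<^sup>2 - 1) < 1" and z: "z \<in> slice_cdisc \<alpha> t"
    note eqs = slice_sets_eq[OF t(2)]
    show "cmod (h t z) \<le> C"
    proof (rule maximum_modulus_disc[of "of_real (slice_centre \<alpha> t)" "slice_radius \<alpha> t" "h t" C z])
      show "continuous_on (cball (of_real (slice_centre \<alpha> t)) (slice_radius \<alpha> t)) (h t)" using h_cont[OF t] eqs by simp
      show "h t holomorphic_on ball (of_real (slice_centre \<alpha> t)) (slice_radius \<alpha> t)" using h_hol[OF t] eqs by simp
      show "slice_radius \<alpha> t > 0" by (rule slice_radius_pos[OF t(2)])
      show "z \<in> cball (of_real (slice_centre \<alpha> t)) (slice_radius \<alpha> t)" using z eqs by simp
      fix w :: complex assume "w \<in> sphere (of_real (slice_centre \<alpha> t)) (slice_radius \<alpha> t)"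
      then have w: "w \<in> slice_circle \<alpha> t" using eqs by simp
      show "cmod (h t w) \<le> C" unfolding h_eq[OF t w] by (rule C(2)[OF circle_sphere[OF w]])
    qed
  qed
qed

lemma h_jointly_continuous:
  "continuous_on {(t,z). t > 0 \<and> t\<^sup>2 * (\<alpha>\<^sup>2 - 1) < 1 \<and> z \<in> slice_cdisc \<alpha> t} (\<lambda>(t,z). h t z)"
proof -
  let ?S = "{t. t > 0 \<and> t\<^sup>2 * (\<alpha>\<^sup>2 - 1) < 1}"
  let ?c = "\<lambda>t. complex_of_real (slice_centre \<alpha> t)" and ?r = "slice_radius \<alpha>"
  have nz: "1 + t\<^sup>2 \<noteq> 0" for t :: real by (metis add_pos_nonneg less_numeral_extra(1,3) zero_le_power2)
  have "continuous_on {(t,z). t \<in> ?S \<and> z \<in> cball (?c t) (?r t)} (\<lambda>(t,z). h t z)"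
  proof (rule disc_extensions_jointly_continuous)
    show "continuous_on ?S ?c" unfolding slice_centre_def by (intro continuous_intros) (use nz in auto)
    show "continuous_on ?S ?r" unfolding slice_radius_def by (intro continuous_intros) (use nz in auto)
    show "?r t > 0" if "t \<in> ?S" for t using that slice_radius_pos by auto
    show "continuous_on (cball (?c t) (?r t)) (h t)" "h t holomorphic_on ball (?c t) (?r t)" if "t \<in> ?S" for t
      using that h_cont[of t] h_hol[of t] slice_sets_eq[of t \<alpha>] by auto
    let ?B = "{(t,z). t \<in> ?S \<and> z \<in> sphere (?c t) (?r t)}"
    have B: "z \<in> slice_circle \<alpha> t" if "(t,z) \<in> ?B" for t z using that slice_sets_eq(3)[of t \<alpha>] by auto
    have "continuous_on ?B (\<lambda>u. (\<lambda>(z,w). g z w) (snd u, of_real (fst u) * (snd u - of_real \<alpha>)))"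
      by (rule continuous_on_compose2[OF cont]) (use B circle_sphere in \<open>auto intro!: continuous_intros\<close>)
    then show "continuous_on ?B (\<lambda>(t,z). h t z)"
      by (rule continuous_on_eq) (use B h_eq in force)
  qed
  then show ?thesis
    by (rule continuous_on_subset) (use slice_sets_eq(2)[of _ \<alpha>] in auto)
qed

lemma boundary_value:
  fixes z :: complex
  assumes "cmod z < 1" "z \<noteq> \<alpha>" "\<alpha> * z \<noteq> 1"
  shows "G z (max_slope \<alpha> z) = F z"
proof -
  let ?t = "max_slope \<alpha> z"
  have t: "?t > 0" by (rule max_slope_pos[OF assms(1,2)])
  have zc: "z \<in> slice_circle \<alpha> ?t" by (rule max_slope_in_circle[OF assms(1,2)])
  then have "z \<in> slice_cdisc \<alpha> ?t" by (simp add: slice_circle_def slice_cdisc_def)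
  then have "?t\<^sup>2 * (\<alpha>\<^sup>2 - 1) < 1" by (intro slope_admissible[of z]) (use assms in auto)
  then have "G z ?t = g z (of_real ?t * (z - of_real \<alpha>)) * (of_real ?t * (z - of_real \<alpha>)) powi (-k)"
    by (simp add: G_def h_eq[OF t _ zc])
  also have "\<dots> = F z"
    by (intro F_eq circle_sphere zc) (use assms t in auto)
  finally show ?thesis .
qed

end

section \<open>Rays and test functions\<close>

text \<open>For fixed \<open>t\<close> the function \<open>ray \<alpha> z t\<close> is holomorphic in \<open>z\<close>, while for fixed \<open>z\<close> it is affine in
  \<open>1/t\<^sup>2\<close>. The coefficients are chosen so that at \<open>t = max_slope \<alpha> z\<close> it takes the value \<open>vertex z\<close>, which
  does not involve \<open>\<alpha>\<close> (\<open>ray_max_slope\<close>). The slopes between \<open>0\<close> and \<open>max_slope \<alpha> z\<close> thus parametrise a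
  ray from \<open>vertex z\<close> to infinity.\<close>

definition ray_dir :: "real \<Rightarrow> complex \<Rightarrow> complex" where
  "ray_dir \<alpha> z = 1 / ((z - of_real \<alpha>) * (1 - of_real \<alpha> * z))"

definition ray_base :: "real \<Rightarrow> complex \<Rightarrow> complex" where
  "ray_base \<alpha> z = of_real \<alpha> / (1 - of_real \<alpha> * z)"

definition ray :: "real \<Rightarrow> complex \<Rightarrow> real \<Rightarrow> complex" where
  "ray \<alpha> z t = ray_base \<alpha> z + ray_dir \<alpha> z / of_real (t\<^sup>2)"

definition vertex :: "complex \<Rightarrow> complex" where
  "vertex z = cnj z / of_real (1 - (cmod z)\<^sup>2)"

text \<open>In terms of the Cayley transform \<open>e = (v + \<i>) / (v - \<i>)\<close> the test functions for \<open>s = 1\<close> and \<open>s = -1\<close> are the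
  characters \<open>e powi (n + 1)\<close> and \<open>e powi (- (m + 1 + n))\<close>, divided by \<open>(v - \<i>) ^ m * (v\<^sup>2 + 1)\<close>. They detect
  precisely the Fourier coefficients with index outside \<open>{0..m}\<close>. The only pole is \<open>s \<i>\<close>.\<close>

definition test_fun :: "nat \<Rightarrow> nat \<Rightarrow> real \<Rightarrow> complex \<Rightarrow> complex" where
  "test_fun m n s v = (v + of_real s * \<i>) ^ n / (v - of_real s * \<i>) ^ (m + 2 + n)"

text \<open>\<open>t\<^sup>2 (ray \<alpha> z t + s \<i>)\<close>, in a form that makes sense at \<open>t = 0\<close>.\<close>

definition kern_num :: "real \<Rightarrow> real \<Rightarrow> complex \<Rightarrow> real \<Rightarrow> complex" where
  "kern_num \<alpha> s z t = ray_dir \<alpha> z + (ray_base \<alpha> z + of_real s * \<i>) * of_real (t\<^sup>2)"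

text \<open>The test function along the ray times the factor \<open>2 * ray_dir \<alpha> z\<close> of \<open>dv\<close>, divided by the power
  \<open>t ^ (2 * m + 4)\<close> with which the test function decays at infinity (\<open>kern_eq\<close>); this makes it regular at \<open>t = 0\<close>.\<close>

definition kern :: "real \<Rightarrow> nat \<Rightarrow> nat \<Rightarrow> real \<Rightarrow> complex \<Rightarrow> real \<Rightarrow> complex" where
  "kern \<alpha> m n s z t = 2 * ray_dir \<alpha> z * kern_num \<alpha> s z t ^ n / kern_num \<alpha> (- s) z t ^ (m + 2 + n)"

lemma ray_max_slope:
  fixes z :: complex
  assumes z: "cmod z < 1" "z \<noteq> of_real \<alpha>" "of_real \<alpha> * z \<noteq> 1"
  shows "ray \<alpha> z (max_slope \<alpha> z) = vertex z"
proof -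
  have d: "complex_of_real (1 - (cmod z)\<^sup>2) = 1 - z * cnj z" by (simp only: of_real_diff complex_norm_square of_real_1)
  have d0: "1 - z * cnj z \<noteq> 0" unfolding d[symmetric] of_real_eq_0_iff
    using z(1) abs_square_less_1[of "cmod z"] by auto
  have a: "complex_of_real ((cmod (z - of_real \<alpha>))\<^sup>2) = (z - of_real \<alpha>) * (cnj z - of_real \<alpha>)"
    by (simp only: complex_norm_square complex_cnj_diff complex_cnj_complex_of_real)
  have a0: "z - of_real \<alpha> \<noteq> 0" "cnj z - of_real \<alpha> \<noteq> 0" "1 - of_real \<alpha> * z \<noteq> 0" using z
    by (auto simp: complex_eq_iff)
  have t: "complex_of_real ((max_slope \<alpha> z)\<^sup>2) = (1 - z * cnj z) / ((z - of_real \<alpha>) * (cnj z - of_real \<alpha>))"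
    unfolding max_slope_sq[OF z(1)] of_real_divide d a ..
  show ?thesis unfolding ray_def t vertex_def d ray_dir_def ray_base_def
    using a0 d0 by (simp add: divide_simps) (simp add: algebra_simps)
qed

lemma Im_vertex: "cmod z < 1 \<Longrightarrow> Im (vertex z) = - Im z / (1 - (cmod z)\<^sup>2)"
  by (simp add: vertex_def)

text \<open>\<open>Im ((z - \<alpha>)(1 - \<alpha> z)) = Im z (1 + \<alpha>\<^sup>2 - 2 \<alpha> Re z)\<close>, and the last factor is nonnegative on the disc.\<close>

lemma Im_ray_dir:
  fixes z :: complex
  assumes "cmod z < 1"
  obtains c where "c \<ge> 0" "Im (ray_dir \<alpha> z) = - c * Im z"
proof -
  let ?w = "(z - of_real \<alpha>) * (1 - of_real \<alpha> * z)"
  have "Im ?w = Im z * (1 + \<alpha>\<^sup>2 - 2 * \<alpha> * Re z)" by (simp add: power2_eq_square algebra_simps)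
  then have "Im (ray_dir \<alpha> z) = - ((1 + \<alpha>\<^sup>2 - 2 * \<alpha> * Re z) / (cmod ?w)\<^sup>2) * Im z"
  proof -
    have inv: "Im (1 / w) = - Im w / (cmod w)\<^sup>2" for w by (simp add: Im_divide cmod_power2)
    show ?thesis unfolding ray_dir_def inv \<open>Im ?w = _\<close> by (simp add: mult.commute)
  qed
  moreover have "1 + \<alpha>\<^sup>2 - 2 * \<alpha> * Re z \<ge> 0"
  proof -
    have "\<bar>Re z\<bar> \<le> 1" using abs_Re_le_cmod[of z] assms by linarith
    then have "\<alpha> * Re z \<le> \<bar>\<alpha>\<bar>" by (metis abs_ge_self abs_mult abs_ge_zero mult_left_le order_trans)
    moreover have "(\<bar>\<alpha>\<bar> - 1)\<^sup>2 \<ge> 0" by simp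
    then have "1 + \<alpha>\<^sup>2 - 2 * \<bar>\<alpha>\<bar> \<ge> 0" by (simp add: power2_eq_square algebra_simps)
    ultimately show ?thesis by (simp add: mult.assoc)
  qed
  ultimately show ?thesis using that[of "(1 + \<alpha>\<^sup>2 - 2 * \<alpha> * Re z) / (cmod ?w)\<^sup>2"] by simp
qed

text \<open>Both the vertex and the direction of the ray have imaginary part of sign opposite to that of \<open>Im z\<close>,
  hence the whole ray lies in the closed half plane opposite to \<open>z\<close>, which does not contain \<open>s \<i>\<close>.\<close>

lemma ray_avoids_pole:
  fixes z :: complex
  assumes z: "cmod z < 1" "z \<noteq> of_real \<alpha>" "of_real \<alpha> * z \<noteq> 1" and s: "s \<noteq> 0" "Im z * s \<ge> 0"
    and t: "0 < t" "t \<le> max_slope \<alpha> z"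
  shows "ray \<alpha> z t \<noteq> of_real s * \<i>"
proof
  assume eq: "ray \<alpha> z t = of_real s * \<i>"
  let ?T = "max_slope \<alpha> z"
  obtain c where c: "c \<ge> 0" "Im (ray_dir \<alpha> z) = - c * Im z" using Im_ray_dir[OF z(1)] by blast
  have T: "?T > 0" by (rule max_slope_pos[OF z(1,2)])
  have "ray \<alpha> z t = ray \<alpha> z ?T + ray_dir \<alpha> z * of_real (1 / t\<^sup>2 - 1 / ?T\<^sup>2)"
    by (simp add: ray_def algebra_simps)
  then have "Im (ray \<alpha> z t) = - Im z / (1 - (cmod z)\<^sup>2) - c * Im z * (1 / t\<^sup>2 - 1 / ?T\<^sup>2)"
    by (simp only: ray_max_slope[OF z]) (simp add: Im_vertex[OF z(1)] c)
  then have "s = - Im z / (1 - (cmod z)\<^sup>2) - c * Im z * (1 / t\<^sup>2 - 1 / ?T\<^sup>2)"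
    unfolding eq by simp
  then have "s * s = s * (- Im z / (1 - (cmod z)\<^sup>2) - c * Im z * (1 / t\<^sup>2 - 1 / ?T\<^sup>2))" by simp
  then have "s * s = - (Im z * s) / (1 - (cmod z)\<^sup>2) - c * (Im z * s) * (1 / t\<^sup>2 - 1 / ?T\<^sup>2)"
    by (simp add: algebra_simps)
  moreover have "1 / ?T\<^sup>2 \<le> 1 / t\<^sup>2" using t by (intro divide_left_mono power_mono) auto
  moreover have "1 - (cmod z)\<^sup>2 > 0" using z by (simp add: abs_square_less_1)
  ultimately have "s * s \<le> 0" using s c
    by (smt (verit) divide_nonneg_pos minus_divide_left mult_nonneg_nonneg)
  then show False using s by (metis mult_less_0_iff not_square_less_zero order_antisym_conv mult_eq_0_iff not_less)
qed

lemma kern_num_ray: "t \<noteq> 0 \<Longrightarrow> kern_num \<alpha> s z t = of_real (t\<^sup>2) * (ray \<alpha> z t + of_real s * \<i>)"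
  by (simp add: kern_num_def ray_def algebra_simps)

lemma kern_num_nonzero:
  fixes z :: complex
  assumes z: "cmod z < 1" "z \<noteq> of_real \<alpha>" "of_real \<alpha> * z \<noteq> 1" and s: "s \<noteq> 0" "Im z * s \<ge> 0"
    and t: "0 \<le> t" "t \<le> max_slope \<alpha> z"
  shows "kern_num \<alpha> (- s) z t \<noteq> 0"
proof (cases "t = 0")
  case True
  then show ?thesis using z by (simp add: kern_num_def ray_dir_def)
next
  case False
  then show ?thesis using ray_avoids_pole[OF z s, of t] t by (simp add: kern_num_ray)
qed

lemma kern_eq:
  assumes "t > 0"
  shows "kern \<alpha> m n s z t = test_fun m n s (ray \<alpha> z t) * (2 * ray_dir \<alpha> z) / of_real t ^ (2 * m + 4)"
proof -
  have "kern \<alpha> m n s z t = 2 * ray_dir \<alpha> z * (of_real (t\<^sup>2) * (ray \<alpha> z t + of_real s * \<i>)) ^ n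
     / (of_real (t\<^sup>2) * (ray \<alpha> z t - of_real s * \<i>)) ^ (m + 2 + n)"
    unfolding kern_def using assms by (simp add: kern_num_ray)
  also have "\<dots> = 2 * ray_dir \<alpha> z * (ray \<alpha> z t + of_real s * \<i>) ^ n / (ray \<alpha> z t - of_real s * \<i>) ^ (m + 2 + n)
      * (of_real (t\<^sup>2) ^ n / of_real (t\<^sup>2) ^ (m + 2 + n))"
    by (simp only: power_mult_distrib times_divide_times_eq) (simp only: mult_ac)
  also have "complex_of_real (t\<^sup>2) ^ n / of_real (t\<^sup>2) ^ (m + 2 + n) = 1 / of_real t ^ (2 * m + 4)"
  proof -
    have "complex_of_real (t\<^sup>2) ^ (m + 2 + n) = of_real (t\<^sup>2) ^ n * of_real t ^ (2 * m + 4)"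
      by (simp add: power_add power_mult[symmetric] mult_ac)
    then show ?thesis using assms by simp
  qed
  finally show ?thesis by (simp add: test_fun_def)
qed

text \<open>The coefficient \<open>b\<close> of \<open>cnj h\<close> in the differential has the factor \<open>1 / ray_dir \<alpha> z\<close>, which will
  cancel the factor \<open>ray_dir \<alpha> z\<close> of the integrand in the ray integral.\<close>

lemma max_slope_has_derivative:
  fixes z :: complex
  assumes z: "cmod z < 1" "z \<noteq> of_real \<alpha>"
  defines "b \<equiv> - ((z - of_real \<alpha>) * (1 - of_real \<alpha> * z)) / of_real (2 * max_slope \<alpha> z * ((cmod (z - of_real \<alpha>))\<^sup>2)\<^sup>2)"
  shows "(max_slope \<alpha> has_derivative (\<lambda>h. 2 * Re (b * cnj h))) (at z)"
proof -
  let ?A = "(cmod (z - of_real \<alpha>))\<^sup>2" and ?T = "max_slope \<alpha> z"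
  let ?Q = "\<lambda>z::complex. (1 - z \<bullet> z) / ((z - of_real \<alpha>) \<bullet> (z - of_real \<alpha>))"
  have A: "(z - of_real \<alpha>) \<bullet> (z - of_real \<alpha>) = ?A" "?A \<noteq> 0" "?A > 0" using z by (auto simp: power2_norm_eq_inner[symmetric])
  have zz: "z \<bullet> z = (cmod z)\<^sup>2" "1 - z \<bullet> z > 0" using z by (auto simp: power2_norm_eq_inner[symmetric] abs_square_less_1)
  have ms: "max_slope \<alpha> = (\<lambda>z. sqrt (?Q z))" by (simp add: max_slope_def fun_eq_iff power2_norm_eq_inner)
  have T: "?T > 0" by (rule max_slope_pos[OF z])
  have Qpos: "?Q z > 0" using A zz by (simp add: divide_pos_pos)
  have Q: "(?Q has_derivative (\<lambda>h. (- (2 * (z \<bullet> h)) * ?A - (1 - z \<bullet> z) * (2 * ((z - of_real \<alpha>) \<bullet> h))) / ?A\<^sup>2)) (at z)"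
    using A by (auto intro!: derivative_eq_intros simp: inner_commute fun_eq_iff power2_eq_square divide_simps algebra_simps)
  have S: "((\<lambda>z. sqrt (?Q z)) has_derivative (\<lambda>h. ((- (2 * (z \<bullet> h)) * ?A - (1 - z \<bullet> z) * (2 * ((z - of_real \<alpha>) \<bullet> h))) / ?A\<^sup>2) / (2 * ?T))) (at z)"
    by (rule derivative_eq_intros refl Q Qpos)+ (auto simp: ms divide_simps)
  have b: "b = of_real (1 / (2 * ?T * ?A\<^sup>2)) * (- of_real ?A * z - of_real (1 - z \<bullet> z) * (z - of_real \<alpha>))"
  proof -
    have "complex_of_real ?A = (z - of_real \<alpha>) * (cnj z - of_real \<alpha>)"
      by (simp only: complex_norm_square complex_cnj_diff complex_cnj_complex_of_real)
    moreover have "complex_of_real (1 - z \<bullet> z) = 1 - z * cnj z"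
      by (simp only: zz(1) of_real_diff complex_norm_square of_real_1)
    ultimately have "- of_real ?A * z - of_real (1 - z \<bullet> z) * (z - of_real \<alpha>) = - ((z - of_real \<alpha>) * (1 - of_real \<alpha> * z))"
      by (simp only:) (simp add: algebra_simps)
    note eq = this
    show ?thesis unfolding b_def eq of_real_divide of_real_1
      by (simp only: divide_inverse mult_1_left mult.commute)
  qed
  have "2 * Re (b * cnj h) = ((- (2 * (z \<bullet> h)) * ?A - (1 - z \<bullet> z) * (2 * ((z - of_real \<alpha>) \<bullet> h))) / ?A\<^sup>2) / (2 * ?T)" for h
  proof -
    have "Re (b * cnj h) = (1 / (2 * ?T * ?A\<^sup>2)) * Re ((- of_real ?A * z - of_real (1 - z \<bullet> z) * (z - of_real \<alpha>)) * cnj h)"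
    proof -
      have Re_of_real_mult: "Re (of_real x * w) = x * Re w" for x w by simp
      show ?thesis unfolding b mult.assoc by (rule Re_of_real_mult)
    qed
    also have "Re ((- of_real ?A * z - of_real (1 - z \<bullet> z) * (z - of_real \<alpha>)) * cnj h) = - ?A * (z \<bullet> h) - (1 - z \<bullet> z) * ((z - of_real \<alpha>) \<bullet> h)"
      by (simp add: inner_complex_def algebra_simps)
    finally have R: "Re (b * cnj h) = 1 / (2 * ?T * ?A\<^sup>2) * (- ?A * (z \<bullet> h) - (1 - z \<bullet> z) * ((z - of_real \<alpha>) \<bullet> h))" .
    have "2 * (1 / (2 * t * a\<^sup>2) * (- a * p - q * r)) = (- (2 * p) * a - q * (2 * r)) / a\<^sup>2 / (2 * t)"
      if "t \<noteq> 0" "a \<noteq> 0" for t a p q r :: real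
      using that by (simp add: field_simps)
    from this[of ?T ?A] R T A(2) show ?thesis by simp
  qed
  then show ?thesis using S unfolding ms by simp
qed

section \<open>Equality of the ray integrals of two pencils\<close>

lemma isCont_greaterE:
  fixes f :: "'a::metric_space \<Rightarrow> real"
  assumes "isCont f x" "f x > c"
  obtains d where "d > 0" "\<And>y. dist y x < d \<Longrightarrow> f y > c"
proof -
  have "\<forall>\<^sub>F y in nhds x. f y > c"
    using order_tendstoD(1)[OF assms(1)[unfolded isCont_def tendsto_at_iff_tendsto_nhds] assms(2)] .
  then show ?thesis using that unfolding eventually_nhds_metric by blast
qed

context homogeneous_sphere_function
begin

text \<open>\<open>m\<close> exceeds by one the degree that the polynomial in \<open>v\<close> is going to have, so that \<open>G / (v - \<i>)\<^sup>m\<close> vanishes at infinity.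
  \<open>N\<close> is the power of \<open>t\<close> that is left over in the integrand \<open>W\<close>: \<open>-k\<close> from the factor
  \<open>w powi (- k)\<close> of \<open>G\<close>, \<open>2m + 4\<close> from the test function, and \<open>-3\<close> from \<open>dv\<close>.\<close>

definition m :: nat where "m = nat k + 1"
definition N :: nat where "N = nat (2 * int m + 1 - k)"

lemma N_eq: "int N = 2 * int m + 1 - k" and N_ge: "N \<ge> 3"
  by (auto simp: N_def m_def)

end

context pencil
begin

text \<open>\<open>K\<close> is the integral of \<open>G\<close> times a test function along the ray from the vertex to infinity, and
  \<open>W\<close> its integrand in the variable \<open>t\<close>, written without negative powers of \<open>t\<close>; \<open>W_eq\<close> shows it in terms of
  \<open>G\<close> and \<open>dv = - 2 ray_dir / t\<^sup>3 dt\<close>.\<close>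

definition W :: "nat \<Rightarrow> real \<Rightarrow> complex \<Rightarrow> real \<Rightarrow> complex" where
  "W n s z t = h t z * of_real t ^ N * ((z - of_real \<alpha>) powi (- k) * kern \<alpha> m n s z t)"

definition K :: "nat \<Rightarrow> real \<Rightarrow> complex \<Rightarrow> complex" where
  "K n s z = integral {0..max_slope \<alpha> z} (W n s z)"

lemma W_eq:
  assumes t: "t > 0"
  shows "W n s z t = G z t * test_fun m n s (ray \<alpha> z t) * (2 * ray_dir \<alpha> z) / of_real t ^ 3"
proof -
  let ?t = "complex_of_real t"
  have t0: "?t \<noteq> 0" using t by simp
  have "?t ^ N = ?t powi (int N)" by (simp only: power_int_of_nat)
  also have "int N = - k + (2 * int m + 1)" using N_eq by simp
  also have "?t powi (- k + (2 * int m + 1)) = ?t powi (- k) * ?t ^ (2 * m + 1)"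
  proof -
    have "?t powi (2 * int m + 1) = ?t ^ (2 * m + 1)"
      using power_int_of_nat[of ?t "2 * m + 1"] by (simp add: add.commute)
    note eq = this
    show ?thesis unfolding eq[symmetric] by (rule power_int_add) (use t0 in simp)
  qed
  also have "?t ^ (2 * m + 1) = ?t ^ (2 * m + 4) / ?t ^ 3"
    using t0 by (simp add: power_add power3_eq_cube power4_eq_xxxx)
  finally have tN: "?t ^ N = ?t powi (- k) * (?t ^ (2 * m + 4) / ?t ^ 3)" .
  show ?thesis unfolding W_def kern_eq[OF t] G_def power_int_mult_distrib tN
    using t0 by (simp add: field_simps)
qed

text \<open>The half disc on the side of \<open>s \<i>\<close>, with its real diameter; the points \<open>\<alpha>\<close> and \<open>1/\<alpha>\<close>, where the ray is not defined, are removed.\<close>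

definition region :: "real \<Rightarrow> complex set" where
  "region s = {z. cmod z < 1 \<and> z \<noteq> of_real \<alpha> \<and> of_real \<alpha> * z \<noteq> 1 \<and> Im z * s \<ge> 0}"

lemma kern_continuous:
  assumes "s \<noteq> 0"
  shows "continuous_on {(z,t). z \<in> region s \<and> 0 \<le> t \<and> t \<le> max_slope \<alpha> z}
    (\<lambda>(z,t). (z - of_real \<alpha>) powi (- k) * kern \<alpha> m n s z t)"
proof -
  let ?D = "{(z,t). z \<in> region s \<and> 0 \<le> t \<and> t \<le> max_slope \<alpha> z}"
  have nz: "fst u - of_real \<alpha> \<noteq> 0" "1 - of_real \<alpha> * fst u \<noteq> 0"
      "kern_num \<alpha> (- s) (fst u) (snd u) \<noteq> 0" if "u \<in> ?D" for u
    using that kern_num_nonzero[of "fst u" \<alpha> s "snd u"] assms by (auto simp: region_def)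
  have c1: "continuous_on ?D (\<lambda>u. ray_dir \<alpha> (fst u))" "continuous_on ?D (\<lambda>u. ray_base \<alpha> (fst u))"
    unfolding ray_dir_def ray_base_def by (intro continuous_intros; use nz in force)+
  have c2: "continuous_on ?D (\<lambda>u. kern_num \<alpha> s' (fst u) (snd u))" for s'
    unfolding kern_num_def by (intro continuous_intros c1)
  have "continuous_on ?D (\<lambda>u. (fst u - of_real \<alpha>) powi (- k) * kern \<alpha> m n s (fst u) (snd u))"
    unfolding kern_def by (intro continuous_intros c1 c2) (use nz in auto)
  then show ?thesis by (simp add: split_beta)
qed

lemma admissible_in_region:
  assumes "z \<in> region s" "0 < t" "t \<le> max_slope \<alpha> z"
  shows "z \<in> slice_cdisc \<alpha> t" "t\<^sup>2 * (\<alpha>\<^sup>2 - 1) < 1"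
proof -
  show 1: "z \<in> slice_cdisc \<alpha> t" using assms max_slope_le_iff[of z \<alpha> t] by (auto simp: region_def)
  show "t\<^sup>2 * (\<alpha>\<^sup>2 - 1) < 1" by (rule slope_admissible[OF _ _ 1]) (use assms in \<open>auto simp: region_def\<close>)
qed

text \<open>The extensions \<open>h t\<close> are uniformly bounded, so a positive power of \<open>t\<close> forces continuity at \<open>t = 0\<close>,
  where \<open>h t\<close> itself has no limit in general.\<close>

lemma weighted_h_continuous:
  assumes M: "M > (0::nat)"
  shows "continuous_on {(z,t). z \<in> region s \<and> 0 \<le> t \<and> t \<le> max_slope \<alpha> z} (\<lambda>(z,t). h t z * of_real t ^ M)"
  (is "continuous_on ?D ?H")
proof -
  obtain C where C: "C > 0" "\<And>t z. t > 0 \<Longrightarrow> t\<^sup>2 * (\<alpha>\<^sup>2 - 1) < 1 \<Longrightarrow> z \<in> slice_cdisc \<alpha> t \<Longrightarrow> cmod (h t z) \<le> C"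
    using h_bounded by blast
  have bound: "norm (?H u) \<le> C * snd u ^ M" if "u \<in> ?D" for u
  proof (cases "snd u = 0")
    case True then show ?thesis using M by (simp add: split_beta power_0_left)
  next
    case False
    then have "cmod (h (snd u) (fst u)) \<le> C"
      using that by (intro C(2)) (auto intro: admissible_in_region simp: split_beta)
    then show ?thesis using that by (auto simp: split_beta norm_mult norm_power intro!: mult_right_mono)
  qed
  have 1: "continuous_on (?D \<inter> UNIV \<times> {0<..}) ?H"
  proof -
    have "continuous_on (?D \<inter> UNIV \<times> {0<..}) (\<lambda>u. (\<lambda>(t,z). h t z) (snd u, fst u) * of_real (snd u) ^ M)"
      by (intro continuous_intros continuous_on_compose2[OF h_jointly_continuous])
         (auto intro: admissible_in_region)
    then show ?thesis by (simp add: split_beta)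
  qed
  show ?thesis
    unfolding continuous_on_eq_continuous_within
  proof
    fix x assume x: "x \<in> ?D"
    show "continuous (at x within ?D) ?H"
    proof (cases "snd x = 0")
      case True
      have x0: "?H x = 0" using True M by (simp add: split_beta power_0_left)
      have "(?H \<longlongrightarrow> 0) (at x within ?D)"
      proof (rule Lim_null_comparison)
        show "\<forall>\<^sub>F u in at x within ?D. norm (?H u) \<le> C * snd u ^ M"
          using bound by (auto simp: eventually_at_filter)
        have "((\<lambda>u. C * snd u ^ M) \<longlongrightarrow> C * snd x ^ M) (at x within ?D)"
          by (intro tendsto_intros)
        then show "((\<lambda>u. C * snd u ^ M) \<longlongrightarrow> 0) (at x within ?D)" using True M by (simp add: power_0_left)
      qed
      then show ?thesis unfolding continuous_within x0 .
    next
      case False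
      then have xin: "x \<in> ?D \<inter> UNIV \<times> {0<..}" using x by auto
      have "continuous (at x within ?D \<inter> UNIV \<times> {0<..}) ?H"
        using 1 xin by (simp add: continuous_on_eq_continuous_within)
      moreover have "at x within ?D \<inter> UNIV \<times> {0<..} = at x within ?D"
        by (rule at_within_nhd[of x "UNIV \<times> {0<..}"]) (use xin in \<open>auto intro: open_Times\<close>)
      ultimately show ?thesis by simp
    qed
  qed
qed

lemma W_continuous:
  assumes "s \<noteq> 0"
  shows "continuous_on {(z,t). z \<in> region s \<and> 0 \<le> t \<and> t \<le> max_slope \<alpha> z} (\<lambda>(z,t). W n s z t)"
  using continuous_on_mult[OF weighted_h_continuous[of N s] kern_continuous[OF assms, of n]] N_ge
  by (simp add: W_def split_beta)

lemma max_slope_continuous: "continuous_on {z. z \<noteq> of_real \<alpha>} (max_slope \<alpha>)"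
  unfolding max_slope_def by (intro continuous_intros) auto

text \<open>The substitution of \<open>max_slope \<alpha> z * x\<close> for \<open>t\<close> makes the interval of integration independent of \<open>z\<close>.\<close>

lemma K_continuous:
  assumes "s \<noteq> 0"
  shows "continuous_on (region s) (K n s)"
proof -
  let ?T = "max_slope \<alpha>"
  have Tc: "continuous_on (region s) ?T"
    by (rule continuous_on_subset[OF max_slope_continuous]) (auto simp: region_def)
  have Tpos: "?T z > 0" if "z \<in> region s" for z using that max_slope_pos by (auto simp: region_def)
  have Wz: "continuous_on {0..?T z} (W n s z)" if "z \<in> region s" for z
  proof -
    have "continuous_on {0..?T z} (\<lambda>t. (\<lambda>(z,t). W n s z t) (z,t))"
      by (rule continuous_on_compose2[OF W_continuous[OF assms]]) (use that in \<open>auto intro!: continuous_intros\<close>)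
    then show ?thesis by simp
  qed
  have "continuous_on (region s) (\<lambda>z. integral (cbox 0 1) (\<lambda>x. of_real (?T z) * W n s z (?T z * x)))"
  proof (rule integral_continuous_on_param)
    have T2: "continuous_on (region s \<times> X) (\<lambda>u. ?T (fst u))" for X :: "real set"
      by (rule continuous_on_compose2[OF Tc]) (auto intro!: continuous_intros)
    have "0 \<le> ?T z * x" "?T z * x \<le> ?T z" if "z \<in> region s" "x \<in> cbox 0 1" for z x
      using Tpos[OF that(1)] that(2) by (auto simp: mult_left_le)
    then have "continuous_on (region s \<times> cbox 0 1)
      (\<lambda>u. (\<lambda>(z,t). W n s z t) (fst u, ?T (fst u) * snd u))"
      by (intro continuous_on_compose2[OF W_continuous[OF assms]])
         (auto intro!: continuous_intros T2)
    then have "continuous_on (region s \<times> cbox 0 1)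
      (\<lambda>u. of_real (?T (fst u)) * (\<lambda>(z,t). W n s z t) (fst u, ?T (fst u) * snd u))"
      by (intro continuous_on_mult continuous_on_of_real T2)
    then show "continuous_on (region s \<times> cbox 0 1) (\<lambda>(z, x). of_real (?T z) * W n s z (?T z * x))"
      by (simp add: split_beta)
  qed
  moreover have "integral (cbox 0 1) (\<lambda>x. of_real (?T z) * W n s z (?T z * x)) = K n s z" if z: "z \<in> region s" for z
  proof -
    have "((\<lambda>x. ?T z *\<^sub>R W n s z (?T z * x)) has_integral (integral {?T z * 0..?T z * 1} (W n s z))) {0..1}"
    proof (rule has_integral_substitution[where c = 0 and d = "?T z"])
      show "((*) (?T z) has_real_derivative ?T z) (at x within {0..1})" for x
        by (auto intro!: derivative_eq_intros)
    qed (use Tpos[OF z] Wz[OF z] in \<open>auto simp: mult_le_cancel_left1\<close>)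
    from integral_unique[OF this] show ?thesis by (simp add: K_def scaleR_conv_of_real)
  qed
  ultimately show ?thesis by (simp cong: continuous_on_cong)
qed

lemma W_holomorphic:
  assumes s: "s \<noteq> 0" and V: "open V" "V \<subseteq> region s" and t: "0 \<le> t" "\<And>z. z \<in> V \<Longrightarrow> t < max_slope \<alpha> z"
  shows "(\<lambda>z. W n s z t) holomorphic_on V"
proof (cases "t = 0")
  case True
  then show ?thesis using N_ge by (simp add: W_def power_0_left)
next
  case False
  then have t0: "t > 0" using t by simp
  have h: "h t holomorphic_on V"
  proof (cases "V = {}")
    case False
    then obtain z where "z \<in> V" by blast
    then have adm: "t\<^sup>2 * (\<alpha>\<^sup>2 - 1) < 1"
      using admissible_in_region(2)[of z s t] V t t0 by force
    show ?thesis
      by (rule holomorphic_on_subset[OF h_hol[OF t0 adm]])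
         (use V t t0 max_slope_less_iff in \<open>force simp: region_def\<close>)
  qed (simp add: holomorphic_on_def)
  have nz: "z - of_real \<alpha> \<noteq> 0" "1 - of_real \<alpha> * z \<noteq> 0" "kern_num \<alpha> (- s) z t \<noteq> 0" if "z \<in> V" for z
    using that V(2) kern_num_nonzero[of z \<alpha> s t] t t(2)[OF that] s by (auto simp: region_def subset_iff)
  have r: "ray_dir \<alpha> holomorphic_on V" "ray_base \<alpha> holomorphic_on V"
    unfolding ray_dir_def ray_base_def by (intro holomorphic_intros; use nz in force)+
  have kn: "(\<lambda>z. kern_num \<alpha> s' z t) holomorphic_on V" for s'
    unfolding kern_num_def by (intro holomorphic_intros r)
  show ?thesis unfolding W_def kern_def
    by (intro holomorphic_intros h r kn) (use nz in auto)
qed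

text \<open>By Leibniz' rule the derivative is the integrand at \<open>t = max_slope \<alpha> z\<close>, that is at the vertex, times the derivative
  of \<open>max_slope\<close>. There \<open>G = F z\<close>, and every other trace of \<open>\<alpha>\<close> cancels.\<close>

lemma K_has_dbar:
  assumes s: "s \<noteq> 0" and z: "cmod z < 1" "Im z * s > 0"
  shows "has_dbar (K n s) (- F z * test_fun m n s (vertex z) / of_real ((1 - (cmod z)\<^sup>2)\<^sup>2)) z"
proof -
  let ?T = "max_slope \<alpha>" and ?A = "(cmod (z - of_real \<alpha>))\<^sup>2"
  define U where "U = {z. cmod z < 1 \<and> Im z * s > 0}"
  have U: "open U" unfolding U_def by (intro open_Collect_conj open_Collect_less continuous_intros)
  have reg: "U \<subseteq> region s"
    by (auto simp: U_def region_def complex_eq_iff mult_less_0_iff)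
  have zU: "z \<in> U" using z by (simp add: U_def)
  then have zr: "z \<noteq> of_real \<alpha>" "of_real \<alpha> * z \<noteq> 1" using reg by (auto simp: region_def)
  define b where "b = - ((z - of_real \<alpha>) * (1 - of_real \<alpha> * z)) / of_real (2 * ?T z * ?A\<^sup>2)"
  have "has_dbar (\<lambda>z. integral {0..?T z} (W n s z)) (W n s z (?T z) * b) z"
  proof (rule has_dbar_integral_upper_limit[OF U zU])
    show "?T z > 0" if "z \<in> U" for z using that reg max_slope_pos by (auto simp: region_def)
    show "(?T has_derivative (\<lambda>h. 2 * Re (b * cnj h))) (at z)"
      unfolding b_def by (rule max_slope_has_derivative[OF z(1) zr(1)])
    show "continuous_on {(z, t). z \<in> U \<and> 0 \<le> t \<and> t \<le> ?T z} (\<lambda>(z, t). W n s z t)"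
      by (rule continuous_on_subset[OF W_continuous[OF s]]) (use reg in auto)
    show "(\<lambda>z. W n s z t) holomorphic_on V"
      if "0 \<le> t" "open V" "V \<subseteq> U" "\<And>z. z \<in> V \<Longrightarrow> t < ?T z" for t V
      by (rule W_holomorphic[OF s]) (use that reg in auto)
    show "complex_of_real (2 * Re (b * cnj h)) = cnj b * h + b * cnj h" for h
      by (simp add: complex_eq_iff)
  qed
  moreover have "W n s z (?T z) * b = - F z * test_fun m n s (vertex z) / of_real ((1 - (cmod z)\<^sup>2)\<^sup>2)"
  proof -
    have T: "?T z > 0" by (rule max_slope_pos[OF z(1) zr(1)])
    have A: "?A \<noteq> 0" using zr by simp
    have TA: "(?T z)\<^sup>2 * ?A = 1 - (cmod z)\<^sup>2" using A by (simp add: max_slope_sq[OF z(1)])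
    let ?p = "(z - of_real \<alpha>) * (1 - of_real \<alpha> * z)"
    have p: "?p \<noteq> 0" using zr by auto
    have "W n s z (?T z) * b = F z * test_fun m n s (vertex z) * (2 * (1 / ?p)) / of_real (?T z) ^ 3 * (- ?p / of_real (2 * ?T z * ?A\<^sup>2))"
      unfolding W_eq[OF T] boundary_value[OF z(1) zr] ray_max_slope[OF z(1) zr] b_def ray_dir_def ..
    also have "\<dots> = - F z * test_fun m n s (vertex z) / of_real (((?T z)\<^sup>2 * ?A)\<^sup>2)"
    proof -
      have "x * (2 * (1 / p)) / t ^ 3 * (- p / (2 * t * a\<^sup>2)) = - x / ((t\<^sup>2 * a)\<^sup>2)"
        if "p \<noteq> 0" "t \<noteq> 0" "a \<noteq> 0" for x p t a :: complex
        using that by (simp add: field_simps power2_eq_square power3_eq_cube)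
      from this[of ?p "of_real (?T z)" "of_real ?A" "F z * test_fun m n s (vertex z)"] p T A
      show ?thesis by simp
    qed
    finally show ?thesis unfolding TA .
  qed
  ultimately show ?thesis unfolding K_def by simp
qed

text \<open>Near the arc \<open>max_slope \<alpha> z\<close> is comparable to the square root of \<open>1 - \<bar>z\<bar>\<^sup>2\<close>, and \<open>N \<ge> 3\<close> bounds the integrand
  by its third power; integration contributes one more power.\<close>

lemma K_small_at_arc:
  assumes s: "s \<noteq> 0" and z1: "cmod z1 = 1" "Im z1 * s > 0"
  obtains C d where "C > 0" "d > 0"
    "\<And>z. cmod z < 1 \<Longrightarrow> dist z z1 < d \<Longrightarrow> cmod (K n s z) \<le> C * (1 - (cmod z)\<^sup>2)\<^sup>2"
proof -
  let ?T = "max_slope \<alpha>"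
  let ?R = "\<lambda>u. (fst u - of_real \<alpha>) powi (- k) * kern \<alpha> m n s (fst u) (snd u)"
  obtain C0 where C0: "C0 > 0" "\<And>t z. t > 0 \<Longrightarrow> t\<^sup>2 * (\<alpha>\<^sup>2 - 1) < 1 \<Longrightarrow> z \<in> slice_cdisc \<alpha> t \<Longrightarrow> cmod (h t z) \<le> C0"
    using h_bounded by blast
  have nz: "z1 - of_real \<alpha> \<noteq> 0" "1 - of_real \<alpha> * z1 \<noteq> 0" using z1 by (auto simp: complex_eq_iff)
  then have kn0: "kern_num \<alpha> (- s) z1 0 \<noteq> 0" by (simp add: kern_num_def ray_dir_def)
  have c1: "isCont (\<lambda>u::complex\<times>real. ray_dir \<alpha> (fst u)) (z1, 0)" "isCont (\<lambda>u::complex\<times>real. ray_base \<alpha> (fst u)) (z1, 0)"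
    unfolding ray_dir_def ray_base_def using nz by (auto intro!: continuous_intros)
  have c2: "isCont (\<lambda>u. kern_num \<alpha> s' (fst u) (snd u)) (z1, 0)" for s'
    unfolding kern_num_def by (intro continuous_intros c1)
  have "isCont ?R (z1, 0)"
    unfolding kern_def by (intro continuous_intros c1 c2) (use nz kn0 in auto)
  then obtain d1 where d1: "d1 > 0" "\<And>u. dist u (z1, 0) < d1 \<Longrightarrow> dist (?R u) (?R (z1, 0)) < 1"
    unfolding continuous_at_eps_delta by (meson zero_less_one)
  define B where "B = cmod (?R (z1, 0)) + 1"
  have B: "B > 0" "cmod (?R u) \<le> B" if "dist u (z1, 0) < d1" for u
    using d1(2)[OF that] norm_triangle_ineq2[of "?R u" "?R (z1,0)"]
    by (auto simp: B_def dist_norm add_nonneg_pos simp del: fst_conv snd_conv)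
  have Tc: "isCont ?T z1"
    unfolding max_slope_def using nz by (intro continuous_intros) auto
  have T1: "?T z1 = 0" by (simp add: max_slope_def z1)
  obtain d2 where d2: "d2 > 0" "\<And>z. dist z z1 < d2 \<Longrightarrow> ?T z < min 1 (d1/2)"
  proof -
    have "0 < min 1 (d1/2)" using d1(1) by simp
    then obtain d2 where d2: "d2 > 0" "\<forall>z. dist z z1 < d2 \<longrightarrow> dist (?T z) (?T z1) < min 1 (d1/2)"
      using Tc unfolding continuous_at_eps_delta by meson
    have "?T z < min 1 (d1/2)" if "dist z z1 < d2" for z
    proof -
      have "?T z \<le> dist (?T z) (?T z1)" by (simp add: T1)
      also have "\<dots> < min 1 (d1/2)" using d2(2) that by blast
      finally show ?thesis .
    qed
    then show ?thesis using that d2(1) by blast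
  qed
  have Ac: "isCont (\<lambda>z. (cmod (z - of_real \<alpha>))\<^sup>2) z1" by (intro continuous_intros)
  define a where "a = (cmod (z1 - of_real \<alpha>))\<^sup>2 / 2"
  have a: "a > 0" using nz by (simp add: a_def)
  obtain d3 where d3: "d3 > 0" "\<And>z. dist z z1 < d3 \<Longrightarrow> (cmod (z - of_real \<alpha>))\<^sup>2 > a"
    using isCont_greaterE[OF Ac, of a] a by (auto simp: a_def)
  have "isCont (\<lambda>z. Im z * s) z1" by (intro continuous_intros linear_continuous_at bounded_linear_Im)
  then obtain d4 where d4: "d4 > 0" "\<And>z. dist z z1 < d4 \<Longrightarrow> Im z * s > 0"
    using isCont_greaterE[where f = "\<lambda>z. Im z * s" and x = z1 and c = 0] z1(2) by auto
  define d where "d = min (min (d1/2) d2) (min d3 d4)"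
  have dpos: "d > 0" using d1 d2 d3 d4 by (simp add: d_def)
  define C where "C = C0 * B / a\<^sup>2"
  have Bpos: "B > 0" by (simp add: B_def add_nonneg_pos)
  show ?thesis
  proof (rule that[of C d])
    show "C > 0" using C0 Bpos a by (simp add: C_def)
    show "d > 0" by (rule dpos)
    fix z assume z: "cmod z < 1" "dist z z1 < d"
    have zs: "Im z * s > 0" using d4 z by (simp add: d_def)
    have zr: "z \<in> region s" using z zs by (auto simp: region_def complex_eq_iff)
    have zr': "z \<noteq> of_real \<alpha>" using zr by (auto simp: region_def)
    have T: "?T z > 0" "?T z < 1" "?T z < d1/2"
      using max_slope_pos[OF z(1) zr'] d2(2)[of z] z by (auto simp: d_def)
    have Wb: "cmod (W n s z t) \<le> C0 * B * (?T z) ^ 3" if t: "t \<in> {0..?T z}" for t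
    proof (cases "t = 0")
      case True then show ?thesis using N_ge C0 Bpos T by (simp add: W_def power_0_left)
    next
      case False
      then have t0: "t > 0" "t \<le> ?T z" using t by auto
      have "dist (z,t) (z1, 0::real) \<le> dist z z1 + dist t 0"
        using t0 by (simp add: dist_Pair_Pair sqrt_sum_squares_le_sum)
      also have "\<dots> < d1/2 + d1/2" using z T t0 by (intro add_strict_mono) (auto simp: d_def)
      finally have R: "cmod (?R (z,t)) \<le> B" using B(2)[of "(z,t)"] by simp
      have "t ^ N \<le> t ^ 3" using N_ge T t0 by (intro power_decreasing) auto
      also have "\<dots> \<le> (?T z) ^ 3" using t0 by (intro power_mono) auto
      finally have tN: "t ^ N \<le> (?T z) ^ 3" .
      have hb: "cmod (h t z) \<le> C0" by (rule C0(2)[OF t0(1)]) (use admissible_in_region[OF zr t0] in auto)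
      have "cmod (W n s z t) = (cmod (h t z) * t ^ N) * cmod (?R (z,t))"
        using t0 by (simp add: W_def norm_mult norm_power)
      also have "\<dots> \<le> (C0 * (?T z) ^ 3) * B"
        using hb tN R C0 T t0 by (intro mult_mono) auto
      finally show ?thesis by (simp add: mult_ac)
    qed
    have Wz: "continuous_on {0..?T z} (W n s z)"
    proof -
      have "continuous_on {0..?T z} (\<lambda>t. (\<lambda>(z,t). W n s z t) (z,t))"
        by (rule continuous_on_compose2[OF W_continuous[OF s]]) (use zr in \<open>auto intro!: continuous_intros\<close>)
      then show ?thesis by simp
    qed
    have "cmod (K n s z) \<le> C0 * B * (?T z) ^ 3 * (?T z - 0)"
      unfolding K_def by (rule integral_bound[OF _ Wz]) (use T Wb in auto)
    also have "\<dots> = C0 * B * ((?T z)\<^sup>2)\<^sup>2" by (simp add: power2_eq_square power3_eq_cube)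
    also have "((?T z)\<^sup>2)\<^sup>2 \<le> ((1 - (cmod z)\<^sup>2) / a)\<^sup>2"
      unfolding max_slope_sq[OF z(1)] using d3(2)[of z] z a zr'
      by (intro power_mono divide_left_mono) (auto simp: d_def abs_square_less_1 less_imp_le abs_square_le_1 intro!: mult_pos_pos)
    finally show "cmod (K n s z) \<le> C * (1 - (cmod z)\<^sup>2)\<^sup>2"
      using C0 Bpos by (simp add: C_def power_divide mult_left_mono)
  qed
qed

end

locale two_pencils = A: pencil g k \<alpha> hA + B: pencil g k \<beta> hB
  for g k \<alpha> hA \<beta> hB
begin

text \<open>The difference, extended by zero beyond the arc, has zero \<open>\<partial>/\<partial>cnj z\<close> derivative at every point of the half
  plane: inside because both derivatives agree, on the arc by the quadratic decay. It is therefore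
  holomorphic and vanishes on an open set.\<close>

lemma K_eq_half_disc:
  assumes s: "s \<noteq> 0" and z: "cmod z < 1" "Im z * s > 0"
  shows "A.K n s z = B.K n s z"
proof -
  define u where "u z = (if cmod z < 1 then A.K n s z - B.K n s z else 0)" for z
  let ?S = "{z. Im z * s > 0}"
  have dbar: "has_dbar u 0 z1" if z1: "z1 \<in> ?S" for z1
  proof -
    consider "cmod z1 < 1" | "cmod z1 = 1" | "cmod z1 > 1" by linarith
    then show ?thesis
    proof cases
      case 1
      have "has_dbar (\<lambda>z. A.K n s z - B.K n s z) 0 z1"
        using has_dbar_diff[OF A.K_has_dbar[OF s 1, of n] B.K_has_dbar[OF s 1, of n]] z1 by simp
      then show ?thesis
        by (rule has_dbar_transform[of _ _ _ "ball 0 1"]) (use 1 in \<open>auto simp: u_def\<close>)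
    next
      case 2
      obtain C1 d1 where 1: "C1 > 0" "d1 > 0" "\<And>z. cmod z < 1 \<Longrightarrow> dist z z1 < d1 \<Longrightarrow> cmod (A.K n s z) \<le> C1 * (1 - (cmod z)\<^sup>2)\<^sup>2"
        by (rule A.K_small_at_arc[OF s 2, of n]) (use z1 in auto)
      obtain C2 d2 where 2: "C2 > 0" "d2 > 0" "\<And>z. cmod z < 1 \<Longrightarrow> dist z z1 < d2 \<Longrightarrow> cmod (B.K n s z) \<le> C2 * (1 - (cmod z)\<^sup>2)\<^sup>2"
        by (rule B.K_small_at_arc[OF s 2, of n]) (use z1 in auto)
      show ?thesis
      proof (rule has_dbar_zero_of_quadratic_bound[of "4 * (C1 + C2)" "min d1 d2"])
        fix z assume zd: "dist z z1 < min d1 d2"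
        show "cmod (u z) \<le> 4 * (C1 + C2) * (dist z z1)\<^sup>2"
        proof (cases "cmod z < 1")
          case True
          have "cmod z1 - cmod z \<le> dist z z1" unfolding dist_norm by (metis norm_minus_commute norm_triangle_ineq2)
          then have le: "1 - cmod z \<le> dist z z1" using \<open>cmod z1 = 1\<close> by simp
          have "1 - (cmod z)\<^sup>2 = (1 - cmod z) * (1 + cmod z)" by (simp add: power2_eq_square algebra_simps)
          also have "\<dots> \<le> (1 - cmod z) * 2" using True by (intro mult_left_mono) auto
          also have "\<dots> \<le> 2 * dist z z1" using le by simp
          finally have "1 - (cmod z)\<^sup>2 \<le> 2 * dist z z1" .
          moreover have "0 \<le> 1 - (cmod z)\<^sup>2" using True by (simp add: abs_square_le_1)
          ultimately have sq: "(1 - (cmod z)\<^sup>2)\<^sup>2 \<le> (2 * dist z z1)\<^sup>2" by (intro power_mono)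
          have "cmod (u z) \<le> cmod (A.K n s z) + cmod (B.K n s z)" using True by (simp add: u_def norm_triangle_ineq4)
          also have "\<dots> \<le> (C1 + C2) * (1 - (cmod z)\<^sup>2)\<^sup>2" using 1(3)[OF True] 2(3)[OF True] zd by (simp add: distrib_right)
          also have "\<dots> \<le> (C1 + C2) * (2 * dist z z1)\<^sup>2" using sq 1 2 by (intro mult_left_mono) auto
          finally show ?thesis by (simp add: power_mult_distrib algebra_simps)
        qed (use 1 2 in \<open>simp add: u_def\<close>)
      qed (use 1 2 in auto)
    next
      case 3
      have "has_dbar (\<lambda>_. 0) 0 z1" by (rule has_dbar_zero_of_quadratic_bound[of 1 1]) auto
      then show ?thesis
        by (rule has_dbar_transform[of _ _ _ "- cball 0 1"]) (use 3 in \<open>auto simp: u_def\<close>)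
    qed
  qed
  have oS: "open ?S" by (intro open_Collect_less continuous_intros)
  have cS: "convex ?S"
  proof (cases "s > 0")
    case True
    then have "?S = {z. Im z > 0}" by (auto simp: zero_less_mult_iff)
    then show ?thesis using convex_halfspace_Im_gt by simp
  next
    case False
    then have "?S = {z. Im z < 0}" using s by (auto simp: zero_less_mult_iff)
    then show ?thesis using convex_halfspace_Im_lt by simp
  qed
  have "u holomorphic_on ?S" by (rule has_dbar_zero_imp_holomorphic[OF oS dbar])
  moreover have "u z = 0"
  proof (rule analytic_continuation_open[of "?S \<inter> - cball 0 1" ?S u "\<lambda>_. 0"])
    show "?S \<inter> - cball 0 1 \<noteq> {}"
    proof -
      have "Complex 0 (2 * sgn s) \<in> ?S \<inter> - cball 0 1"
        using s by (auto simp: cmod_def sgn_if zero_less_mult_iff split: if_splits)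
      then show ?thesis by blast
    qed
    show "u holomorphic_on ?S" by fact
  qed (use oS cS z in \<open>auto simp: convex_connected u_def intro!: open_Int\<close>)
  ultimately show ?thesis using z by (simp add: u_def)
qed

lemma K_eq_real:
  fixes x :: real
  assumes s: "s \<noteq> 0" and x: "\<bar>x\<bar> < 1" "x \<noteq> \<alpha>" "\<alpha> * x \<noteq> 1" "x \<noteq> \<beta>" "\<beta> * x \<noteq> 1"
  shows "A.K n s (of_real x) = B.K n s (of_real x)"
proof -
  let ?z = "\<lambda>j::nat. complex_of_real x + of_real (s / real (Suc j)) * \<i>"
  have lim: "?z \<longlonglongrightarrow> of_real x + of_real 0 * \<i>"
    by (intro tendsto_intros) (use LIMSEQ_Suc[OF lim_const_over_n[of s]] in simp)
  have imz: "Im (?z j) * s > 0" for j using s linorder_less_linear[of s 0] by (auto simp: zero_less_mult_iff zero_less_divide_iff)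
  have ev: "\<forall>\<^sub>F j in sequentially. cmod (?z j) < 1"
    using order_tendstoD(2)[OF tendsto_norm[OF lim], of 1] x by simp
  have xr: "of_real x \<in> A.region s" "of_real x \<in> B.region s"
    using x by (auto simp: A.region_def B.region_def simp flip: of_real_mult)
  have evr: "\<forall>\<^sub>F j in sequentially. ?z j \<in> A.region s" "\<forall>\<^sub>F j in sequentially. ?z j \<in> B.region s"
    using ev by (eventually_elim, use imz s in \<open>auto simp: A.region_def B.region_def complex_eq_iff less_imp_le\<close>)+
  have "(\<lambda>j. A.K n s (?z j)) \<longlonglongrightarrow> A.K n s (of_real x)"
    using continuous_on_tendsto_compose[OF A.K_continuous[OF s] _ xr(1) evr(1), of n] lim by simp
  moreover have "(\<lambda>j. B.K n s (?z j)) \<longlonglongrightarrow> B.K n s (of_real x)"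
    using continuous_on_tendsto_compose[OF B.K_continuous[OF s] _ xr(2) evr(2), of n] lim by simp
  moreover have "\<forall>\<^sub>F j in sequentially. A.K n s (?z j) = B.K n s (?z j)"
    using ev by eventually_elim (use imz K_eq_half_disc[OF s] in blast)
  ultimately show ?thesis
  proof -
    assume A: "(\<lambda>j. A.K n s (?z j)) \<longlonglongrightarrow> A.K n s (of_real x)"
      and B: "(\<lambda>j. B.K n s (?z j)) \<longlonglongrightarrow> B.K n s (of_real x)"
      and eq: "\<forall>\<^sub>F j in sequentially. A.K n s (?z j) = B.K n s (?z j)"
    from Lim_transform_eventually[OF A eq] have "(\<lambda>j. B.K n s (?z j)) \<longlonglongrightarrow> A.K n s (of_real x)" .
    from LIMSEQ_unique[OF this B] show ?thesis .
  qed
qed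

end

section \<open>The ray over a real point as an arc of the circle\<close>

lemma cis_arctan: "cis (pi - 2 * arctan v) = (of_real v + \<i>) / (of_real v - \<i>)"
proof -
  have r: "cis (arctan v) = (1 + \<i> * of_real v) / of_real (sqrt (1 + v\<^sup>2))"
    by (simp add: complex_eq_iff cos_arctan sin_arctan)
  have nz: "of_real v - \<i> \<noteq> 0" "1 + \<i> * of_real v \<noteq> 0" "sqrt (1 + v\<^sup>2) \<noteq> 0"
    by (auto simp: complex_eq_iff real_sqrt_eq_zero_cancel_iff) (metis add_nonneg_eq_0_iff zero_le_one zero_le_power2 zero_neq_one)
  have "cis (pi - 2 * arctan v) = - 1 / (cis (arctan v) * cis (arctan v))"
    by (simp add: cis_divide[symmetric] cis_mult)
  also have "\<dots> = - of_real ((sqrt (1 + v\<^sup>2))\<^sup>2) / ((1 + \<i> * of_real v) * (1 + \<i> * of_real v))"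
    unfolding r by (simp add: power2_eq_square del: of_real_power real_sqrt_pow2 real_sqrt_mult_self)
  also have "complex_of_real ((sqrt (1 + v\<^sup>2))\<^sup>2) = (1 + \<i> * of_real v) * (1 - \<i> * of_real v)"
    by (simp add: algebra_simps power2_eq_square flip: of_real_mult)
  also have "- ((1 + \<i> * of_real v) * (1 - \<i> * of_real v)) / ((1 + \<i> * of_real v) * (1 + \<i> * of_real v))
      = - (1 - \<i> * of_real v) / (1 + \<i> * of_real v)"
  proof -
    have cancel: "- (a * b) / (a * a) = - b / a" if "a \<noteq> 0" for a b :: complex using that by simp
    show ?thesis by (rule cancel[OF nz(2)])
  qed
  also have "\<dots> = (of_real v + \<i>) / (of_real v - \<i>)"
    using nz by (simp add: divide_simps) (simp add: algebra_simps)
  finally show ?thesis .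
qed

context pencil
begin

text \<open>The argument of the Cayley transform \<open>(v + \<i>) / (v - \<i>)\<close> of the real number \<open>v = ray \<alpha> x t\<close>, by \<open>cis_arctan\<close>. As \<open>t\<close>
  tends to \<open>0\<close>, \<open>v\<close> tends to plus or minus infinity according to the sign of \<open>(x - \<alpha>)(1 - \<alpha> x)\<close>, and
  the value at \<open>t = 0\<close> is the limit \<open>0\<close> or \<open>2\<pi>\<close>.\<close>

definition angle :: "real \<Rightarrow> real \<Rightarrow> real" where
  "angle x t = (if t = 0 then (if (x - \<alpha>) * (1 - \<alpha> * x) > 0 then 0 else 2 * pi)
     else pi - 2 * arctan (Re (ray \<alpha> (of_real x) t)))"

context
  fixes x p q :: real
  assumes x: "\<bar>x\<bar> < 1" "x \<noteq> \<alpha>" "\<alpha> * x \<noteq> 1"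
    and p: "p = 1 / ((x - \<alpha>) * (1 - \<alpha> * x))" and q: "q = \<alpha> / (1 - \<alpha> * x)"
begin

abbreviation (input) "T \<equiv> max_slope \<alpha> (of_real x)"

lemma x_complex: "cmod (of_real x) < 1" "complex_of_real x \<noteq> of_real \<alpha>" "of_real \<alpha> * complex_of_real x \<noteq> 1"
  using x by (auto simp flip: of_real_mult)

lemma p_nonzero: "p \<noteq> 0" using x by (simp add: p)

lemma T_pos: "T > 0" by (rule max_slope_pos[OF x_complex(1,2)])

lemma ray_dir_real: "ray_dir \<alpha> (of_real x) = of_real p"
  by (simp add: ray_dir_def p)

lemma ray_real: "ray \<alpha> (of_real x) t = of_real (q + p / t\<^sup>2)"
  by (simp add: ray_def ray_dir_def ray_base_def p q)

lemma ray_at_T: "ray \<alpha> (of_real x) T = of_real (x / (1 - x\<^sup>2))"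
  unfolding ray_max_slope[OF x_complex] by (simp add: vertex_def)

lemma p_sign: "(x - \<alpha>) * (1 - \<alpha> * x) > 0 \<longleftrightarrow> p > 0" by (simp add: p)

lemma angle_nonzero: "t \<noteq> 0 \<Longrightarrow> angle x t = pi - 2 * arctan (q + p / t\<^sup>2)"
  by (simp add: angle_def ray_real)

lemma angle_range: "angle x t \<in> {0..2 * pi}"
  using arctan_lbound[of "Re (ray \<alpha> (of_real x) t)"] arctan_ubound[of "Re (ray \<alpha> (of_real x) t)"]
  by (auto simp: angle_def)

lemma angle_T: "angle x T = pi - 2 * arctan (x / (1 - x\<^sup>2))"
  using T_pos by (simp add: angle_def ray_at_T)

lemma angle_0: "angle x 0 = (if p > 0 then 0 else 2 * pi)"
  unfolding angle_def p_sign by simp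

lemma cis_angle:
  "cis (angle x t) = (if t = 0 then 1 else (ray \<alpha> (of_real x) t + \<i>) / (ray \<alpha> (of_real x) t - \<i>))"
proof (cases "t = 0")
  case False
  then show ?thesis unfolding angle_nonzero[OF False] cis_arctan ray_real by simp
qed (simp add: angle_def complex_eq_iff)

lemma angle_deriv:
  assumes "t > 0"
  shows "(angle x has_field_derivative 4 * p / (t ^ 3 * (1 + (q + p / t\<^sup>2)\<^sup>2))) (at t within A)"
proof -
  have D: "1 + (q + p / t\<^sup>2)\<^sup>2 \<noteq> 0" by (metis add_nonneg_eq_0_iff zero_le_one zero_le_power2 zero_neq_one)
  have d1: "((\<lambda>t. q + p / t\<^sup>2) has_field_derivative - (2 * p / t ^ 3)) (at t within A)"
    using assms by (auto intro!: derivative_eq_intros simp: power2_eq_square power3_eq_cube field_simps)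
  have "((\<lambda>t. pi - 2 * arctan (q + p / t\<^sup>2)) has_field_derivative 0 - 2 * (inverse (1 + (q + p / t\<^sup>2)\<^sup>2) * - (2 * p / t ^ 3))) (at t within A)"
    by (intro DERIV_diff DERIV_const DERIV_cmult DERIV_chain2[OF DERIV_arctan d1])
  then have "((\<lambda>t. pi - 2 * arctan (q + p / t\<^sup>2)) has_field_derivative 4 * p / (t ^ 3 * (1 + (q + p / t\<^sup>2)\<^sup>2))) (at t within A)"
    by (simp add: divide_inverse mult_ac)
  moreover have "\<forall>\<^sub>F s in nhds t. angle x s = pi - 2 * arctan (q + p / s\<^sup>2)"
    using eventually_nhds_in_open[of "{0<..}" t] assms by (auto elim!: eventually_mono simp: angle_nonzero)
  ultimately show ?thesis
    using DERIV_cong_ev has_field_derivative_cong_eventually[of "angle x" _ t A]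
    by (smt (verit) assms angle_nonzero eventually_at_filter eventually_mono has_field_derivative_cong_eventually)
qed

lemma angle_continuous: "continuous_on {0..T} (angle x)"
  unfolding continuous_on_eq_continuous_within
proof
  fix t assume t: "t \<in> {0..T}"
  show "continuous (at t within {0..T}) (angle x)"
  proof (cases "t = 0")
    case False
    then show ?thesis using angle_deriv[of t "{0..T}"] t by (auto intro: DERIV_continuous)
  next
    case True
    have "((\<lambda>t. pi - 2 * arctan (q + p / t\<^sup>2)) \<longlongrightarrow> angle x 0) (at_right 0)"
    proof (cases "p > 0")
      case True
      have "filterlim (\<lambda>t. q + p / t\<^sup>2) at_top (at_right 0)" using True by real_asymp
      then have "((\<lambda>t. pi - 2 * arctan (q + p / t\<^sup>2)) \<longlongrightarrow> pi - 2 * (pi/2)) (at_right 0)"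
        by (intro tendsto_intros filterlim_compose[OF tendsto_arctan_at_top])
      then show ?thesis using True unfolding angle_0 by simp
    next
      case False
      then have "p < 0" using p_nonzero by linarith
      then have "filterlim (\<lambda>t. q + p / t\<^sup>2) at_bot (at_right 0)" by real_asymp
      then have "((\<lambda>t. pi - 2 * arctan (q + p / t\<^sup>2)) \<longlongrightarrow> pi - 2 * (-(pi/2))) (at_right 0)"
        by (intro tendsto_intros filterlim_compose[OF tendsto_arctan_at_bot])
      then show ?thesis using False unfolding angle_0 by simp
    qed
    then have "(angle x \<longlongrightarrow> angle x 0) (at_right 0)"
      by (rule Lim_transform_eventually) (auto simp: eventually_at_filter angle_nonzero)
    moreover have "at (0::real) within {0..T} = at_right 0" using T_pos by (simp add: at_within_Icc_at_right)
    ultimately show ?thesis by (simp add: True continuous_within)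
  qed
qed

lemma W_cont_real: "s \<noteq> 0 \<Longrightarrow> continuous_on {0..T} (W n s (of_real x))"
proof -
  assume s: "s \<noteq> 0"
  have xr: "of_real x \<in> region s" using x_complex by (simp add: region_def)
  have "continuous_on {0..T} (\<lambda>t. (\<lambda>(z,t). W n s z t) (of_real x,t))"
    by (rule continuous_on_compose2[OF W_continuous[OF s]]) (use xr in \<open>auto intro!: continuous_intros\<close>)
  then show ?thesis by simp
qed

text \<open>The substitution \<open>\<theta> = angle x t\<close> in the ray integral. For \<open>p > 0\<close> the ray ends at plus infinity and covers the first part
  of the circle, for \<open>p < 0\<close> at minus infinity and covers the last part, with the opposite orientation.\<close>

lemma arc_integral:
  assumes s: "s \<noteq> 0" and f: "continuous_on {0..2 * pi} f"
    and W: "\<And>t. 0 < t \<Longrightarrow> t \<le> T \<Longrightarrow> (4 * p / (t ^ 3 * (1 + (q + p / t\<^sup>2)\<^sup>2))) *\<^sub>R f (angle x t) = 2 * W n s (of_real x) t"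
  shows "p > 0 \<Longrightarrow> integral {0..pi - 2 * arctan (x / (1 - x\<^sup>2))} f = 2 * K n s (of_real x)"
    and "p < 0 \<Longrightarrow> integral {pi - 2 * arctan (x / (1 - x\<^sup>2))..2 * pi} f = - 2 * K n s (of_real x)"
proof -
  let ?th = "pi - 2 * arctan (x / (1 - x\<^sup>2))"
  have th: "0 < ?th" "?th < 2 * pi" using arctan_lbound[of "x / (1 - x\<^sup>2)"] arctan_ubound[of "x / (1 - x\<^sup>2)"] by linarith+
  have I: "((\<lambda>t. (4 * p / (t ^ 3 * (1 + (q + p / t\<^sup>2)\<^sup>2))) *\<^sub>R f (angle x t)) has_integral
     (integral {angle x 0..angle x T} f - integral {angle x T..angle x 0} f)) {0..T}"
    by (rule has_integral_substitution_general[where s = "{0}" and c = 0 and d = "2 * pi"])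
       (use T_pos f angle_continuous angle_deriv angle_range in auto)
  have "((\<lambda>t. 2 * W n s (of_real x) t) has_integral
     (integral {angle x 0..angle x T} f - integral {angle x T..angle x 0} f)) {0..T}"
    by (rule has_integral_spike_finite[OF _ _ I, of "{0}"]) (use W in auto)
  moreover have "((\<lambda>t. 2 * W n s (of_real x) t) has_integral 2 * K n s (of_real x)) {0..T}"
    unfolding K_def by (intro has_integral_mult_right integrable_integral integrable_continuous_real W_cont_real s)
  ultimately have eq: "integral {angle x 0..angle x T} f - integral {angle x T..angle x 0} f = 2 * K n s (of_real x)"
    by (rule has_integral_unique)
  show "p > 0 \<Longrightarrow> integral {0..?th} f = 2 * K n s (of_real x)"
    using eq th unfolding angle_0 angle_T by simp
  show "p < 0 \<Longrightarrow> integral {?th..2 * pi} f = - 2 * K n s (of_real x)"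
  proof -
    assume "p < 0"
    then have "integral {2 * pi..?th} f - integral {?th..2 * pi} f = 2 * K n s (of_real x)"
      using eq unfolding angle_0 angle_T by simp
    moreover have "integral {2 * pi..?th} f = 0" using th by simp
    ultimately show ?thesis by (metis diff_0 minus_minus mult_minus_left)
  qed
qed

text \<open>The density \<open>d\<theta>/dt\<close> and the characters on the circle combine to the test functions with \<open>s = 1\<close> and \<open>s = -1\<close>.\<close>

lemma test_fun_angle:
  assumes t: "0 < t" and v: "v = ray \<alpha> (of_real x) t"
  shows "(4 * p / (t ^ 3 * (1 + (q + p / t\<^sup>2)\<^sup>2))) *\<^sub>R (G (of_real x) t / (v - \<i>) ^ m * cis (of_int (int n + 1) * angle x t)) = 2 * W n 1 (of_real x) t"
    and "(4 * p / (t ^ 3 * (1 + (q + p / t\<^sup>2)\<^sup>2))) *\<^sub>R (G (of_real x) t / (v - \<i>) ^ m * cis (of_int (- (int (m + 1 + n))) * angle x t)) = 2 * W n (-1) (of_real x) t"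
proof -
  let ?r = "q + p / t\<^sup>2"
  have vr: "v = of_real ?r" unfolding v ray_real ..
  have nz: "v + \<i> \<noteq> 0" "v - \<i> \<noteq> 0" unfolding vr by (auto simp: complex_eq_iff)
  have prod: "complex_of_real (1 + ?r\<^sup>2) = (v + \<i>) * (v - \<i>)" unfolding vr by (simp add: algebra_simps power2_eq_square)
  have c: "cis (angle x t) = (v + \<i>) / (v - \<i>)" using cis_angle[of t] t v by simp
  have sc: "(4 * p / (t ^ 3 * (1 + ?r\<^sup>2))) *\<^sub>R X = 4 * of_real p / (of_real t ^ 3 * ((v + \<i>) * (v - \<i>))) * X" for X :: complex
    unfolding scaleR_conv_of_real of_real_divide of_real_mult of_real_power prod[symmetric] by simp
  have cp: "cis (of_int (int n + 1) * angle x t) = ((v + \<i>) / (v - \<i>)) ^ (n + 1)"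
    unfolding c[symmetric] Complex.DeMoivre by (simp add: add.commute)
  have cm: "cis (of_int (- (int (m + 1 + n))) * angle x t) = ((v - \<i>) / (v + \<i>)) ^ (m + 1 + n)"
  proof -
    have "cis (of_int (- (int (m + 1 + n))) * angle x t) = cis (- angle x t) ^ (m + 1 + n)"
      unfolding Complex.DeMoivre by (simp add: algebra_simps)
    also have "cis (- angle x t) = (v - \<i>) / (v + \<i>)" using c by (simp flip: cis_inverse)
    finally show ?thesis .
  qed
  have alg: "4 * P / (c * (a * b)) * (g / b ^ m * (a / b) ^ (n + 1)) = 2 * (g * (a ^ n / b ^ (m + 2 + n)) * (2 * P) / c)"
    "4 * P / (c * (a * b)) * (g / b ^ m * (b / a) ^ (m + 1 + n)) = 2 * (g * (b ^ n / a ^ (m + 2 + n)) * (2 * P) / c)"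
    if "a \<noteq> 0" "b \<noteq> 0" "c \<noteq> 0" for P a b c g :: complex
    using that by (simp_all add: field_simps power_add power2_eq_square)
  have test: "test_fun m n 1 v = (v + \<i>) ^ n / (v - \<i>) ^ (m + 2 + n)"
    "test_fun m n (- 1) v = (v - \<i>) ^ n / (v + \<i>) ^ (m + 2 + n)" by (simp_all add: test_fun_def)
  have t3: "complex_of_real t ^ 3 \<noteq> 0" using t by simp
  show "(4 * p / (t ^ 3 * (1 + ?r\<^sup>2))) *\<^sub>R (G (of_real x) t / (v - \<i>) ^ m * cis (of_int (int n + 1) * angle x t)) = 2 * W n 1 (of_real x) t"
    unfolding sc cp W_eq[OF t] v[symmetric] ray_dir_real test by (rule alg(1)[OF nz t3])
  show "(4 * p / (t ^ 3 * (1 + ?r\<^sup>2))) *\<^sub>R (G (of_real x) t / (v - \<i>) ^ m * cis (of_int (- (int (m + 1 + n))) * angle x t)) = 2 * W n (-1) (of_real x) t"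
    unfolding sc cm W_eq[OF t] v[symmetric] ray_dir_real test by (rule alg(2)[OF nz t3])
qed

end

end

section \<open>The slice extensions over a real point are polynomial along the rays\<close>

text \<open>The inverse of the Cayley transform from the real line to the circle without \<open>1\<close>.\<close>

definition circle_coord :: "complex \<Rightarrow> real" where
  "circle_coord e = Re (\<i> * (e + 1) / (e - 1))"

lemma circle_coord_inverse: "circle_coord ((of_real v + \<i>) / (of_real v - \<i>)) = v"
proof -
  have nz: "of_real v - \<i> \<noteq> 0" by (auto simp: complex_eq_iff)
  have "(of_real v + \<i>) / (of_real v - \<i>) + 1 = 2 * of_real v / (of_real v - \<i>)"
    "(of_real v + \<i>) / (of_real v - \<i>) - 1 = 2 * \<i> / (of_real v - \<i>)"
    using nz by (simp_all add: field_simps)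
  then show ?thesis unfolding circle_coord_def using nz by simp
qed

lemma circle_coord_eq:
  assumes e: "cmod e = 1" "e \<noteq> 1"
  shows "e = (of_real (circle_coord e) + \<i>) / (of_real (circle_coord e) - \<i>)"
proof -
  let ?w = "\<i> * (e + 1) / (e - 1)"
  have ee: "e * cnj e = 1" using e(1) by (simp add: complex_norm_square[symmetric])
  have e0: "e - 1 \<noteq> 0" using e by simp
  have ce0: "cnj e - 1 \<noteq> 0" using e0 by (metis complex_cnj_diff complex_cnj_one complex_cnj_zero_iff)
  have "cnj ?w = (- \<i>) * (cnj e + 1) / (cnj e - 1)" by simp
  also have "\<dots> = ?w"
  proof -
    have "(cnj e + 1) * (e - 1) = - ((e + 1) * (cnj e - 1))" using ee by (simp add: algebra_simps)
    then have "(- \<i>) * (cnj e + 1) * (e - 1) = \<i> * (e + 1) * (cnj e - 1)" by (simp add: mult.assoc)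
    then show ?thesis by (simp only: frac_eq_eq[OF ce0 e0])
  qed
  finally have "?w \<in> \<real>" by (simp add: Reals_cnj_iff)
  then have w: "of_real (circle_coord e) = ?w" unfolding circle_coord_def by simp
  have "?w + \<i> = 2 * \<i> * e / (e - 1)" "?w - \<i> = 2 * \<i> / (e - 1)"
    using e0 by (simp_all add: field_simps)
  then show ?thesis unfolding w using e0 by simp
qed

context pencil
begin

text \<open>The slope \<open>t = 0\<close> is the point at infinity of the ray, and the value \<open>0\<close> there is the limit (\<open>Y_continuous\<close>).\<close>

definition Y :: "real \<Rightarrow> real \<Rightarrow> complex" where
  "Y x t = (if t = 0 then 0 else G (of_real x) t / (ray \<alpha> (of_real x) t - \<i>) ^ m)"

context
  fixes x p q :: real
  assumes x: "\<bar>x\<bar> < 1" "x \<noteq> \<alpha>" "\<alpha> * x \<noteq> 1"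
    and p: "p = 1 / ((x - \<alpha>) * (1 - \<alpha> * x))" and q: "q = \<alpha> / (1 - \<alpha> * x)"
begin

lemmas ray_facts = x_complex[OF x p q] T_pos[OF x p q] ray_real[OF x p q] cis_angle[OF x p q] p_nonzero[OF x p q]

text \<open>In \<open>Y\<close> the boundedness of \<open>h\<close> comes with the power \<open>N - 1 > 0\<close> of \<open>t\<close>, so that \<open>Y\<close> tends to \<open>0\<close> at infinity.\<close>

lemma Y_continuous: "continuous_on {0..max_slope \<alpha> (of_real x)} (Y x)"
proof -
  let ?z = "complex_of_real x" and ?T = "max_slope \<alpha> (of_real x)"
  have xr: "?z \<in> region 1" using ray_facts by (simp add: region_def)
  have N1: "N - 1 > 0" using N_ge by simp
  have "continuous_on {0..?T} (\<lambda>t. (\<lambda>(z,t). h t z * of_real t ^ (N - 1)) (?z, t))"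
    by (rule continuous_on_compose2[OF weighted_h_continuous[OF N1, of 1]])
       (use xr in \<open>auto intro!: continuous_intros\<close>)
  then have c1: "continuous_on {0..?T} (\<lambda>t. h t ?z * of_real t ^ (N - 1))" by simp
  have nz: "kern_num \<alpha> (-1) ?z t \<noteq> 0" if "t \<in> {0..?T}" for t
    using kern_num_nonzero[of ?z \<alpha> 1 t] ray_facts that by simp
  have c2: "continuous_on {0..?T} (\<lambda>t. kern_num \<alpha> (-1) ?z t)"
    unfolding kern_num_def by (intro continuous_intros)
  have "continuous_on {0..?T} (\<lambda>t. h t ?z * of_real t ^ (N - 1) * ((?z - of_real \<alpha>) powi (- k) / kern_num \<alpha> (-1) ?z t ^ m))"
    by (intro continuous_intros c1 c2) (use nz in auto)
  moreover have "h t ?z * of_real t ^ (N - 1) * ((?z - of_real \<alpha>) powi (- k) / kern_num \<alpha> (-1) ?z t ^ m) = Y x t"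
    if t: "t \<in> {0..?T}" for t
  proof (cases "t = 0")
    case True then show ?thesis using N1 by (simp add: Y_def power_0_left)
  next
    case False
    let ?t = "complex_of_real t"
    have t0: "?t \<noteq> 0" using False by simp
    have "?t ^ (N - 1) = ?t powi (int (N - 1))" by (simp only: power_int_of_nat)
    also have "int (N - 1) = - k + int (2 * m)" using N_eq N_ge by linarith
    also have "?t powi (- k + int (2 * m)) = ?t powi (- k) * ?t powi int (2 * m)"
      by (rule power_int_add) (use t0 in simp)
    finally have tN: "?t ^ (N - 1) = ?t powi (- k) * (of_real (t\<^sup>2)) ^ m"
      by (simp only: power_int_of_nat power_mult of_real_power)
    have kn: "kern_num \<alpha> (-1) ?z t = of_real (t\<^sup>2) * (ray \<alpha> ?z t - \<i>)"
      using kern_num_ray[OF False, of \<alpha> "-1" ?z] by simp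
    have "complex_of_real (t\<^sup>2) ^ m \<noteq> 0" using False by simp
    then show ?thesis unfolding tN kn Y_def G_def power_int_mult_distrib power_mult_distrib
      using False by (simp add: mult_ac)
  qed
  ultimately show ?thesis by (rule continuous_on_eq)
qed

lemma cis_angle_ne_1: "t \<noteq> 0 \<Longrightarrow> cis (angle x t) \<noteq> 1"
proof
  assume t: "t \<noteq> 0" and 1: "cis (angle x t) = 1"
  have "complex_of_real (q + p / t\<^sup>2) - \<i> \<noteq> 0" by (auto simp: complex_eq_iff)
  moreover have "(complex_of_real (q + p / t\<^sup>2) + \<i>) / (of_real (q + p / t\<^sup>2) - \<i>) = 1"
    using ray_facts(6)[of t] t 1 unfolding ray_facts(5) by simp
  ultimately have "complex_of_real (q + p / t\<^sup>2) + \<i> = of_real (q + p / t\<^sup>2) - \<i>" by (simp only: divide_eq_1_iff)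
  then show False by (simp add: complex_eq_iff)
qed

lemma circle_coord_cis_angle: "t \<noteq> 0 \<Longrightarrow> circle_coord (cis (angle x t)) = q + p / t\<^sup>2"
  using ray_facts(6)[of t] circle_coord_inverse[of "q + p / t\<^sup>2"] by (simp add: ray_facts(5))

lemma slope_of_coord: "t > 0 \<Longrightarrow> sqrt (p / (q + p / t\<^sup>2 - q)) = t"
  using ray_facts(7) by (simp add: real_sqrt_unique)

text \<open>The parametrisation of the arc is a continuous injection of a compact interval, so its inverse is continuous.\<close>

lemma arc_closed_continuous:
  assumes y: "\<And>t. t \<in> {0..max_slope \<alpha> (of_real x)} \<Longrightarrow> y (cis (angle x t)) = Y x t"
  defines "carc \<equiv> (\<lambda>t. cis (angle x t)) ` {0..max_slope \<alpha> (of_real x)}"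
  shows "closed carc" "continuous_on carc y"
proof -
  let ?T = "max_slope \<alpha> (of_real x)"
  have c: "continuous_on {0..?T} (\<lambda>t. cis (angle x t))"
    by (intro continuous_intros angle_continuous[OF x p q])
  then show "closed carc" unfolding carc_def by (intro compact_imp_closed compact_continuous_image) auto
  define gi where "gi e = (if e = 1 then 0 else sqrt (p / (circle_coord e - q)))" for e
  have gi: "gi (cis (angle x t)) = t" if "t \<in> {0..?T}" for t
  proof (cases "t = 0")
    case True then show ?thesis by (simp add: gi_def ray_facts(6))
  next
    case False
    then show ?thesis using that cis_angle_ne_1[OF False] circle_coord_cis_angle[OF False] slope_of_coord[of t]
      by (simp add: gi_def)
  qed
  have gic: "continuous_on carc gi"
    unfolding carc_def by (rule continuous_on_inv[OF c]) (use gi in auto)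
  have "continuous_on carc (\<lambda>e. Y x (gi e))"
    by (rule continuous_on_compose2[OF Y_continuous gic]) (use gi in \<open>auto simp: carc_def\<close>)
  then show "continuous_on carc y"
    by (rule continuous_on_eq) (use gi y in \<open>auto simp: carc_def\<close>)
qed

lemma arc_covers:
  assumes e: "cmod e = 1" "e \<noteq> 1"
    and v: "(p > 0 \<and> circle_coord e \<ge> x / (1 - x\<^sup>2)) \<or> (p < 0 \<and> circle_coord e \<le> x / (1 - x\<^sup>2))"
  shows "e \<in> (\<lambda>t. cis (angle x t)) ` {0..max_slope \<alpha> (of_real x)}"
proof -
  let ?T = "max_slope \<alpha> (of_real x)" and ?v = "circle_coord e"
  have T: "?T > 0" by (rule ray_facts)
  have v0: "x / (1 - x\<^sup>2) = q + p / ?T\<^sup>2"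
    using ray_at_T[OF x p q] unfolding ray_facts(5) of_real_eq_iff by simp
  define t where "t = sqrt (p / (?v - q))"
  have pT: "p / ?T\<^sup>2 \<noteq> 0" "(p / ?T\<^sup>2 > 0) = (p > 0)" using ray_facts T by (auto simp: zero_less_divide_iff)
  have rat: "0 < p / (?v - q)" "p / (?v - q) \<le> ?T\<^sup>2"
  proof -
    consider "p > 0" "?v - q \<ge> p / ?T\<^sup>2" | "p < 0" "?v - q \<le> p / ?T\<^sup>2" using v v0 by linarith
    then have "0 < p / (?v - q) \<and> p / (?v - q) \<le> ?T\<^sup>2"
    proof cases
      case 1
      then have "?v - q > 0" using pT by linarith
      then show ?thesis using 1 T by (simp add: field_simps)
    next
      case 2
      then have "p / ?T\<^sup>2 < 0" using T by (simp add: divide_neg_pos)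
      then have "?v - q < 0" using 2 by linarith
      then show ?thesis using 2 T by (simp add: zero_less_divide_iff field_simps)
    qed
    then show "0 < p / (?v - q)" "p / (?v - q) \<le> ?T\<^sup>2" by auto
  qed
  have t2: "t\<^sup>2 = p / (?v - q)" using rat by (simp add: t_def)
  have t: "t > 0" "t \<le> ?T" using rat T by (auto simp: t_def real_le_lsqrt real_sqrt_le_iff intro!: real_le_lsqrt)
  have "q + p / t\<^sup>2 = ?v" unfolding t2 using rat ray_facts(7) by auto
  then have "cis (angle x t) = (of_real ?v + \<i>) / (of_real ?v - \<i>)"
    using t ray_facts(6)[of t] by (simp add: ray_facts(5))
  then have "e = cis (angle x t)" using circle_coord_eq[OF e] by simp
  then show ?thesis using t by auto
qed

end

end

context two_pencils
begin

text \<open>The two rays over \<open>x\<close> share the vertex and fill the real line. The functions \<open>Y\<close> of the two pencils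
  agree at the vertex and at infinity, so on the circle they form one continuous function \<open>y\<close>. Its Fourier
  coefficients with index outside \<open>{0..m}\<close> are differences of ray integrals of the two pencils and vanish by
  \<open>K_eq_real\<close>. Hence \<open>y\<close> is a polynomial of degree at most \<open>m\<close> on the circle, and \<open>y (v - \<i>)\<^sup>m\<close> is a polynomial in \<open>v\<close>.\<close>

lemma polynomial_on_real_line:
  fixes x :: real
  assumes x: "\<bar>x\<bar> < 1" "(x - \<alpha>) * (1 - \<alpha> * x) > 0" "(x - \<beta>) * (1 - \<beta> * x) < 0"
  obtains P where "degree P \<le> nat k" "k < 0 \<Longrightarrow> P = 0"
    "\<And>t. 0 < t \<Longrightarrow> t \<le> max_slope \<alpha> (of_real x) \<Longrightarrow> A.G (of_real x) t = poly P (ray \<alpha> (of_real x) t)"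
    "\<And>t. 0 < t \<Longrightarrow> t \<le> max_slope \<beta> (of_real x) \<Longrightarrow> B.G (of_real x) t = poly P (ray \<beta> (of_real x) t)"
proof -
  let ?z = "complex_of_real x" and ?v0 = "x / (1 - x\<^sup>2)"
  let ?TA = "max_slope \<alpha> ?z" and ?TB = "max_slope \<beta> ?z"
  have xA: "\<bar>x\<bar> < 1" "x \<noteq> \<alpha>" "\<alpha> * x \<noteq> 1" and xB: "\<bar>x\<bar> < 1" "x \<noteq> \<beta>" "\<beta> * x \<noteq> 1" using x by auto
  define p where "p = 1 / ((x - \<alpha>) * (1 - \<alpha> * x))"
  define q where "q = \<alpha> / (1 - \<alpha> * x)"
  define p' where "p' = 1 / ((x - \<beta>) * (1 - \<beta> * x))"
  define q' where "q' = \<beta> / (1 - \<beta> * x)"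
  note RA = A.ray_facts[OF xA p_def q_def] and RB = B.ray_facts[OF xB p'_def q'_def]
  have pp: "p > 0" "p' < 0" using x by (simp_all add: p_def p'_def)
  have v0A: "?v0 = q + p / ?TA\<^sup>2"
    using A.ray_at_T[OF xA p_def q_def] unfolding RA(5) of_real_eq_iff by simp
  have v0B: "?v0 = q' + p' / ?TB\<^sup>2"
    using B.ray_at_T[OF xB p'_def q'_def] unfolding RB(5) of_real_eq_iff by simp
  define y where "y e = (if e = 1 then 0 else if circle_coord e \<ge> ?v0
     then A.Y x (sqrt (p / (circle_coord e - q))) else B.Y x (sqrt (p' / (circle_coord e - q'))))" for e
  have yA: "y (cis (A.angle x t)) = A.Y x t" if t: "t \<in> {0..?TA}" for t
  proof (cases "t = 0")
    case True then show ?thesis by (simp add: y_def RA(6) A.Y_def)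
  next
    case False
    have "p / ?TA\<^sup>2 \<le> p / t\<^sup>2" using pp t False by (intro divide_left_mono power_mono mult_pos_pos) auto
    then have "circle_coord (cis (A.angle x t)) \<ge> ?v0"
      unfolding A.circle_coord_cis_angle[OF xA p_def q_def False] v0A by simp
    then show ?thesis
      using A.cis_angle_ne_1[OF xA p_def q_def False] A.circle_coord_cis_angle[OF xA p_def q_def False]
        A.slope_of_coord[OF xA p_def q_def, of t] t False by (simp add: y_def)
  qed
  have yB: "y (cis (B.angle x t)) = B.Y x t" if t: "t \<in> {0..?TB}" for t
  proof (cases "t = 0")
    case True then show ?thesis by (simp add: y_def RB(6) B.Y_def)
  next
    case False
    note co = B.circle_coord_cis_angle[OF xB p'_def q'_def False]
    show ?thesis
    proof (cases "t = ?TB")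
      case True
      have "B.angle x t = A.angle x ?TA" unfolding True B.angle_T[OF xB p'_def q'_def] A.angle_T[OF xA p_def q_def] ..
      then have "y (cis (B.angle x t)) = A.Y x ?TA" using yA[of ?TA] RA(4) by simp
      also have "\<dots> = B.Y x ?TB"
        using RA(4) RB(4) A.boundary_value[OF RA(1-3)] B.boundary_value[OF RB(1-3)]
        by (simp add: A.Y_def B.Y_def A.ray_at_T[OF xA p_def q_def] B.ray_at_T[OF xB p'_def q'_def])
      finally show ?thesis using True by simp
    next
      case False
      then have tl: "0 < t" "t < ?TB" using t \<open>t \<noteq> 0\<close> by auto
      have "t\<^sup>2 < ?TB\<^sup>2" using tl by (intro power_strict_mono) auto
      then have "p' / t\<^sup>2 < p' / ?TB\<^sup>2" using pp tl by (intro divide_strict_left_mono_neg mult_pos_pos) auto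
      then have "\<not> circle_coord (cis (B.angle x t)) \<ge> ?v0" unfolding co v0B by simp
      then show ?thesis
        using B.cis_angle_ne_1[OF xB p'_def q'_def \<open>t \<noteq> 0\<close>] co
          B.slope_of_coord[OF xB p'_def q'_def, of t] tl by (simp add: y_def)
    qed
  qed
  have ycont: "continuous_on (sphere 0 1) y"
  proof -
    let ?a = "(\<lambda>t. cis (A.angle x t)) ` {0..?TA}" and ?b = "(\<lambda>t. cis (B.angle x t)) ` {0..?TB}"
    have "continuous_on (?a \<union> ?b) y"
      by (intro continuous_on_closed_Un A.arc_closed_continuous[OF xA p_def q_def yA] B.arc_closed_continuous[OF xB p'_def q'_def yB])
    moreover have "sphere 0 1 \<subseteq> ?a \<union> ?b"
    proof
      fix e :: complex assume e: "e \<in> sphere 0 1"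
      show "e \<in> ?a \<union> ?b"
      proof (cases "e = 1")
        case True
        then have "e = cis (A.angle x 0)" by (simp add: RA(6))
        then show ?thesis using RA(4) by auto
      next
        case False
        then show ?thesis
          using A.arc_covers[OF xA p_def q_def, of e] B.arc_covers[OF xB p'_def q'_def, of e] e pp by force
      qed
    qed
    ultimately show ?thesis by (rule continuous_on_subset)
  qed
  have zero: "fourier_coeff (\<lambda>\<theta>. y (cis \<theta>)) j = 0"
    if j: "j < 0 \<or> j > int A.m" for j
  proof -
    define f where "f \<theta> = y (cis \<theta>) * cis (of_int (- j) * \<theta>)" for \<theta>
    have fc: "continuous_on S f" for S
      unfolding f_def by (intro continuous_intros continuous_on_compose2[OF ycont]) auto
    have fper: "f (\<theta> + 2 * pi) = f \<theta>" for \<theta>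
    proof -
      have "cis (of_int (- j) * (\<theta> + 2 * pi)) = cis (of_int (- j) * \<theta>) * cis (2 * pi * of_int (- j))"
        by (simp add: cis_mult algebra_simps)
      also have "cis (2 * pi * of_int (- j)) = 1" by (rule cis_multiple_2pi) simp
      finally have "cis (of_int (- j) * (\<theta> + 2 * pi)) = cis (of_int (- j) * \<theta>)" by simp
      moreover have "cis (\<theta> + 2 * pi) = cis \<theta>" by (simp add: complex_eq_iff)
      ultimately show ?thesis by (simp only: f_def)
    qed
    \<comment> \<open>negative indices are detected on the side \<open>s = 1\<close>, those above \<open>m\<close> on the side \<open>s = -1\<close>\<close>
    obtain n and s :: real where ns: "s \<noteq> 0" "(s = 1 \<and> - j = int n + 1) \<or> (s = -1 \<and> - j = - int (A.m + 1 + n))"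
    proof (cases "j < 0")
      case True
      then show ?thesis using that[of 1 "nat (- j - 1)"] by simp
    next
      case False
      then show ?thesis using that[of "-1" "nat (j - int A.m - 1)"] j by simp
    qed
    let ?th = "pi - 2 * arctan ?v0"
    have th: "0 \<le> ?th" "?th \<le> 2 * pi" using arctan_lbound[of ?v0] arctan_ubound[of ?v0] by linarith+
    have fA: "f (A.angle x t) = A.G ?z t / (ray \<alpha> ?z t - \<i>) ^ A.m * cis (of_int (- j) * A.angle x t)"
      if "0 < t" "t \<le> ?TA" for t using yA[of t] that by (simp add: f_def A.Y_def)
    have fB: "f (B.angle x t) = B.G ?z t / (ray \<beta> ?z t - \<i>) ^ A.m * cis (of_int (- j) * B.angle x t)"
      if "0 < t" "t \<le> ?TB" for t using yB[of t] that by (simp add: f_def B.Y_def)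
    have WA: "(4 * p / (t ^ 3 * (1 + (q + p / t\<^sup>2)\<^sup>2))) *\<^sub>R f (A.angle x t) = 2 * A.W n s ?z t"
      if t: "0 < t" "t \<le> ?TA" for t
      unfolding fA[OF t] using ns(2) A.test_fun_angle[OF xA p_def q_def t(1) refl, of n]
      by (elim disjE conjE) (simp_all only:)
    have WB: "(4 * p' / (t ^ 3 * (1 + (q' + p' / t\<^sup>2)\<^sup>2))) *\<^sub>R f (B.angle x t) = 2 * B.W n s ?z t"
      if t: "0 < t" "t \<le> ?TB" for t
      unfolding fB[OF t] using ns(2) B.test_fun_angle[OF xB p'_def q'_def t(1) refl, of n]
      by (elim disjE conjE) (simp_all only:)
    have "integral {0..2 * pi} f = integral {0..?th} f + integral {?th..2 * pi} f"
      using Henstock_Kurzweil_Integration.integral_combine[OF th, of f] integrable_continuous_real[OF fc] by simp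
    also have "\<dots> = 2 * A.K n s ?z - 2 * B.K n s ?z"
      using A.arc_integral(1)[OF xA p_def q_def ns(1) fc WA pp(1)]
        B.arc_integral(2)[OF xB p'_def q'_def ns(1) fc WB pp(2)] by simp
    also have "\<dots> = 0" using K_eq_real[OF ns(1) xA xB(2,3), of n] by simp
    finally have "integral {-pi..pi} f = 0" using integral_0_2pi[of f] fc fper by simp
    then show ?thesis unfolding fourier_coeff_def f_def by simp
  qed
  obtain c where c: "\<And>e. e \<in> sphere 0 1 \<Longrightarrow> y e = (\<Sum>j\<le>A.m. c j * e ^ j)"
    using circle_function_polynomial_if_fourier_coeffs_0[OF ycont zero] by blast
  \<comment> \<open>the vanishing at infinity, which lowers the degree from \<open>m\<close> to \<open>m - 1 = nat k\<close>\<close>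
  have c0: "(\<Sum>j\<le>A.m. c j) = 0" using c[of 1] by (simp add: y_def)
  \<comment> \<open>the monomial \<open>e ^ j\<close> on the circle times \<open>(v - \<i>) ^ m\<close>\<close>
  define L where "L j = [:\<i>, 1:] ^ j * [:- \<i>, 1:] ^ (A.m - j)" for j
  define P where "P = (\<Sum>j\<le>A.m. smult (c j) (L j))"
  have L: "degree (L j) = A.m" "coeff (L j) A.m = 1" if "j \<le> A.m" for j
  proof -
    show d: "degree (L j) = A.m" using that unfolding L_def
      by (subst degree_mult_eq) (auto simp: degree_linear_power)
    have "lead_coeff (L j) = 1" unfolding L_def lead_coeff_mult lead_coeff_power by simp
    then show "coeff (L j) A.m = 1" using d by simp
  qed
  have Pdeg: "degree P \<le> nat k"
  proof (rule degree_le, intro allI impI)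
    fix i assume i: "nat k < i"
    then consider "i = A.m" | "i > A.m" by (fastforce simp: A.m_def)
    then show "coeff P i = 0"
    proof cases
      case 1
      then show ?thesis using L(2) c0 by (simp add: P_def coeff_sum)
    next
      case 2
      then have "coeff (L j) i = 0" if "j \<le> A.m" for j using L(1)[OF that] by (intro coeff_eq_0) simp
      then show ?thesis by (simp add: P_def coeff_sum)
    qed
  qed
  have Peval: "y ((v + \<i>) / (v - \<i>)) * (v - \<i>) ^ A.m = poly P v" if v: "v \<in> \<real>" for v
  proof -
    have nz: "v - \<i> \<noteq> 0" using v by (auto simp: complex_is_Real_iff complex_eq_iff)
    have "cmod (v + \<i>) = cmod (v - \<i>)"
      using v by (simp add: complex_is_Real_iff cmod_def)
    then have "(v + \<i>) / (v - \<i>) \<in> sphere 0 1" using nz by (simp add: norm_divide)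
    then have "y ((v + \<i>) / (v - \<i>)) * (v - \<i>) ^ A.m = (\<Sum>j\<le>A.m. c j * ((v + \<i>) / (v - \<i>)) ^ j * (v - \<i>) ^ A.m)"
      by (simp add: c sum_distrib_right)
    also have "\<dots> = (\<Sum>j\<le>A.m. c j * ((v + \<i>) ^ j * (v - \<i>) ^ (A.m - j)))"
    proof (rule sum.cong[OF refl])
      fix j assume "j \<in> {..A.m}"
      then have "(v - \<i>) ^ A.m = (v - \<i>) ^ j * (v - \<i>) ^ (A.m - j)" by (simp flip: power_add)
      then show "c j * ((v + \<i>) / (v - \<i>)) ^ j * (v - \<i>) ^ A.m = c j * ((v + \<i>) ^ j * (v - \<i>) ^ (A.m - j))"
        using nz by (simp add: power_divide)
    qed
    also have "\<dots> = poly P v" by (simp add: P_def L_def poly_sum add.commute)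
    finally show ?thesis .
  qed
  have GA: "A.G ?z t = poly P (ray \<alpha> ?z t)" if t: "0 < t" "t \<le> ?TA" for t
  proof -
    let ?v = "ray \<alpha> ?z t"
    have vr: "?v \<in> \<real>" unfolding RA(5) by simp
    have nz: "?v - \<i> \<noteq> 0" unfolding RA(5) by (auto simp: complex_eq_iff)
    have "y ((?v + \<i>) / (?v - \<i>)) = A.Y x t" using yA[of t] RA(6)[of t] t by simp
    then have "A.G ?z t / (?v - \<i>) ^ A.m * (?v - \<i>) ^ A.m = poly P ?v" using Peval[OF vr] t by (simp add: A.Y_def)
    then show ?thesis using nz by simp
  qed
  have GB: "B.G ?z t = poly P (ray \<beta> ?z t)" if t: "0 < t" "t \<le> ?TB" for t
  proof -
    let ?v = "ray \<beta> ?z t"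
    have vr: "?v \<in> \<real>" unfolding RB(5) by simp
    have nz: "?v - \<i> \<noteq> 0" unfolding RB(5) by (auto simp: complex_eq_iff)
    have "y ((?v + \<i>) / (?v - \<i>)) = B.Y x t" using yB[of t] RB(6)[of t] t by simp
    then have "B.G ?z t / (?v - \<i>) ^ A.m * (?v - \<i>) ^ A.m = poly P ?v" using Peval[OF vr] t by (simp add: B.Y_def)
    then show ?thesis using nz by simp
  qed
  \<comment> \<open>a constant \<open>G = h * w ^ nat (- k)\<close> must be zero, since \<open>h\<close> is bounded and \<open>w = t (x - \<alpha>)\<close> tends to \<open>0\<close>\<close>
  have P0: "P = 0" if k: "k < 0"
  proof -
    have "degree P = 0" using Pdeg k by simp
    then obtain c where Pc: "P = [:c:]" by (rule degree_eq_zeroE)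
    obtain C where C: "C > 0" "\<And>t z. t > 0 \<Longrightarrow> t\<^sup>2 * (\<alpha>\<^sup>2 - 1) < 1 \<Longrightarrow> z \<in> slice_cdisc \<alpha> t \<Longrightarrow> cmod (hA t z) \<le> C"
      using A.h_bounded by blast
    have xr: "?z \<in> A.region 1" using RA by (simp add: A.region_def)
    define n where "n = nat (- k)"
    have n: "n > 0" "- k = int n" using k by (auto simp: n_def)
    have b: "cmod c \<le> C * (t * \<bar>x - \<alpha>\<bar>) ^ n" if t: "0 < t" "t \<le> ?TA" for t
    proof -
      have "c = hA t ?z * (of_real t * (?z - of_real \<alpha>)) ^ n"
        using GA[OF t] by (simp add: Pc A.G_def n(2) power_int_of_nat)
      then have "cmod c = cmod (hA t ?z) * (t * \<bar>x - \<alpha>\<bar>) ^ n"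
        using t by (simp add: norm_mult norm_power flip: of_real_diff)
      also have "\<dots> \<le> C * (t * \<bar>x - \<alpha>\<bar>) ^ n"
        by (intro mult_right_mono C A.admissible_in_region[OF xr t] t) (use t in simp)
      finally show ?thesis .
    qed
    have "((\<lambda>t. C * (t * \<bar>x - \<alpha>\<bar>) ^ n) \<longlongrightarrow> C * (0 * \<bar>x - \<alpha>\<bar>) ^ n) (at_right 0)"
      by (intro tendsto_intros)
    then have lim: "((\<lambda>t. C * (t * \<bar>x - \<alpha>\<bar>) ^ n) \<longlongrightarrow> 0) (at_right 0)" using n by (simp add: power_0_left)
    have "\<forall>\<^sub>F t in at_right 0. cmod c \<le> C * (t * \<bar>x - \<alpha>\<bar>) ^ n"
      using eventually_at_right_less[of 0] eventually_at_right_field[of "\<lambda>t. t < ?TA" 0] RA(4)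
      by (auto simp: eventually_at_right_field intro!: exI[of _ ?TA] b)
    then have "cmod c \<le> 0" by (intro tendsto_lowerbound[OF lim]) auto
    then show ?thesis by (simp add: Pc)
  qed
  show ?thesis using that[OF Pdeg P0 GA GB] .
qed

end

section \<open>Continuation from an interval to the disc\<close>

definition lagrange_basis :: "nat \<Rightarrow> (nat \<Rightarrow> complex) \<Rightarrow> nat \<Rightarrow> complex poly" where
  "lagrange_basis d v i = (\<Prod>l\<in>{..d} - {i}. smult (1 / (v i - v l)) [:- v l, 1:])"

definition lagrange :: "nat \<Rightarrow> (nat \<Rightarrow> complex) \<Rightarrow> (nat \<Rightarrow> complex) \<Rightarrow> complex poly" where
  "lagrange d v y = (\<Sum>i\<le>d. smult (y i) (lagrange_basis d v i))"

lemma degree_lagrange: "degree (lagrange d v y) \<le> d"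
  unfolding lagrange_def
proof (rule degree_sum_le)
  fix i assume i: "i \<in> {..d}"
  have "degree (lagrange_basis d v i) \<le> sum (degree \<circ> (\<lambda>l. smult (1 / (v i - v l)) [:- v l, 1:])) ({..d} - {i})"
    unfolding lagrange_basis_def by (rule degree_prod_sum_le) simp
  also have "\<dots> \<le> sum (\<lambda>_. 1) ({..d} - {i})"
    by (rule sum_mono) (simp add: order_trans[OF degree_smult_le])
  also have "\<dots> = d" using i by simp
  finally show "degree (smult (y i) (lagrange_basis d v i)) \<le> d"
    by (rule order_trans[OF degree_smult_le])
qed simp

lemma poly_lagrange:
  assumes inj: "inj_on v {..d}" and j: "j \<le> d"
  shows "poly (lagrange d v y) (v j) = y j"
proof -
  have "poly (lagrange_basis d v i) (v j) = (if i = j then 1 else 0)" if i: "i \<le> d" for i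
  proof (cases "i = j")
    case True
    have "v j \<noteq> v l" if "l \<in> {..d} - {j}" for l using inj j that by (auto simp: inj_on_def)
    then have "poly (lagrange_basis d v i) (v j) = 1"
      unfolding lagrange_basis_def poly_prod True
    proof (intro prod.neutral ballI)
      fix l assume "l \<in> {..d} - {j}"
      then have ne: "v j - v l \<noteq> 0" using \<open>\<And>l. l \<in> {..d} - {j} \<Longrightarrow> v j \<noteq> v l\<close> by simp
      have eq: "poly [:- v l, 1:] (v j) = v j - v l" by simp
      show "poly (smult (1 / (v j - v l)) [:- v l, 1:]) (v j) = 1"
        unfolding poly_smult eq times_divide_eq_left mult_1_left by (rule divide_self[OF ne])
    qed
    then show ?thesis using True by simp
  next
    case False
    then have "j \<in> {..d} - {i}" using j by simp
    then have "poly (lagrange_basis d v i) (v j) = 0"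
      unfolding lagrange_basis_def poly_prod by (intro prod_zero bexI[of _ j]) auto
    then show ?thesis using False by simp
  qed
  then have "poly (lagrange d v y) (v j) = (\<Sum>i\<le>d. y i * (if i = j then 1 else 0))"
    unfolding lagrange_def poly_sum by (intro sum.cong) auto
  also have "\<dots> = y j" using j by (simp add: if_distrib cong: if_cong)
  finally show ?thesis .
qed

lemma poly_eq_if_agree_at_nodes:
  fixes P Q :: "complex poly"
  assumes "inj_on v {..d}" "degree P \<le> d" "degree Q \<le> d" "\<And>i. i \<le> d \<Longrightarrow> poly P (v i) = poly Q (v i)"
  shows "P = Q"
  by (rule poly_eqI_degree[of "v ` {..d}"]) (use assms in \<open>auto simp: card_image\<close>)

text \<open>The coefficients are rational functions of the nodes and values, with denominators \<open>v i - v l\<close>.\<close>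

lemma lagrange_coeff_holomorphic:
  assumes v: "\<And>i. i \<le> d \<Longrightarrow> v i holomorphic_on S" and y: "\<And>i. i \<le> d \<Longrightarrow> y i holomorphic_on S"
    and inj: "\<And>z. z \<in> S \<Longrightarrow> inj_on (\<lambda>i. v i z) {..d}"
  shows "(\<lambda>z. coeff (lagrange d (\<lambda>i. v i z) (\<lambda>i. y i z)) j) holomorphic_on S"
proof -
  have lin: "(\<lambda>z. coeff (\<Prod>l\<in>A. smult (c l z) [:- v l z, 1:]) j) holomorphic_on S"
    if "finite A" "A \<subseteq> {..d}" "\<And>l. l \<in> A \<Longrightarrow> c l holomorphic_on S" for A c j
    using that
  proof (induction A arbitrary: j rule: finite_induct)
    case empty
    then show ?case by simp
  next
    case (insert a A)
    have "coeff (\<Prod>l\<in>insert a A. smult (c l z) [:- v l z, 1:]) j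
       = c a z * (- v a z * coeff (\<Prod>l\<in>A. smult (c l z) [:- v l z, 1:]) j
          + (if j = 0 then 0 else coeff (\<Prod>l\<in>A. smult (c l z) [:- v l z, 1:]) (j - 1)))" for z
      using insert.hyps by (cases j) (simp_all add: algebra_simps)
    moreover have "(\<lambda>z. c a z * (- v a z * coeff (\<Prod>l\<in>A. smult (c l z) [:- v l z, 1:]) j
          + (if j = 0 then 0 else coeff (\<Prod>l\<in>A. smult (c l z) [:- v l z, 1:]) (j - 1)))) holomorphic_on S"
      using insert by (cases "j = 0") (auto intro!: holomorphic_intros v)
    ultimately show ?case by simp
  qed
  have "(\<lambda>z. coeff (lagrange_basis d (\<lambda>i. v i z) i) j) holomorphic_on S" if i: "i \<le> d" for i
    unfolding lagrange_basis_def
  proof (rule lin)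
    fix l assume l: "l \<in> {..d} - {i}"
    have "v i z - v l z \<noteq> 0" if "z \<in> S" for z using inj[OF that] l i by (auto simp: inj_on_def)
    then show "(\<lambda>z. 1 / (v i z - v l z)) holomorphic_on S" using l i by (auto intro!: holomorphic_intros v)
  qed auto
  then show ?thesis unfolding lagrange_def by (simp add: coeff_sum) (auto intro!: holomorphic_intros y)
qed

lemma islimpt_of_real_image:
  fixes c :: real
  assumes "open I" "c \<in> I" "open D" "complex_of_real c \<in> D"
  shows "complex_of_real c islimpt (complex_of_real ` I \<inter> D)"
proof -
  have "(\<lambda>n. c + 1 / real (Suc n)) \<longlonglongrightarrow> c + 0" by (intro tendsto_intros LIMSEQ_Suc[OF lim_1_over_n])
  then have l: "(\<lambda>n. c + 1 / real (Suc n)) \<longlonglongrightarrow> c" by simp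
  then have l2: "(\<lambda>n. complex_of_real (c + 1 / real (Suc n))) \<longlonglongrightarrow> of_real c" by (rule tendsto_of_real)
  have "\<forall>\<^sub>F n in sequentially. c + 1 / real (Suc n) \<in> I" using topological_tendstoD[OF l assms(1,2)] .
  moreover have "\<forall>\<^sub>F n in sequentially. complex_of_real (c + 1 / real (Suc n)) \<in> D"
    using topological_tendstoD[OF l2 assms(3,4)] .
  ultimately have "\<forall>\<^sub>F n in sequentially. complex_of_real (c + 1 / real (Suc n)) \<in> complex_of_real ` I \<inter> D - {of_real c}"
  proof eventually_elim
    case (elim n)
    have "c + 1 / real (Suc n) \<noteq> c" by simp
    then have "complex_of_real (c + 1 / real (Suc n)) \<noteq> of_real c" by (simp only: of_real_eq_iff not_False_eq_True)
    then show ?case using elim by blast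
  qed
  then obtain M where M: "\<And>n. n \<ge> M \<Longrightarrow> complex_of_real (c + 1 / real (Suc n)) \<in> complex_of_real ` I \<inter> D - {of_real c}"
    unfolding eventually_sequentially by blast
  show ?thesis unfolding islimpt_sequential
  proof (intro exI conjI allI)
    show "complex_of_real (c + 1 / real (Suc (n + M))) \<in> complex_of_real ` I \<inter> D - {of_real c}" for n
      by (rule M) simp
    show "(\<lambda>n. complex_of_real (c + 1 / real (Suc (n + M)))) \<longlonglongrightarrow> of_real c"
      by (rule LIMSEQ_ignore_initial_segment[OF l2])
  qed
qed

context pencil
begin

text \<open>The points at which the ray is not defined.\<close>

definition exceptional :: "complex set" where
  "exceptional = {z. (z - of_real \<alpha>) * (1 - of_real \<alpha> * z) = 0}"

text \<open>Slopes are described by \<open>\<sigma> = 1/t\<^sup>2\<close>, in which the ray is affine: equally spaced values \<open>s, s + 1, \<dots>\<close> give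
  equally spaced nodes on the ray. The slice discs increase with \<open>\<sigma>\<close>, so that all these nodes are
  available over the slice disc of the first one.\<close>

definition node_slope :: "real \<Rightarrow> real" where
  "node_slope \<sigma> = 1 / sqrt \<sigma>"

definition nodes_domain :: "real \<Rightarrow> complex set" where
  "nodes_domain s = slice_disc \<alpha> (node_slope s) - exceptional"

definition interpolant :: "real \<Rightarrow> complex \<Rightarrow> complex poly" where
  "interpolant s z = lagrange (nat k) (\<lambda>i. ray \<alpha> z (node_slope (s + i))) (\<lambda>i. G z (node_slope (s + i)))"

lemma exceptional_finite: "finite exceptional"
proof -
  have "exceptional \<subseteq> {of_real \<alpha>, 1 / of_real \<alpha>}"
  proof
    fix z assume "z \<in> exceptional"
    then have "z = of_real \<alpha> \<or> of_real \<alpha> * z = 1" by (auto simp: exceptional_def)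
    moreover have "z = 1 / of_real \<alpha>" if "of_real \<alpha> * z = 1"
    proof -
      have "complex_of_real \<alpha> \<noteq> 0" using that by auto
      then show ?thesis using that by (metis nonzero_mult_div_cancel_left)
    qed
    ultimately show "z \<in> {of_real \<alpha>, 1 / of_real \<alpha>}" by blast
  qed
  then show ?thesis by (rule finite_subset) simp
qed

lemma node_slope: "\<sigma> > 0 \<Longrightarrow> node_slope \<sigma> > 0" "\<sigma> > 0 \<Longrightarrow> (node_slope \<sigma>)\<^sup>2 = 1 / \<sigma>"
  by (simp_all add: node_slope_def power_divide)

lemma ray_node: "\<sigma> > 0 \<Longrightarrow> ray \<alpha> z (node_slope \<sigma>) = ray_base \<alpha> z + of_real \<sigma> * ray_dir \<alpha> z"
  by (simp add: ray_def node_slope)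

lemma node_disc_mono:
  assumes "0 < s" "s \<le> \<sigma>"
  shows "slice_disc \<alpha> (node_slope s) \<subseteq> slice_disc \<alpha> (node_slope \<sigma>)"
proof
  fix z assume z: "z \<in> slice_disc \<alpha> (node_slope s)"
  have "1 / \<sigma> * (cmod (z - of_real \<alpha>))\<^sup>2 \<le> 1 / s * (cmod (z - of_real \<alpha>))\<^sup>2"
    using assms by (intro mult_right_mono divide_left_mono) auto
  then show "z \<in> slice_disc \<alpha> (node_slope \<sigma>)"
    using z assms by (simp add: slice_disc_def node_slope)
qed

lemma nodes_domain_mono: "0 < s \<Longrightarrow> s \<le> \<sigma> \<Longrightarrow> nodes_domain s \<subseteq> nodes_domain \<sigma>"
  using node_disc_mono by (auto simp: nodes_domain_def)

lemma nodes_domain_facts: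
  assumes "z \<in> nodes_domain s"
  shows "cmod z < 1" "z \<noteq> of_real \<alpha>" "of_real \<alpha> * z \<noteq> 1" "ray_dir \<alpha> z \<noteq> 0"
  using assms slice_disc_cmod by (auto simp: nodes_domain_def exceptional_def ray_dir_def)

lemma nodes_domain_open: "open (nodes_domain s)"
proof -
  obtain c r where "slice_disc \<alpha> (node_slope s) = ball c r" by (rule slice_disc_ball)
  then show ?thesis unfolding nodes_domain_def
    by (auto intro!: open_Diff finite_imp_closed exceptional_finite)
qed

lemma nodes_domain_connected: "connected (nodes_domain s)"
proof -
  obtain c r where b: "slice_disc \<alpha> (node_slope s) = ball c r" by (rule slice_disc_ball)
  show ?thesis unfolding nodes_domain_def b
    by (rule connected_open_diff_countable)
       (auto simp: countable_finite exceptional_finite convex_connected)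
qed

lemma nodes_distinct:
  assumes "s > 0" "ray_dir \<alpha> z \<noteq> 0"
  shows "inj_on (\<lambda>i::nat. ray \<alpha> z (node_slope (s + i))) {..d}"
proof (rule inj_onI)
  fix i j :: nat assume "ray \<alpha> z (node_slope (s + i)) = ray \<alpha> z (node_slope (s + j))"
  then have "complex_of_real (s + i) * ray_dir \<alpha> z = of_real (s + j) * ray_dir \<alpha> z"
    using assms(1) by (simp only: ray_node add_pos_nonneg of_nat_0_le_iff add_left_cancel)
  then show "i = j" using assms(2) by (simp only: mult_cancel_right of_real_eq_iff) simp
qed

lemma G_holomorphic:
  assumes "t > 0"
  shows "(\<lambda>z. G z t) holomorphic_on slice_disc \<alpha> t - exceptional"
proof (cases "slice_disc \<alpha> t = {}")
  case True
  then show ?thesis by (simp add: holomorphic_on_def)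
next
  case False
  then have adm: "t\<^sup>2 * (\<alpha>\<^sup>2 - 1) < 1" using slice_disc_admissible by blast
  have "h t holomorphic_on slice_disc \<alpha> t - exceptional"
    using h_hol[OF assms adm] by (rule holomorphic_on_subset) auto
  then show ?thesis unfolding G_def
    by (intro holomorphic_intros) (use assms in \<open>auto simp: exceptional_def\<close>)
qed

lemma interpolant_coeff_holomorphic:
  assumes s: "s > 0"
  shows "(\<lambda>z. coeff (interpolant s z) j) holomorphic_on nodes_domain s"
  unfolding interpolant_def
proof (rule lagrange_coeff_holomorphic)
  fix i :: nat
  have si: "s + i > 0" "s \<le> s + i" using s by auto
  have "ray_base \<alpha> holomorphic_on nodes_domain s" "ray_dir \<alpha> holomorphic_on nodes_domain s"
    unfolding ray_base_def ray_dir_def by (intro holomorphic_intros; use nodes_domain_facts in fastforce)+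
  then show "(\<lambda>z. ray \<alpha> z (node_slope (s + i))) holomorphic_on nodes_domain s"
    unfolding ray_node[OF si(1)] by (intro holomorphic_intros)
  show "(\<lambda>z. G z (node_slope (s + i))) holomorphic_on nodes_domain s"
    by (rule holomorphic_on_subset[OF G_holomorphic[OF node_slope(1)[OF si(1)]]])
       (use node_disc_mono[OF s si(2)] in \<open>auto simp: nodes_domain_def\<close>)
next
  show "inj_on (\<lambda>i. ray \<alpha> z (node_slope (s + i))) {..nat k}" if "z \<in> nodes_domain s" for z
    using nodes_distinct[OF s] nodes_domain_facts(4)[OF that] by blast
qed

lemma node_slope_less:
  assumes "z \<in> nodes_domain s" "0 < s" "s \<le> \<sigma>"
  shows "0 < node_slope \<sigma>" "node_slope \<sigma> < max_slope \<alpha> z"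
proof -
  show p: "0 < node_slope \<sigma>" using assms by (intro node_slope) auto
  have "z \<in> slice_disc \<alpha> (node_slope \<sigma>)" using assms node_disc_mono by (auto simp: nodes_domain_def)
  then show "node_slope \<sigma> < max_slope \<alpha> z"
    using max_slope_less_iff[of z \<alpha> "node_slope \<sigma>"] p nodes_domain_facts[OF assms(1)] by simp
qed

lemma interpolant_eq_poly:
  assumes z: "z \<in> nodes_domain s" and s: "s > 0" and P: "degree P \<le> nat k"
    "\<And>t. 0 < t \<Longrightarrow> t < max_slope \<alpha> z \<Longrightarrow> G z t = poly P (ray \<alpha> z t)"
  shows "interpolant s z = P"
proof (rule poly_eq_if_agree_at_nodes[OF nodes_distinct[OF s nodes_domain_facts(4)[OF z]]])
  show "degree (interpolant s z) \<le> nat k" unfolding interpolant_def by (rule degree_lagrange)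
  show "degree P \<le> nat k" by (rule P)
  fix i assume i: "i \<le> nat k"
  have "poly (interpolant s z) (ray \<alpha> z (node_slope (s + i))) = G z (node_slope (s + i))"
    unfolding interpolant_def
    using poly_lagrange[OF nodes_distinct[OF s nodes_domain_facts(4)[OF z]] i, of "\<lambda>i. G z (node_slope (s + i))"] by simp
  also have "\<dots> = poly P (ray \<alpha> z (node_slope (s + i)))"
    by (intro P node_slope_less[OF z s]) auto
  finally show "poly (interpolant s z) (ray \<alpha> z (node_slope (s + i))) = poly P (ray \<alpha> z (node_slope (s + i)))" .
qed

text \<open>The value of \<open>1/t\<^sup>2\<close> at the vertex; the nodes over \<open>z\<close> are those beyond it.\<close>

definition critical_node :: "complex \<Rightarrow> real" where
  "critical_node z = 1 / (max_slope \<alpha> z)\<^sup>2"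

lemma in_nodes_domain:
  assumes z: "cmod z < 1" "z \<notin> exceptional" and s: "s > critical_node z"
  shows "z \<in> nodes_domain s" "s > 0"
proof -
  have za: "z \<noteq> of_real \<alpha>" using z by (auto simp: exceptional_def)
  have T: "max_slope \<alpha> z > 0" by (rule max_slope_pos[OF z(1) za])
  have "critical_node z > 0" using T by (simp add: critical_node_def)
  then show s0: "s > 0" using s by simp
  have "(node_slope s)\<^sup>2 < (max_slope \<alpha> z)\<^sup>2"
    using s s0 T by (simp add: node_slope critical_node_def field_simps)
  then have "node_slope s < max_slope \<alpha> z" by (rule power2_less_imp_less) (use T in simp)
  then show "z \<in> nodes_domain s"
    using max_slope_less_iff[OF z(1) za, of "node_slope s"] node_slope(1)[OF s0] z by (simp add: nodes_domain_def)
qed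

text \<open>
  \<open>I\<close> is a set of real points over which \<open>G\<close> is known to be polynomial along the ray. It has to reach into every slice
  disc, because the slice discs shrink to the critical nodes and the identity theorem is applied in each of them; the
  centre is a convenient point.
\<close>

context
  fixes I :: "real set"
  assumes I_open: "open I"
    and I_slices: "\<And>t. slice_disc \<alpha> t \<noteq> {} \<Longrightarrow> slice_centre \<alpha> t \<in> I"
    and I_exc: "\<And>x. x \<in> I \<Longrightarrow> complex_of_real x \<notin> exceptional"
    and I_poly: "\<And>x. x \<in> I \<Longrightarrow> \<exists>P. degree P \<le> nat k \<and>
       (\<forall>t. 0 < t \<and> t < max_slope \<alpha> (of_real x) \<longrightarrow> G (of_real x) t = poly P (ray \<alpha> (of_real x) t))"
begin

text \<open>Over the real points of the common domain both interpolate the same polynomial; the identity theorem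
  extends the equality of their coefficients to the whole domain.\<close>

lemma interpolants_agree:
  assumes s: "0 < s" "s \<le> s'" and z: "z \<in> nodes_domain s"
  shows "interpolant s z = interpolant s' z"
proof (rule poly_eqI)
  fix j
  let ?D = "nodes_domain s" and ?t = "node_slope s"
  have ne: "slice_disc \<alpha> ?t \<noteq> {}" using z by (auto simp: nodes_domain_def)
  then have adm: "?t\<^sup>2 * (\<alpha>\<^sup>2 - 1) < 1" using slice_disc_admissible by blast
  define c where "c = slice_centre \<alpha> ?t"
  have cI: "c \<in> I" unfolding c_def by (rule I_slices[OF ne])
  have cD: "of_real c \<in> ?D"
    using slice_sets_eq(1)[OF adm] slice_radius_pos[OF adm] I_exc[OF cI] by (simp add: nodes_domain_def c_def)
  let ?U = "complex_of_real ` I \<inter> ?D"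
  have lim: "of_real c islimpt ?U" by (rule islimpt_of_real_image[OF I_open cI nodes_domain_open cD])
  have "coeff (interpolant s z) j - coeff (interpolant s' z) j = 0"
  proof (rule analytic_continuation[where f = "\<lambda>z. coeff (interpolant s z) j - coeff (interpolant s' z) j" and S = ?D and U = ?U])
    show "(\<lambda>z. coeff (interpolant s z) j - coeff (interpolant s' z) j) holomorphic_on ?D"
      by (intro holomorphic_intros interpolant_coeff_holomorphic s holomorphic_on_subset[OF interpolant_coeff_holomorphic])
         (use s nodes_domain_mono in auto)
    fix w assume w: "w \<in> ?U"
    then obtain x where x: "x \<in> I" "w = of_real x" by auto
    obtain P where P: "degree P \<le> nat k"
      "\<And>t. 0 < t \<Longrightarrow> t < max_slope \<alpha> w \<Longrightarrow> G w t = poly P (ray \<alpha> w t)"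
      using I_poly[OF x(1)] x(2) by blast
    have "interpolant s w = P"
      by (rule interpolant_eq_poly[OF _ s(1) P]) (use w in auto)
    moreover have "interpolant s' w = P"
      by (rule interpolant_eq_poly[OF _ _ P]) (use w s nodes_domain_mono[OF s] in auto)
    ultimately show "coeff (interpolant s w) j - coeff (interpolant s' w) j = 0" by simp
  qed (use nodes_domain_open nodes_domain_connected cD lim z in auto)
  then show "coeff (interpolant s z) j = coeff (interpolant s' z) j" by simp
qed

text \<open>As the interpolant does not depend on the position of its nodes, it agrees with \<open>G\<close> at every point of the open ray,
  and by continuity at the vertex, where \<open>G = F\<close>.\<close>

lemma polynomial_continuation:
  obtains Q where "\<And>j. (\<lambda>z. coeff (Q z) j) holomorphic_on ball 0 1 - exceptional"
    "\<And>z. cmod z < 1 \<Longrightarrow> z \<notin> exceptional \<Longrightarrow> degree (Q z) \<le> nat k"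
    "\<And>z. cmod z < 1 \<Longrightarrow> z \<notin> exceptional \<Longrightarrow> F z = poly (Q z) (vertex z)"
    "\<And>x P. x \<in> I \<Longrightarrow> \<bar>x\<bar> < 1 \<Longrightarrow> degree P \<le> nat k \<Longrightarrow>
       (\<And>t. 0 < t \<Longrightarrow> t < max_slope \<alpha> (of_real x) \<Longrightarrow> G (of_real x) t = poly P (ray \<alpha> (of_real x) t)) \<Longrightarrow> Q (of_real x) = P"
proof -
  define Q where "Q z = interpolant (critical_node z + 1) z" for z
  have Qs: "Q z = interpolant s z" if "cmod z < 1" "z \<notin> exceptional" "s > critical_node z" for z s
  proof (cases "s \<le> critical_node z + 1")
    case True
    then show ?thesis unfolding Q_def using in_nodes_domain[OF that] interpolants_agree[of s "critical_node z + 1" z] by simp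
  next
    case False
    then show ?thesis unfolding Q_def
      using in_nodes_domain[OF that(1,2), of "critical_node z + 1"] interpolants_agree[of "critical_node z + 1" s z] by simp
  qed
  have critical_node_less: "critical_node w < s" if "w \<in> nodes_domain s" "s > 0" for w s
  proof -
    note l = node_slope_less[OF that order_refl]
    have "(node_slope s)\<^sup>2 < (max_slope \<alpha> w)\<^sup>2" using l by (intro power_strict_mono) auto
    then have "1 / s < (max_slope \<alpha> w)\<^sup>2" using that(2) by (simp add: node_slope)
    moreover have "(max_slope \<alpha> w)\<^sup>2 > 0" using l by simp
    ultimately show ?thesis using that(2) by (simp add: critical_node_def divide_less_eq mult.commute)
  qed
  show ?thesis
  proof (rule that[of Q])
    fix j
    have "(\<lambda>z. coeff (Q z) j) field_differentiable at z" if z: "z \<in> ball 0 1 - exceptional" for z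
    proof -
      let ?s = "critical_node z + 1"
      have zd: "z \<in> nodes_domain ?s" "?s > 0" using z by (auto intro: in_nodes_domain)
      have "(\<lambda>z. coeff (interpolant ?s z) j) holomorphic_on nodes_domain ?s"
        by (rule interpolant_coeff_holomorphic[OF zd(2)])
      then have "(\<lambda>z. coeff (Q z) j) holomorphic_on nodes_domain ?s"
      proof (rule holomorphic_transform)
        fix w assume w: "w \<in> nodes_domain ?s"
        then have "w \<notin> exceptional" by (simp add: nodes_domain_def)
        then show "coeff (interpolant ?s w) j = coeff (Q w) j"
          using Qs[OF nodes_domain_facts(1)[OF w] _ critical_node_less[OF w zd(2)]] by simp
      qed
      then show ?thesis using zd(1) nodes_domain_open holomorphic_on_imp_differentiable_at by blast
    qed
    then show "(\<lambda>z. coeff (Q z) j) holomorphic_on ball 0 1 - exceptional"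
      by (auto simp: holomorphic_on_def intro: field_differentiable_at_within)
  next
    fix z assume z: "cmod z < 1" "z \<notin> exceptional"
    show "degree (Q z) \<le> nat k" unfolding Q_def interpolant_def by (rule degree_lagrange)
    have zz: "z \<noteq> of_real \<alpha>" "of_real \<alpha> * z \<noteq> 1" using z by (auto simp: exceptional_def)
    let ?T = "max_slope \<alpha> z"
    have T: "?T > 0" by (rule max_slope_pos[OF z(1) zz(1)])
    \<comment> \<open>place the first node at the given slope\<close>
    have eq: "G z t = poly (Q z) (ray \<alpha> z t)" if t: "0 < t" "t < ?T" for t
    proof -
      define s where "s = 1 / t\<^sup>2"
      have s: "s > 0" using t by (simp add: s_def)
      have ts: "t = node_slope s" using t by (simp add: s_def node_slope_def real_sqrt_divide)
      have "t\<^sup>2 < ?T\<^sup>2" using t by (intro power_strict_mono) auto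
      then have so: "s > critical_node z" using t T by (simp add: s_def critical_node_def field_simps)
      note zd = in_nodes_domain[OF z so]
      have "poly (interpolant s z) (ray \<alpha> z (node_slope (s + real 0))) = G z (node_slope (s + real 0))"
        unfolding interpolant_def
        by (rule poly_lagrange[OF nodes_distinct[OF zd(2) nodes_domain_facts(4)[OF zd(1)]], of 0]) simp
      then show ?thesis using Qs[OF z so] ts by simp
    qed
    have hc: "continuous_on {0<..?T} (\<lambda>t. G z t)"
    proof -
      have "continuous_on {0<..?T} (\<lambda>t. (\<lambda>(t,z). h t z) (t, z))"
        by (rule continuous_on_compose2[OF h_jointly_continuous])
           (use z zz slope_admissible max_slope_le_iff[OF z(1) zz(1)] in \<open>auto intro!: continuous_intros\<close>)
      then show ?thesis unfolding G_def by (auto intro!: continuous_intros simp: zz)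
    qed
    have rc: "continuous_on {0<..?T} (\<lambda>t. poly (Q z) (ray \<alpha> z t))"
      unfolding ray_def by (intro continuous_intros) auto
    have "G z ?T - poly (Q z) (ray \<alpha> z ?T) = 0"
    proof -
      have c: "continuous_on {0<..?T} (\<lambda>t. G z t - poly (Q z) (ray \<alpha> z t))" by (intro continuous_intros hc rc)
      have "((\<lambda>t. G z t - poly (Q z) (ray \<alpha> z t)) \<longlongrightarrow> G z ?T - poly (Q z) (ray \<alpha> z ?T)) (at ?T within {0<..?T})"
        using c T by (auto simp: continuous_on_def)
      then have "((\<lambda>t. G z t - poly (Q z) (ray \<alpha> z t)) \<longlongrightarrow> G z ?T - poly (Q z) (ray \<alpha> z ?T)) (at ?T within {0<..<?T})"
        by (rule tendsto_within_subset) auto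
      then have "((\<lambda>t. 0) \<longlongrightarrow> G z ?T - poly (Q z) (ray \<alpha> z ?T)) (at ?T within {0<..<?T})"
        by (rule Lim_transform_eventually) (use eq in \<open>auto simp: eventually_at_filter\<close>)
      moreover have "at ?T within {0<..<?T} \<noteq> bot"
        using T by (simp add: trivial_limit_within islimpt_greaterThanLessThan2)
      ultimately show ?thesis using tendsto_unique tendsto_const by metis
    qed
    then show "F z = poly (Q z) (vertex z)"
      using boundary_value[OF z(1) zz] ray_max_slope[OF z(1) zz] by simp
  next
    fix x P assume x: "x \<in> I" "\<bar>x\<bar> < 1" and P: "degree P \<le> nat k"
      "\<And>t. 0 < t \<Longrightarrow> t < max_slope \<alpha> (of_real x) \<Longrightarrow> G (of_real x) t = poly P (ray \<alpha> (of_real x) t)"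
    show "Q (of_real x) = P" unfolding Q_def
      by (rule interpolant_eq_poly[OF _ _ P]) (use x I_exc in \<open>auto intro!: in_nodes_domain\<close>)
  qed
qed

end

end

context two_pencils
begin

text \<open>Each pencil yields such an expansion away from its own two exceptional points. The expansions agree because over the
  interval \<open>I\<close> both come from \<open>polynomial_on_real_line\<close>, and the exceptional points of \<open>\<alpha> < 0\<close> are different from those of
  \<open>\<beta> > 0\<close>, so that each expansion fills the gaps of the other.\<close>

lemma polyanalytic_structure:
  assumes ab: "\<alpha> < 0" "0 < \<beta>"
  obtains b where "\<And>j. b j holomorphic_on ball 0 1"
    "\<And>z. cmod z < 1 \<Longrightarrow> A.F z = (\<Sum>j\<le>nat k. b j z * vertex z ^ j)"
    "\<And>z. k < 0 \<Longrightarrow> cmod z < 1 \<Longrightarrow> A.F z = 0"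
proof -
  define I where "I = {x. \<bar>x\<bar> < 1 \<and> (x - \<alpha>) * (1 - \<alpha> * x) > 0 \<and> (x - \<beta>) * (1 - \<beta> * x) < 0}"
  have Iopen: "open I" unfolding I_def
    by (intro open_Collect_conj open_Collect_less continuous_intros)
  have I0: "0 \<in> I" using ab by (simp add: I_def)
  have IexA: "complex_of_real x \<notin> A.exceptional" and IexB: "complex_of_real x \<notin> B.exceptional" if "x \<in> I" for x
  proof -
    have nz: "(x - \<alpha>) * (1 - \<alpha> * x) \<noteq> 0" "(x - \<beta>) * (1 - \<beta> * x) \<noteq> 0" using that by (auto simp: I_def)
    have r: "(complex_of_real x - of_real \<gamma>) * (1 - of_real \<gamma> * of_real x) = of_real ((x - \<gamma>) * (1 - \<gamma> * x))" for \<gamma>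
      by simp
    show "complex_of_real x \<notin> A.exceptional" "complex_of_real x \<notin> B.exceptional"
      unfolding A.exceptional_def B.exceptional_def mem_Collect_eq r of_real_eq_0_iff by (rule nz)+
  qed
  \<comment> \<open>the centre of a slice disc lies between \<open>0\<close> and \<open>\<gamma>\<close>\<close>
  have centre: "slice_centre \<gamma> t \<in> {x. \<bar>x\<bar> < 1 \<and> (x - \<gamma>) * \<gamma> \<le> 0 \<and> x * \<gamma> \<ge> 0 \<and> (\<gamma> \<noteq> 0 \<longrightarrow> (x - \<gamma>) * (1 - \<gamma> * x) * \<gamma> < 0)}"
    if "slice_disc \<gamma> t \<noteq> {}" for \<gamma> t
  proof -
    have adm: "t\<^sup>2 * (\<gamma>\<^sup>2 - 1) < 1" using that slice_disc_admissible by blast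
    have p: "1 + t\<^sup>2 > 0" by (simp add: add_pos_nonneg)
    let ?c = "slice_centre \<gamma> t"
    have "complex_of_real ?c \<in> slice_disc \<gamma> t"
      using slice_sets_eq(1)[OF adm] slice_radius_pos[OF adm] by simp
    then have 1: "\<bar>?c\<bar> < 1" using slice_disc_cmod by fastforce
    have 2: "?c - \<gamma> = - \<gamma> / (1 + t\<^sup>2)" using p by (simp add: slice_centre_def field_simps)
    have 3: "1 - \<gamma> * ?c = (1 - t\<^sup>2 * (\<gamma>\<^sup>2 - 1)) / (1 + t\<^sup>2)"
      using p by (simp add: slice_centre_def field_simps power2_eq_square)
    then have 4: "1 - \<gamma> * ?c > 0" using p adm by simp
    have 5: "(?c - \<gamma>) * \<gamma> = - (\<gamma>\<^sup>2 / (1 + t\<^sup>2))" unfolding 2 by (simp add: power2_eq_square)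
    then have 6: "(?c - \<gamma>) * \<gamma> \<le> 0" using p by simp
    have 7: "?c * \<gamma> \<ge> 0" by (simp add: slice_centre_def mult.assoc flip: power2_eq_square)
    have 8: "(?c - \<gamma>) * (1 - \<gamma> * ?c) * \<gamma> < 0" if "\<gamma> \<noteq> 0"
    proof -
      have "(?c - \<gamma>) * \<gamma> < 0" unfolding 5 using p that by simp
      then have "((?c - \<gamma>) * \<gamma>) * (1 - \<gamma> * ?c) < 0" using 4 by (rule mult_neg_pos)
      then show ?thesis by (simp add: mult_ac)
    qed
    show ?thesis using 1 6 7 8 by simp
  qed
  have IcA: "slice_centre \<alpha> t \<in> I" if "slice_disc \<alpha> t \<noteq> {}" for t
  proof -
    let ?c = "slice_centre \<alpha> t"
    have c: "\<bar>?c\<bar> < 1" "?c * \<alpha> \<ge> 0" "(?c - \<alpha>) * (1 - \<alpha> * ?c) * \<alpha> < 0" using centre[OF that] ab by auto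
    have "?c \<le> 0" using c(2) ab by (simp add: zero_le_mult_iff)
    then have "(?c - \<beta>) < 0" "1 - \<beta> * ?c > 0" using ab mult_nonneg_nonpos[of \<beta> ?c] by auto
    then have "(?c - \<beta>) * (1 - \<beta> * ?c) < 0" by (rule mult_neg_pos)
    moreover have "(?c - \<alpha>) * (1 - \<alpha> * ?c) > 0" using c(3) ab by (simp add: mult_less_0_iff)
    ultimately show ?thesis using c by (simp add: I_def)
  qed
  have IcB: "slice_centre \<beta> t \<in> I" if "slice_disc \<beta> t \<noteq> {}" for t
  proof -
    let ?c = "slice_centre \<beta> t"
    have c: "\<bar>?c\<bar> < 1" "?c * \<beta> \<ge> 0" "(?c - \<beta>) * (1 - \<beta> * ?c) * \<beta> < 0" using centre[OF that] ab by auto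
    have "?c \<ge> 0" using c(2) ab by (simp add: zero_le_mult_iff)
    then have "(?c - \<alpha>) > 0" "1 - \<alpha> * ?c > 0" using ab mult_nonpos_nonneg[of \<alpha> ?c] by auto
    then have "(?c - \<alpha>) * (1 - \<alpha> * ?c) > 0" by (rule mult_pos_pos)
    moreover have "(?c - \<beta>) * (1 - \<beta> * ?c) < 0" using c(3) ab by (simp add: mult_less_0_iff)
    ultimately show ?thesis using c by (simp add: I_def)
  qed
  have poly: "\<exists>P. degree P \<le> nat k \<and> (k < 0 \<longrightarrow> P = 0) \<and>
      (\<forall>t. 0 < t \<and> t < max_slope \<alpha> (of_real x) \<longrightarrow> A.G (of_real x) t = poly P (ray \<alpha> (of_real x) t)) \<and>
      (\<forall>t. 0 < t \<and> t < max_slope \<beta> (of_real x) \<longrightarrow> B.G (of_real x) t = poly P (ray \<beta> (of_real x) t))"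
    if "x \<in> I" for x
    by (rule polynomial_on_real_line[of x]) (use that in \<open>auto simp: I_def intro: less_imp_le\<close>)
  obtain QA where QA: "\<And>j. (\<lambda>z. coeff (QA z) j) holomorphic_on ball 0 1 - A.exceptional"
    "\<And>z. cmod z < 1 \<Longrightarrow> z \<notin> A.exceptional \<Longrightarrow> degree (QA z) \<le> nat k"
    "\<And>z. cmod z < 1 \<Longrightarrow> z \<notin> A.exceptional \<Longrightarrow> A.F z = poly (QA z) (vertex z)"
    "\<And>x P. x \<in> I \<Longrightarrow> \<bar>x\<bar> < 1 \<Longrightarrow> degree P \<le> nat k \<Longrightarrow>
       (\<And>t. 0 < t \<Longrightarrow> t < max_slope \<alpha> (of_real x) \<Longrightarrow> A.G (of_real x) t = poly P (ray \<alpha> (of_real x) t)) \<Longrightarrow> QA (of_real x) = P"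
    by (rule A.polynomial_continuation[OF Iopen IcA IexA]) (use poly in blast)+
  obtain QB where QB: "\<And>j. (\<lambda>z. coeff (QB z) j) holomorphic_on ball 0 1 - B.exceptional"
    "\<And>z. cmod z < 1 \<Longrightarrow> z \<notin> B.exceptional \<Longrightarrow> degree (QB z) \<le> nat k"
    "\<And>z. cmod z < 1 \<Longrightarrow> z \<notin> B.exceptional \<Longrightarrow> A.F z = poly (QB z) (vertex z)"
    "\<And>x P. x \<in> I \<Longrightarrow> \<bar>x\<bar> < 1 \<Longrightarrow> degree P \<le> nat k \<Longrightarrow>
       (\<And>t. 0 < t \<Longrightarrow> t < max_slope \<beta> (of_real x) \<Longrightarrow> B.G (of_real x) t = poly P (ray \<beta> (of_real x) t)) \<Longrightarrow> QB (of_real x) = P"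
    by (rule B.polynomial_continuation[OF Iopen IcB IexB]) (use poly in blast)+
  have realQ: "QA (of_real x) = QB (of_real x)" "k < 0 \<Longrightarrow> QA (of_real x) = 0" if x: "x \<in> I" for x
  proof -
    obtain P where P: "degree P \<le> nat k" "k < 0 \<longrightarrow> P = 0"
      "\<And>t. 0 < t \<Longrightarrow> t < max_slope \<alpha> (of_real x) \<Longrightarrow> A.G (of_real x) t = poly P (ray \<alpha> (of_real x) t)"
      "\<And>t. 0 < t \<Longrightarrow> t < max_slope \<beta> (of_real x) \<Longrightarrow> B.G (of_real x) t = poly P (ray \<beta> (of_real x) t)"
      using poly[OF x] by blast
    have x1: "\<bar>x\<bar> < 1" using x by (simp add: I_def)
    have "QA (of_real x) = P" "QB (of_real x) = P" using QA(4)[OF x x1 P(1,3)] QB(4)[OF x x1 P(1,4)] by auto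
    then show "QA (of_real x) = QB (of_real x)" "k < 0 \<Longrightarrow> QA (of_real x) = 0" using P by auto
  qed
  let ?D = "ball 0 1 - (A.exceptional \<union> B.exceptional)"
  have finE: "finite (A.exceptional \<union> B.exceptional)" using A.exceptional_finite B.exceptional_finite by simp
  have Dopen: "open ?D" by (intro open_Diff open_ball finite_imp_closed finE)
  have Dconn: "connected ?D"
    by (rule connected_open_diff_countable) (use finE in \<open>auto simp: countable_finite convex_connected\<close>)
  have zeroD: "(0::complex) \<in> ?D" using IexA[OF I0] IexB[OF I0] by simp
  let ?U = "complex_of_real ` I \<inter> ?D"
  have lim: "0 islimpt ?U" using islimpt_of_real_image[OF Iopen I0 Dopen] zeroD by simp
  have agree: "coeff (QA z) j = coeff (QB z) j" if z: "z \<in> ?D" for z j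
  proof -
    have "coeff (QA z) j - coeff (QB z) j = 0"
      by (rule analytic_continuation[where f = "\<lambda>z. coeff (QA z) j - coeff (QB z) j" and S = ?D and U = ?U])
         (use Dopen Dconn zeroD lim z realQ in
          \<open>auto intro!: holomorphic_intros holomorphic_on_subset[OF QA(1)] holomorphic_on_subset[OF QB(1)]\<close>)
    then show ?thesis by simp
  qed
  have disj: "z \<notin> A.exceptional \<or> z \<notin> B.exceptional" if z: "cmod z < 1" for z
  proof (rule ccontr)
    assume "\<not> ?thesis"
    then have "(z = of_real \<alpha> \<or> of_real \<alpha> * z = 1)" "(z = of_real \<beta> \<or> of_real \<beta> * z = 1)"
      by (auto simp: A.exceptional_def B.exceptional_def)
    then have "Im z = 0" "(Re z = \<alpha> \<or> \<alpha> * Re z = 1)" "(Re z = \<beta> \<or> \<beta> * Re z = 1)"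
      using ab by (auto simp: complex_eq_iff)
    moreover have "\<alpha> * Re z \<le> 0" if "Re z \<ge> 0" using ab that by (simp add: mult_nonpos_nonneg)
    moreover have "\<beta> * Re z \<le> 0" if "Re z \<le> 0" using ab that by (simp add: mult_nonneg_nonpos)
    ultimately show False using ab by linarith
  qed
  \<comment> \<open>glue the two expansions at the exceptional points\<close>
  define b where "b j z = (if z \<in> A.exceptional then coeff (QB z) j else coeff (QA z) j)" for j z
  have bA: "b j z = coeff (QA z) j" if "z \<notin> A.exceptional" for j z using that by (simp add: b_def)
  have bB: "b j z = coeff (QB z) j" if "cmod z < 1" "z \<notin> B.exceptional" for j z
    using that agree[of z j] by (auto simp: b_def)
  have hol: "b j holomorphic_on ball 0 1" for j
  proof -
    have oA: "open (ball 0 1 - A.exceptional)" and oB: "open (ball 0 1 - B.exceptional)"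
      using A.exceptional_finite B.exceptional_finite by (auto intro!: open_Diff finite_imp_closed)
    have "b j holomorphic_on ball 0 1 - A.exceptional"
      by (rule holomorphic_transform[OF QA(1)]) (use bA in auto)
    moreover have "b j holomorphic_on ball 0 1 - B.exceptional"
      by (rule holomorphic_transform[OF QB(1)]) (use bB in auto)
    ultimately have "b j holomorphic_on (ball 0 1 - A.exceptional) \<union> (ball 0 1 - B.exceptional)"
      by (rule holomorphic_on_Un[OF _ _ oA oB])
    then show ?thesis by (rule holomorphic_on_subset) (use disj in auto)
  qed
  have poly_sum_le: "poly p v = (\<Sum>j\<le>d. coeff p j * v ^ j)" if "degree p \<le> d" for p :: "complex poly" and v d
    unfolding poly_altdef by (rule sum.mono_neutral_left) (use that in \<open>auto simp: coeff_eq_0\<close>)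
  show ?thesis
  proof (rule that[of b])
    show "b j holomorphic_on ball 0 1" for j by (rule hol)
    show F: "A.F z = (\<Sum>j\<le>nat k. b j z * vertex z ^ j)" if z: "cmod z < 1" for z
      using disj[OF z] QA(3)[OF z] QB(3)[OF z] poly_sum_le[OF QA(2)[OF z]] poly_sum_le[OF QB(2)[OF z]]
        bA[of z] bB[OF z] by auto
    show "A.F z = 0" if k: "k < 0" and z: "cmod z < 1" for z
    proof -
      have "b 0 z = 0"
      proof (rule analytic_continuation[where f = "b 0" and S = "ball 0 1" and U = ?U and \<xi> = 0])
        show "b 0 w = 0" if "w \<in> ?U" for w using that realQ(2)[OF _ k] bA[of w 0] by auto
      qed (use hol lim z in \<open>auto simp: convex_connected\<close>)
      then show ?thesis using F[OF z] k by simp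
    qed
  qed
qed

end

section \<open>Fourier components and lines through the axis\<close>

definition disc_extends :: "(complex \<Rightarrow> complex) \<Rightarrow> bool" where
  "disc_extends u \<longleftrightarrow> (\<exists>H. continuous_on (cball 0 1) H \<and> H holomorphic_on ball 0 1 \<and> (\<forall>\<zeta>\<in>sphere 0 1. H \<zeta> = u \<zeta>))"

lemma disc_extends_sum:
  assumes "finite A" "\<And>i. i \<in> A \<Longrightarrow> disc_extends (u i)"
  shows "disc_extends (\<lambda>\<zeta>. \<Sum>i\<in>A. u i \<zeta>)"
proof -
  obtain H where H: "\<And>i. i \<in> A \<Longrightarrow> continuous_on (cball 0 1) (H i)" "\<And>i. i \<in> A \<Longrightarrow> H i holomorphic_on ball 0 1"
     "\<And>i \<zeta>. i \<in> A \<Longrightarrow> \<zeta> \<in> sphere 0 1 \<Longrightarrow> H i \<zeta> = u i \<zeta>"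
    using assms(2) unfolding disc_extends_def by metis
  show ?thesis unfolding disc_extends_def
    by (rule exI[of _ "\<lambda>\<zeta>. \<Sum>i\<in>A. H i \<zeta>"]) (auto intro!: continuous_intros holomorphic_intros H sum.cong)
qed

lemma disc_extends_cmult:
  assumes "disc_extends u" shows "disc_extends (\<lambda>\<zeta>. c * u \<zeta>)"
proof -
  obtain H where H: "continuous_on (cball 0 1) H" "H holomorphic_on ball 0 1" "\<And>\<zeta>. \<zeta> \<in> sphere 0 1 \<Longrightarrow> H \<zeta> = u \<zeta>"
    using assms unfolding disc_extends_def by blast
  show ?thesis unfolding disc_extends_def
    by (rule exI[of _ "\<lambda>\<zeta>. c * H \<zeta>"]) (auto intro!: continuous_intros holomorphic_intros H)
qed

text \<open>By the maximum principle the extensions form a uniform Cauchy sequence on the closed disc.\<close>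

lemma disc_extends_uniform_limit:
  assumes "\<And>e. e > 0 \<Longrightarrow> \<exists>v. disc_extends v \<and> (\<forall>\<zeta>\<in>sphere 0 1. cmod (u \<zeta> - v \<zeta>) \<le> e)"
  shows "disc_extends u"
proof -
  have "\<exists>H. continuous_on (cball 0 1) H \<and> H holomorphic_on ball 0 1 \<and>
      (\<forall>\<zeta>\<in>sphere 0 1. cmod (u \<zeta> - H \<zeta>) \<le> 1 / real (Suc n))" for n
    using assms[of "1 / real (Suc n)"] unfolding disc_extends_def by force
  then obtain H where H: "\<And>n. continuous_on (cball 0 1) (H n)" "\<And>n. H n holomorphic_on ball 0 1"
     "\<And>n \<zeta>. \<zeta> \<in> sphere 0 1 \<Longrightarrow> cmod (u \<zeta> - H n \<zeta>) \<le> 1 / real (Suc n)" by metis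
  have diff: "cmod (H n \<zeta> - H k \<zeta>) \<le> 1 / real (Suc n) + 1 / real (Suc k)" if "\<zeta> \<in> cball 0 1" for n k \<zeta>
  proof (rule maximum_modulus_disc[of 0 1 "\<lambda>\<zeta>. H n \<zeta> - H k \<zeta>"])
    show "cmod (H n z - H k z) \<le> 1 / real (Suc n) + 1 / real (Suc k)" if "z \<in> sphere 0 1" for z
    proof -
      have "H n z - H k z = (u z - H k z) - (u z - H n z)" by simp
      then show ?thesis using norm_triangle_ineq4[of "u z - H k z" "u z - H n z"] H(3)[OF that, of n] H(3)[OF that, of k] by simp
    qed
  qed (use that in \<open>auto intro!: continuous_intros holomorphic_intros H\<close>)
  have "uniformly_Cauchy_on (cball 0 1) H"
    unfolding uniformly_Cauchy_on_def
  proof (intro allI impI)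
    fix e :: real assume e: "e > 0"
    obtain M where M: "1 / real (Suc M) < e / 2" using e nat_approx_posE[of "e/2"] by auto
    show "\<exists>M. \<forall>x\<in>cball 0 1. \<forall>m\<ge>M. \<forall>n\<ge>M. dist (H m x) (H n x) < e"
    proof (intro exI[of _ M] ballI allI impI)
      fix x m n assume x: "x \<in> cball (0::complex) 1" and mn: "m \<ge> M" "n \<ge> M"
      have "1 / real (Suc m) \<le> 1 / real (Suc M)" "1 / real (Suc n) \<le> 1 / real (Suc M)"
        using mn by (auto intro!: divide_left_mono)
      then show "dist (H m x) (H n x) < e" using diff[OF x, of m n] M by (simp add: dist_norm)
    qed
  qed
  then have "uniformly_convergent_on (cball 0 1) H" by (rule Cauchy_uniformly_convergent)
  then obtain L where L: "uniform_limit (cball 0 1) H L sequentially"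
    unfolding uniformly_convergent_on_def by blast
  have contL: "continuous_on (cball 0 1) L"
    by (rule uniform_limit_theorem[OF _ L]) (auto intro!: always_eventually H)
  have holL: "L holomorphic_on ball 0 1"
  proof (rule holomorphic_uniform_sequence[OF open_ball H(2)])
    fix x :: complex assume x: "x \<in> ball 0 1"
    obtain d where d: "d > 0" "cball x d \<subseteq> ball 0 1" using open_ball x unfolding open_contains_cball by blast
    then have "uniform_limit (cball x d) H L sequentially"
      by (intro uniform_limit_on_subset[OF L]) (auto simp: subset_iff less_imp_le)
    then show "\<exists>d>0. cball x d \<subseteq> ball 0 1 \<and> uniform_limit (cball x d) H L sequentially" using d by blast
  qed
  have "L \<zeta> = u \<zeta>" if z: "\<zeta> \<in> sphere 0 1" for \<zeta>
  proof (rule LIMSEQ_unique)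
    show "(\<lambda>n. H n \<zeta>) \<longlonglongrightarrow> L \<zeta>" by (rule tendsto_uniform_limitI[OF L]) (use z in auto)
    have "(\<lambda>n. cmod (H n \<zeta> - u \<zeta>)) \<longlonglongrightarrow> 0"
    proof (rule tendsto_sandwich[OF _ _ tendsto_const LIMSEQ_Suc[OF lim_1_over_n]])
      show "\<forall>\<^sub>F n in sequentially. cmod (H n \<zeta> - u \<zeta>) \<le> 1 / real (Suc n)"
        using H(3)[OF z] by (auto simp: norm_minus_commute)
    qed auto
    then have "(\<lambda>n. H n \<zeta> - u \<zeta>) \<longlonglongrightarrow> 0" by (rule tendsto_norm_zero_cancel)
    then show "(\<lambda>n. H n \<zeta>) \<longlonglongrightarrow> u \<zeta>" by (rule LIM_zero_cancel)
  qed
  then show ?thesis unfolding disc_extends_def using contL holL by blast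
qed

abbreviation sphere2 :: "(complex \<times> complex) set" where
  "sphere2 \<equiv> {(z,w). (cmod z)\<^sup>2 + (cmod w)\<^sup>2 = 1}"

definition component :: "(complex \<Rightarrow> complex \<Rightarrow> complex) \<Rightarrow> int \<Rightarrow> complex \<Rightarrow> complex \<Rightarrow> complex" where
  "component g k z w = fourier_coeff (\<lambda>\<theta>. g z (cis \<theta> * w)) k"

lemma fourier_coeff_continuous_param:
  fixes U :: "'a::metric_space \<Rightarrow> real \<Rightarrow> complex"
  assumes "continuous_on (S \<times> {-pi..pi}) (\<lambda>(s,\<theta>). U s \<theta>)"
  shows "continuous_on S (\<lambda>s. fourier_coeff (U s) k)"
proof -
  have "continuous_on (S \<times> cbox (-pi) pi) (\<lambda>(s,\<theta>). U s \<theta> * cis (- (of_int k * \<theta>)))"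
    using assms by (auto simp: split_beta intro!: continuous_intros)
  then have "continuous_on S (\<lambda>s. integral (cbox (-pi) pi) (\<lambda>\<theta>. U s \<theta> * cis (- (of_int k * \<theta>))))"
    by (rule integral_continuous_on_param)
  then show ?thesis unfolding fourier_coeff_def by (auto intro!: continuous_intros)
qed

lemma fourier_coeff_holomorphic_param:
  assumes "open S" "continuous_on (S \<times> {-pi..pi}) (\<lambda>(s,\<theta>). U s \<theta>)"
    and "\<And>\<theta>. \<theta> \<in> {-pi..pi} \<Longrightarrow> (\<lambda>s. U s \<theta>) holomorphic_on S"
  shows "(\<lambda>s. fourier_coeff (U s) k) holomorphic_on S"
proof -
  have "(\<lambda>s. integral {-pi..pi} (\<lambda>\<theta>. U s \<theta> * cis (- (of_int k * \<theta>)))) holomorphic_on S"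
    by (rule holomorphic_integral_param)
       (use assms in \<open>auto simp: split_beta intro!: continuous_intros holomorphic_intros\<close>)
  then show ?thesis unfolding fourier_coeff_def by (intro holomorphic_intros) auto
qed

lemma component_homogeneous_sphere_function:
  assumes g: "continuous_on sphere2 (\<lambda>(z,w). g z w)"
  shows "homogeneous_sphere_function (component g k) k"
proof
  have "continuous_on (sphere2 \<times> {-pi..pi}) (\<lambda>u. (\<lambda>(z,w). g z w) (fst (fst u), cis (snd u) * snd (fst u)))"
    by (rule continuous_on_compose2[OF g]) (auto simp: norm_mult intro!: continuous_intros)
  then have "continuous_on sphere2 (\<lambda>x. fourier_coeff (\<lambda>\<theta>. g (fst x) (cis \<theta> * snd x)) k)"
    by (intro fourier_coeff_continuous_param) (simp add: split_beta)
  then show "continuous_on sphere2 (\<lambda>(z, w). component g k z w)"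
    by (simp add: component_def split_beta)
next
  fix z w u :: complex
  assume zw: "(cmod z)\<^sup>2 + (cmod w)\<^sup>2 = 1" and u: "cmod u = 1"
  obtain c where c: "0 \<le> c" "c \<le> 2 * pi" "u = cis c"
  proof -
    have "u = cis (Arg2pi u)" using Arg2pi_eq[of u] u by (simp add: cis_conv_exp)
    then show ?thesis using that[of "Arg2pi u"] Arg2pi_ge_0 less_imp_le[OF Arg2pi_lt_2pi] by auto
  qed
  have cont: "continuous_on UNIV (\<lambda>\<theta>. g z (cis \<theta> * w))"
  proof -
    have "continuous_on UNIV (\<lambda>\<theta>. (\<lambda>(z,w). g z w) (z, cis \<theta> * w))"
      by (rule continuous_on_compose2[OF g]) (use zw in \<open>auto simp: norm_mult intro!: continuous_intros\<close>)
    then show ?thesis by simp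
  qed
  have per: "cis (\<theta> + 2 * pi) = cis \<theta>" for \<theta> by (simp add: complex_eq_iff)
  have "fourier_coeff (\<lambda>\<theta>. g z (cis (\<theta> + c) * w)) k = cis (of_int k * c) * fourier_coeff (\<lambda>\<theta>. g z (cis \<theta> * w)) k"
    by (rule fourier_coeff_shift[OF cont _ c(1,2)]) (simp add: per)
  moreover have "cis (\<theta> + c) * w = cis \<theta> * (u * w)" for \<theta>
    by (simp add: c(3) cis_mult[symmetric] mult.assoc)
  ultimately show "component g k z (u * w) = u powi k * component g k z w"
    by (simp add: component_def c(3) cis_power_int)
qed

text \<open>A rotation of \<open>w\<close> maps the line \<open>w = t (z - \<alpha>)\<close> to another line through \<open>(\<alpha>,0)\<close> with the same slice disc. Averaging the
  extensions along these lines gives an extension of the component; the maximum principle provides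
  the joint continuity that the averaging needs.\<close>

lemma component_pencil:
  assumes g: "continuous_on sphere2 (\<lambda>(z,w). g z w)"
    and H: "\<And>t. t \<noteq> 0 \<Longrightarrow> continuous_on (slice_cdisc \<alpha> (cmod t)) (H t)"
      "\<And>t. t \<noteq> 0 \<Longrightarrow> H t holomorphic_on slice_disc \<alpha> (cmod t)"
      "\<And>t z. t \<noteq> 0 \<Longrightarrow> z \<in> slice_circle \<alpha> (cmod t) \<Longrightarrow> H t z = g z (t * (z - of_real \<alpha>))"
  shows "pencil (component g k) k \<alpha> (\<lambda>t z. fourier_coeff (\<lambda>\<theta>. H (cis \<theta> * of_real t) z) k)"
proof -
  interpret homogeneous_sphere_function "component g k" k by (rule component_homogeneous_sphere_function[OF g])
  show ?thesis
  proof
    fix t :: real assume t: "t > 0" "t\<^sup>2 * (\<alpha>\<^sup>2 - 1) < 1"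
    note eqs = slice_sets_eq[OF t(2)]
    let ?c = "complex_of_real (slice_centre \<alpha> t)" and ?r = "slice_radius \<alpha> t"
    let ?t = "\<lambda>\<theta>. cis \<theta> * complex_of_real t"
    have tt: "?t \<theta> \<noteq> 0" "cmod (?t \<theta>) = t" for \<theta> using t by (auto simp: norm_mult)
    have circ: "(cmod z)\<^sup>2 + (cmod (?t \<theta> * (z - of_real \<alpha>)))\<^sup>2 = 1" if "z \<in> slice_circle \<alpha> t" for z \<theta>
      using that by (simp add: slice_circle_def norm_mult power_mult_distrib)
    have J: "continuous_on {(\<theta>,z). \<theta> \<in> {-pi..pi} \<and> z \<in> cball ?c ?r} (\<lambda>(\<theta>,z). H (?t \<theta>) z)"
    proof (rule disc_extensions_jointly_continuous)
      show "continuous_on (cball ?c ?r) (H (?t \<theta>))" "H (?t \<theta>) holomorphic_on ball ?c ?r" for \<theta>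
        using H(1,2)[OF tt(1), of \<theta>] unfolding tt(2) eqs by auto
      show "?r > 0" by (rule slice_radius_pos[OF t(2)])
      have "continuous_on {(\<theta>,z). \<theta> \<in> {-pi..pi} \<and> z \<in> slice_circle \<alpha> t}
         (\<lambda>u. (\<lambda>(z,w). g z w) (snd u, ?t (fst u) * (snd u - of_real \<alpha>)))"
        by (rule continuous_on_compose2[OF g]) (use circ in \<open>auto intro!: continuous_intros\<close>)
      then have "continuous_on {(\<theta>,z). \<theta> \<in> {-pi..pi} \<and> z \<in> slice_circle \<alpha> t} (\<lambda>(\<theta>,z). H (?t \<theta>) z)"
        by (rule continuous_on_eq) (use H(3) tt in auto)
      then show "continuous_on {(\<theta>,z). \<theta> \<in> {-pi..pi} \<and> z \<in> sphere ?c ?r} (\<lambda>(\<theta>,z). H (?t \<theta>) z)"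
        unfolding eqs .
    qed (auto intro!: continuous_intros)
    have J2: "continuous_on (cball ?c ?r \<times> {-pi..pi}) (\<lambda>(z,\<theta>). H (?t \<theta>) z)"
    proof -
      have "continuous_on (cball ?c ?r \<times> {-pi..pi}) (\<lambda>u. (\<lambda>(\<theta>,z). H (?t \<theta>) z) (snd u, fst u))"
        by (rule continuous_on_compose2[OF J]) (auto intro!: continuous_intros)
      then show ?thesis by (simp add: split_beta)
    qed
    show "continuous_on (slice_cdisc \<alpha> t) (\<lambda>z. fourier_coeff (\<lambda>\<theta>. H (?t \<theta>) z) k)"
      unfolding eqs by (rule fourier_coeff_continuous_param[OF J2])
    show "(\<lambda>z. fourier_coeff (\<lambda>\<theta>. H (?t \<theta>) z) k) holomorphic_on slice_disc \<alpha> t"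
      unfolding eqs
    proof (rule fourier_coeff_holomorphic_param)
      show "continuous_on (ball ?c ?r \<times> {-pi..pi}) (\<lambda>(z,\<theta>). H (?t \<theta>) z)"
        by (rule continuous_on_subset[OF J2]) auto
      show "(\<lambda>z. H (?t \<theta>) z) holomorphic_on ball ?c ?r" for \<theta>
        using H(2)[OF tt(1), of \<theta>] unfolding tt(2) eqs by simp
    qed auto
    fix z assume z: "z \<in> slice_circle \<alpha> t"
    have "H (?t \<theta>) z = g z (cis \<theta> * (of_real t * (z - of_real \<alpha>)))" for \<theta>
      using H(3)[OF tt(1), of z \<theta>] z unfolding tt(2) by (simp add: mult.assoc)
    then show "fourier_coeff (\<lambda>\<theta>. H (?t \<theta>) z) k = component g k z (of_real t * (z - of_real \<alpha>))"
      by (simp add: component_def)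
  qed
qed

text \<open>The Fejer means at angle \<open>0\<close> of the functions \<open>\<theta> \<mapsto> g z (cis \<theta> * w)\<close>; these have a common bound and modulus of
  continuity because the sphere is compact.\<close>

lemma fejer_mean_components_approx:
  assumes g: "continuous_on sphere2 (\<lambda>(z,w). g z w)" and e: "e > 0"
  obtains n where "n > 0" "\<And>z w. (cmod z)\<^sup>2 + (cmod w)\<^sup>2 = 1 \<Longrightarrow>
     cmod (g z w - (\<Sum>j<n. \<Sum>l<n. component g (int j - int l) z w) / of_nat n) \<le> e"
proof -
  have S: "sphere2 = sphere (0::complex \<times> complex) 1" by (auto simp: norm_Pair)
  have comp: "compact sphere2" unfolding S by (rule compact_sphere)
  have "compact ((\<lambda>(z,w). g z w) ` sphere2)" by (rule compact_continuous_image[OF g comp])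
  then obtain B where B: "\<And>x. x \<in> (\<lambda>(z,w). g z w) ` sphere2 \<Longrightarrow> norm x \<le> B"
    using compact_imp_bounded bounded_iff by metis
  have Bg: "cmod (g z w) \<le> B" if "(cmod z)\<^sup>2 + (cmod w)\<^sup>2 = 1" for z w
    using B[of "g z w"] that by (force simp: image_iff)
  have "uniformly_continuous_on sphere2 (\<lambda>(z,w). g z w)" by (rule compact_uniformly_continuous[OF g comp])
  then obtain d where d: "d > 0" "\<And>x x'. x \<in> sphere2 \<Longrightarrow> x' \<in> sphere2 \<Longrightarrow> dist x' x < d \<Longrightarrow>
      dist ((\<lambda>(z,w). g z w) x') ((\<lambda>(z,w). g z w) x) < e/2"
    using e unfolding uniformly_continuous_on_def by (meson half_gt_zero)
  have "isCont cis 0" using continuous_on_cis_real[of UNIV "\<lambda>x. x"] by (simp add: continuous_on_eq_continuous_at)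
  then obtain d2 where d2: "d2 > 0" "\<And>\<theta>. dist \<theta> 0 < d2 \<Longrightarrow> dist (cis \<theta>) (cis 0) < d"
    using d(1) unfolding continuous_at_eps_delta by meson
  define \<delta> where "\<delta> = min (d2/2) pi"
  have \<delta>: "0 < \<delta>" "\<delta> \<le> pi" "\<delta> < d2" using d2(1) by (auto simp: \<delta>_def)
  obtain n :: nat where n: "n > 0" "8 * B / (2 - 2 * cos \<delta>) / n < e/2"
  proof -
    have "(\<lambda>n. 8 * B / (2 - 2 * cos \<delta>) / real n) \<longlonglongrightarrow> 0" by (rule lim_const_over_n)
    then have "\<forall>\<^sub>F n in sequentially. 8 * B / (2 - 2 * cos \<delta>) / real n < e/2"
      using e by (intro order_tendstoD(2)) auto
    then have "\<forall>\<^sub>F n in sequentially. n > 0 \<and> 8 * B / (2 - 2 * cos \<delta>) / real n < e/2"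
      using eventually_gt_at_top[of 0] by eventually_elim auto
    then show ?thesis using that by (auto simp: eventually_sequentially)
  qed
  show ?thesis
  proof (rule that[OF n(1)])
    fix z w assume zw: "(cmod z)\<^sup>2 + (cmod w)\<^sup>2 = 1"
    let ?u = "\<lambda>\<theta>. g z (cis \<theta> * w)"
    have w1: "cmod w \<le> 1"
    proof -
      have "(cmod w)\<^sup>2 \<le> 1" using zw zero_le_power2[of "cmod z"] by linarith
      then show ?thesis by (simp add: abs_square_le_1)
    qed
    have rot: "(cmod z)\<^sup>2 + (cmod (cis \<theta> * w))\<^sup>2 = 1" for \<theta> using zw by (simp add: norm_mult)
    have cu: "continuous_on {-pi..pi} ?u"
    proof -
      have "continuous_on {-pi..pi} (\<lambda>\<theta>. (\<lambda>(z,w). g z w) (z, cis \<theta> * w))"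
        by (rule continuous_on_compose2[OF g]) (use zw in \<open>auto simp: norm_mult intro!: continuous_intros\<close>)
      then show ?thesis by simp
    qed
    have near: "cmod (?u \<theta> - ?u 0) \<le> e/2" if "\<bar>\<theta>\<bar> \<le> \<delta>" for \<theta>
    proof -
      have "dist (z, cis \<theta> * w) (z, cis 0 * w) = cmod (cis \<theta> - cis 0) * cmod w"
        by (simp add: dist_Pair_Pair dist_norm left_diff_distrib norm_mult[symmetric] del: cis_zero)
      also have "\<dots> \<le> cmod (cis \<theta> - cis 0)" using w1 by (intro mult_left_le) auto
      also have "\<dots> < d" using d2(2)[of \<theta>] that \<delta>(3) by (simp add: dist_norm)
      finally have "dist (g z (cis \<theta> * w)) (g z (cis 0 * w)) < e/2"
        using d(2)[of "(z, cis 0 * w)" "(z, cis \<theta> * w)"] rot zw by auto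
      then show ?thesis by (simp add: dist_norm)
    qed
    have "cmod (fejer_mean n ?u - ?u 0) \<le> e/2 + 8 * B / (2 - 2 * cos \<delta>) / n"
      by (rule fejer_mean_approx[OF cu \<delta>(1,2) _ near n(1)]) (use Bg rot in auto)
    also have "\<dots> \<le> e" using n by simp
    finally show "cmod (g z w - (\<Sum>j<n. \<Sum>l<n. component g (int j - int l) z w) / of_nat n) \<le> e"
      unfolding fejer_mean_def component_def by (simp add: norm_minus_commute)
  qed
qed

text \<open>Extendability along all lines through \<open>(\<alpha>,0)\<close> except the two axis directions \<open>w = 0\<close> and \<open>z = \<alpha>\<close>.\<close>

definition extends_along_slopes :: "(complex \<Rightarrow> complex \<Rightarrow> complex) \<Rightarrow> real \<Rightarrow> bool" where
  "extends_along_slopes g \<alpha> \<longleftrightarrow> (\<forall>t. t \<noteq> 0 \<longrightarrow> (\<exists>H. continuous_on (slice_cdisc \<alpha> (cmod t)) H \<and>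
     H holomorphic_on slice_disc \<alpha> (cmod t) \<and>
     (\<forall>z\<in>slice_circle \<alpha> (cmod t). H z = g z (t * (z - of_real \<alpha>)))))"

text \<open>\<open>Z\<close> and \<open>W\<close> parametrise the part in the closed ball of a line through \<open>(\<gamma>,0)\<close>: either the vertical line \<open>z = \<gamma>\<close> or
  a line \<open>w = t (z - \<gamma>)\<close>. On the first, the component is a constant times \<open>w\<^sup>k\<close>. On the second,
  \<open>1 - \<bar>z\<bar>\<^sup>2 = \<bar>t\<bar>\<^sup>2 \<bar>z - \<gamma>\<bar>\<^sup>2\<close> on the sphere allows to solve for \<open>cnj z\<close>, and \<open>vertex z\<close> becomes the meromorphic function
  \<open>A z / (z - \<gamma>)\<close>. Its powers up to \<open>k\<close> are compensated by \<open>w\<^sup>k = t\<^sup>k (z - \<gamma>)\<^sup>k\<close>.\<close>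

lemma component_disc_extends:
  assumes g: "continuous_on sphere2 (\<lambda>(z,w). g z w)"
    and ab: "\<alpha> < 0" "0 < \<beta>" and ext: "extends_along_slopes g \<alpha>" "extends_along_slopes g \<beta>"
    and Z: "continuous_on (cball 0 1) Z" "Z holomorphic_on ball 0 1"
    and W: "continuous_on (cball 0 1) W" "W holomorphic_on ball 0 1"
    and ZW: "\<And>\<zeta>. \<zeta> \<in> sphere 0 1 \<Longrightarrow> (cmod (Z \<zeta>))\<^sup>2 + (cmod (W \<zeta>))\<^sup>2 = 1"
    and Z1: "\<And>\<zeta>. \<zeta> \<in> cball 0 1 \<Longrightarrow> cmod (Z \<zeta>) < 1" and \<gamma>: "cmod \<gamma> < 1"
    and line: "(\<forall>\<zeta>\<in>cball 0 1. Z \<zeta> = \<gamma>) \<or> (\<exists>t. t \<noteq> 0 \<and> (\<forall>\<zeta>\<in>cball 0 1. W \<zeta> = t * (Z \<zeta> - \<gamma>)))"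
  shows "disc_extends (\<lambda>\<zeta>. component g k (Z \<zeta>) (W \<zeta>))"
proof -
  obtain HA where HA: "\<And>t. t \<noteq> 0 \<Longrightarrow> continuous_on (slice_cdisc \<alpha> (cmod t)) (HA t)"
      "\<And>t. t \<noteq> 0 \<Longrightarrow> HA t holomorphic_on slice_disc \<alpha> (cmod t)"
      "\<And>t z. t \<noteq> 0 \<Longrightarrow> z \<in> slice_circle \<alpha> (cmod t) \<Longrightarrow> HA t z = g z (t * (z - of_real \<alpha>))"
    using ext(1) unfolding extends_along_slopes_def by metis
  obtain HB where HB: "\<And>t. t \<noteq> 0 \<Longrightarrow> continuous_on (slice_cdisc \<beta> (cmod t)) (HB t)"
      "\<And>t. t \<noteq> 0 \<Longrightarrow> HB t holomorphic_on slice_disc \<beta> (cmod t)"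
      "\<And>t z. t \<noteq> 0 \<Longrightarrow> z \<in> slice_circle \<beta> (cmod t) \<Longrightarrow> HB t z = g z (t * (z - of_real \<beta>))"
    using ext(2) unfolding extends_along_slopes_def by metis
  interpret A: pencil "component g k" k \<alpha> "\<lambda>t z. fourier_coeff (\<lambda>\<theta>. HA (cis \<theta> * of_real t) z) k"
    by (rule component_pencil[OF g HA])
  interpret B: pencil "component g k" k \<beta> "\<lambda>t z. fourier_coeff (\<lambda>\<theta>. HB (cis \<theta> * of_real t) z) k"
    by (rule component_pencil[OF g HB])
  interpret two_pencils "component g k" k \<alpha> "\<lambda>t z. fourier_coeff (\<lambda>\<theta>. HA (cis \<theta> * of_real t) z) k"
    \<beta> "\<lambda>t z. fourier_coeff (\<lambda>\<theta>. HB (cis \<theta> * of_real t) z) k" ..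
  obtain b where b: "\<And>j. b j holomorphic_on ball 0 1"
    "\<And>z. cmod z < 1 \<Longrightarrow> A.F z = (\<Sum>j\<le>nat k. b j z * vertex z ^ j)"
    "\<And>z. k < 0 \<Longrightarrow> cmod z < 1 \<Longrightarrow> A.F z = 0"
    using polyanalytic_structure[OF ab] by metis
  have W0: "W \<zeta> \<noteq> 0" if z: "\<zeta> \<in> sphere 0 1" for \<zeta>
  proof
    assume "W \<zeta> = 0"
    then have "(cmod (Z \<zeta>))\<^sup>2 = 1" using ZW[OF z] by simp
    then show False using Z1[of \<zeta>] z norm_ge_zero[of "Z \<zeta>"] by (auto simp: power2_eq_1_iff)
  qed
  have val: "component g k (Z \<zeta>) (W \<zeta>) = A.F (Z \<zeta>) * W \<zeta> powi k" if z: "\<zeta> \<in> sphere 0 1" for \<zeta>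
    using A.F_eq[OF ZW[OF z] W0[OF z]] W0[OF z] by (simp add: power_int_minus field_simps)
  show ?thesis
  proof (cases "k < 0")
    case True
    show ?thesis unfolding disc_extends_def
      by (rule exI[of _ "\<lambda>_. 0"]) (use val b(3)[OF True] Z1 in \<open>auto\<close>)
  next
    case False
    then have k: "k = int (nat k)" by simp
    have pw: "w powi k = w ^ nat k" for w :: complex using k by (metis power_int_of_nat)
    from line show ?thesis
    proof
      assume c: "\<forall>\<zeta>\<in>cball 0 1. Z \<zeta> = \<gamma>"
      show ?thesis unfolding disc_extends_def
        by (rule exI[of _ "\<lambda>\<zeta>. A.F \<gamma> * W \<zeta> ^ nat k"])
           (use c val pw in \<open>auto intro!: continuous_intros holomorphic_intros W\<close>)
    next
      assume "\<exists>t. t \<noteq> 0 \<and> (\<forall>\<zeta>\<in>cball 0 1. W \<zeta> = t * (Z \<zeta> - \<gamma>))"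
      then obtain t where t: "t \<noteq> 0" "\<And>\<zeta>. \<zeta> \<in> cball 0 1 \<Longrightarrow> W \<zeta> = t * (Z \<zeta> - \<gamma>)" by blast
      define A where "A z = (1 / of_real ((cmod t)\<^sup>2) + cnj \<gamma> * (z - \<gamma>)) / (1 - cnj \<gamma> * z)" for z
      have nz: "1 - cnj \<gamma> * z \<noteq> 0" if "cmod z < 1" for z
      proof
        assume "1 - cnj \<gamma> * z = 0"
        then have "cmod (cnj \<gamma> * z) = 1" by (metis eq_iff_diff_eq_0 norm_one)
        moreover have "cmod \<gamma> * cmod z < 1" using \<gamma> that by (metis mult_less_cancel_right2 mult_strict_mono' norm_ge_zero mult_1 le_less_trans less_eq_real_def mult_left_le)
        ultimately show False by (simp add: norm_mult)
      qed
      have Ahol: "A holomorphic_on ball 0 1"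
        unfolding A_def by (intro holomorphic_intros) (use nz in auto)
      define H where "H z = (\<Sum>j\<le>nat k. b j z * (t ^ nat k * (z - \<gamma>) ^ (nat k - j) * A z ^ j))" for z
      have Hhol: "H holomorphic_on ball 0 1" unfolding H_def by (intro holomorphic_intros b Ahol)
      have vert: "vertex (Z \<zeta>) = A (Z \<zeta>) / (Z \<zeta> - \<gamma>)" if z: "\<zeta> \<in> sphere 0 1" for \<zeta>
      proof -
        let ?z = "Z \<zeta>"
        have zc: "\<zeta> \<in> cball 0 1" using z by auto
        have zg: "?z - \<gamma> \<noteq> 0" using W0[OF z] t(2)[OF zc] by auto
        then have zg': "cnj ?z - cnj \<gamma> \<noteq> 0" by (metis complex_cnj_diff complex_cnj_zero_iff)
        have "(cmod ?z)\<^sup>2 + (cmod t)\<^sup>2 * (cmod (?z - \<gamma>))\<^sup>2 = 1"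
          using ZW[OF z] t(2)[OF zc] by (simp add: norm_mult power_mult_distrib)
        then have "of_real ((cmod ?z)\<^sup>2) + of_real ((cmod t)\<^sup>2) * of_real ((cmod (?z - \<gamma>))\<^sup>2) = (1::complex)"
          by (metis of_real_1 of_real_add of_real_mult)
        then have e1: "?z * cnj ?z + of_real ((cmod t)\<^sup>2) * ((?z - \<gamma>) * (cnj ?z - cnj \<gamma>)) = 1"
          by (simp only: complex_norm_square complex_cnj_diff)
        define \<tau> where "\<tau> = complex_of_real ((cmod t)\<^sup>2)"
        have \<tau>0: "\<tau> \<noteq> 0" using t(1) by (simp add: \<tau>_def)
        have e2: "1 - ?z * cnj ?z = \<tau> * ((?z - \<gamma>) * (cnj ?z - cnj \<gamma>))" using e1 by (simp add: \<tau>_def algebra_simps)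
        have vx: "vertex ?z = cnj ?z / (\<tau> * ((?z - \<gamma>) * (cnj ?z - cnj \<gamma>)))"
          unfolding vertex_def e2[symmetric] by (simp only: of_real_diff of_real_1 complex_norm_square)
        have alg: "cnj ?z * (1 - cnj \<gamma> * ?z) = (1 + \<tau> * cnj \<gamma> * (?z - \<gamma>)) * (cnj ?z - cnj \<gamma>)"
        proof -
          have "(1 + \<tau> * cnj \<gamma> * (?z - \<gamma>)) * (cnj ?z - cnj \<gamma>) = (cnj ?z - cnj \<gamma>) + cnj \<gamma> * (1 - ?z * cnj ?z)"
            unfolding e2 by (simp add: algebra_simps)
          then show ?thesis by (simp add: algebra_simps)
        qed
        have "A ?z = (1 + \<tau> * cnj \<gamma> * (?z - \<gamma>)) / (\<tau> * (1 - cnj \<gamma> * ?z))"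
          unfolding A_def \<tau>_def[symmetric] using \<tau>0 by (simp add: field_simps)
        also have "\<dots> = cnj ?z / (\<tau> * (cnj ?z - cnj \<gamma>))"
          using \<tau>0 zg' nz[OF Z1[OF zc]] alg by (simp add: frac_eq_eq mult_ac)
        finally show ?thesis unfolding vx by simp
      qed
      show ?thesis unfolding disc_extends_def
      proof (intro exI[of _ "\<lambda>\<zeta>. H (Z \<zeta>)"] conjI ballI)
        show "continuous_on (cball 0 1) (\<lambda>\<zeta>. H (Z \<zeta>))"
          by (rule continuous_on_compose2[OF holomorphic_on_imp_continuous_on[OF Hhol] Z(1)]) (use Z1 in auto)
        have "H \<circ> Z holomorphic_on ball 0 1"
          by (rule holomorphic_on_compose_gen[OF Z(2) Hhol]) (use Z1 in auto)
        then show "(\<lambda>\<zeta>. H (Z \<zeta>)) holomorphic_on ball 0 1" by (simp add: o_def)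
        fix \<zeta> :: complex assume z: "\<zeta> \<in> sphere 0 1"
        then have zc: "\<zeta> \<in> cball 0 1" by auto
        have zg: "Z \<zeta> - \<gamma> \<noteq> 0" using W0[OF z] t(2)[OF zc] by auto
        have "component g k (Z \<zeta>) (W \<zeta>) = (\<Sum>j\<le>nat k. b j (Z \<zeta>) * (vertex (Z \<zeta>) ^ j * (t * (Z \<zeta> - \<gamma>)) ^ nat k))"
        proof -
          have "component g k (Z \<zeta>) (W \<zeta>) = A.F (Z \<zeta>) * (t * (Z \<zeta> - \<gamma>)) ^ nat k"
            using val[OF z] pw t(2)[OF zc] by simp
          then show ?thesis unfolding b(2)[OF Z1[OF zc]] by (simp add: sum_distrib_right mult.assoc)
        qed
        also have "\<dots> = H (Z \<zeta>)"
          unfolding H_def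
        proof (rule sum.cong[OF refl])
          fix j assume "j \<in> {..nat k}"
          then have "(Z \<zeta> - \<gamma>) ^ nat k = (Z \<zeta> - \<gamma>) ^ (nat k - j) * (Z \<zeta> - \<gamma>) ^ j" by (simp flip: power_add)
          then show "b j (Z \<zeta>) * (vertex (Z \<zeta>) ^ j * (t * (Z \<zeta> - \<gamma>)) ^ nat k)
              = b j (Z \<zeta>) * (t ^ nat k * (Z \<zeta> - \<gamma>) ^ (nat k - j) * A (Z \<zeta>) ^ j)"
            unfolding vert[OF z] using zg by (simp add: power_mult_distrib power_divide)
        qed
        finally show "H (Z \<zeta>) = component g k (Z \<zeta>) (W \<zeta>)" ..
      qed
    qed
  qed
qed

lemma normal_form_disc_extends:
  assumes g: "continuous_on sphere2 (\<lambda>(z,w). g z w)"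
    and ab: "\<alpha> < 0" "0 < \<beta>" and ext: "extends_along_slopes g \<alpha>" "extends_along_slopes g \<beta>"
    and Z: "continuous_on (cball 0 1) Z" "Z holomorphic_on ball 0 1"
    and W: "continuous_on (cball 0 1) W" "W holomorphic_on ball 0 1"
    and ZW: "\<And>\<zeta>. \<zeta> \<in> sphere 0 1 \<Longrightarrow> (cmod (Z \<zeta>))\<^sup>2 + (cmod (W \<zeta>))\<^sup>2 = 1"
    and Z1: "\<And>\<zeta>. \<zeta> \<in> cball 0 1 \<Longrightarrow> cmod (Z \<zeta>) < 1" and \<gamma>: "cmod \<gamma> < 1"
    and line: "(\<forall>\<zeta>\<in>cball 0 1. Z \<zeta> = \<gamma>) \<or> (\<exists>t. t \<noteq> 0 \<and> (\<forall>\<zeta>\<in>cball 0 1. W \<zeta> = t * (Z \<zeta> - \<gamma>)))"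
  shows "disc_extends (\<lambda>\<zeta>. g (Z \<zeta>) (W \<zeta>))"
proof (rule disc_extends_uniform_limit)
  fix e :: real assume "e > 0"
  then obtain n where n: "n > 0" "\<And>z w. (cmod z)\<^sup>2 + (cmod w)\<^sup>2 = 1 \<Longrightarrow>
     cmod (g z w - (\<Sum>j<n. \<Sum>l<n. component g (int j - int l) z w) / of_nat n) \<le> e"
    using fejer_mean_components_approx[OF g] by blast
  have "disc_extends (\<lambda>\<zeta>. (1 / of_nat n) * (\<Sum>j<n. \<Sum>l<n. component g (int j - int l) (Z \<zeta>) (W \<zeta>)))"
    by (intro disc_extends_cmult disc_extends_sum component_disc_extends[OF g ab ext Z W ZW Z1 \<gamma> line]) auto
  then show "\<exists>v. disc_extends v \<and> (\<forall>\<zeta>\<in>sphere 0 1. cmod (g (Z \<zeta>) (W \<zeta>) - v \<zeta>) \<le> e)"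
    using n(2)[OF ZW] by (intro exI conjI) (assumption, auto)
qed

section \<open>Projective reduction to the normal form\<close>

text \<open>The Hermitian form on homogeneous coordinates that is negative exactly over the ball.\<close>

definition herm3 :: "complex ^ 3 \<Rightarrow> complex ^ 3 \<Rightarrow> complex" where
  "herm3 X Y = X $ 1 * cnj (Y $ 1) + X $ 2 * cnj (Y $ 2) - X $ 3 * cnj (Y $ 3)"

definition lift :: "complex ^ 2 \<Rightarrow> complex ^ 3" where
  "lift a = vector [a $ 1, a $ 2, 1]"

definition proj :: "complex ^ 3 \<Rightarrow> complex ^ 2" where
  "proj X = vector [X $ 1 / X $ 3, X $ 2 / X $ 3]"

lemma herm3_add: "herm3 (X + X') Y = herm3 X Y + herm3 X' Y"
  and herm3_diff: "herm3 (X - X') Y = herm3 X Y - herm3 X' Y"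
  and herm3_scale: "herm3 (c *s X) Y = c * herm3 X Y"
  and herm3_add_right: "herm3 Y (X + X') = herm3 Y X + herm3 Y X'"
  and herm3_diff_right: "herm3 Y (X - X') = herm3 Y X - herm3 Y X'"
  and herm3_scale_right: "herm3 Y (c *s X) = cnj c * herm3 Y X"
  and herm3_cnj: "cnj (herm3 X Y) = herm3 Y X"
  by (simp_all add: herm3_def algebra_simps)

lemmas herm3_linear = herm3_add herm3_diff herm3_scale herm3_add_right herm3_diff_right herm3_scale_right

lemma herm3_self: "herm3 X X = of_real ((cmod (X $ 1))\<^sup>2 + (cmod (X $ 2))\<^sup>2 - (cmod (X $ 3))\<^sup>2)"
  by (simp only: herm3_def of_real_add of_real_diff complex_norm_square)

lemma lift_nth [simp]: "lift a $ 1 = a $ 1" "lift a $ 2 = a $ 2" "lift a $ 3 = 1"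
  by (simp_all add: lift_def)

lemma proj_nth [simp]: "proj X $ 1 = X $ 1 / X $ 3" "proj X $ 2 = X $ 2 / X $ 3"
  by (simp_all add: proj_def)

lemma herm3_lift: "herm3 (lift a) (lift b) = hermitian_inner a b - 1"
  by (simp add: herm3_def hermitian_inner_def)

lemma herm3_lift_self: "herm3 (lift a) (lift a) = of_real ((norm a)\<^sup>2 - 1)"
  by (simp add: herm3_lift hermitian_inner_self)

lemma norm_proj:
  assumes "X $ 3 \<noteq> 0"
  shows "(norm (proj X))\<^sup>2 - 1 = Re (herm3 X X) / (cmod (X $ 3))\<^sup>2"
  using assms by (simp add: norm_complex2 herm3_self norm_divide power_divide field_simps)

lemma vec3_eq_iff: "(X :: complex ^ 3) = Y \<longleftrightarrow> X $ 1 = Y $ 1 \<and> X $ 2 = Y $ 2 \<and> X $ 3 = Y $ 3"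
  by (simp add: vec_eq_iff forall_3)

lemma vec2_eq_iff: "(X :: complex ^ 2) = Y \<longleftrightarrow> X $ 1 = Y $ 1 \<and> X $ 2 = Y $ 2"
  by (simp add: vec_eq_iff forall_2)

lemma proj_lift [simp]: "c \<noteq> 0 \<Longrightarrow> proj (c *s lift a) = a"
  by (simp add: vec2_eq_iff)

lemma nonpos_imp_third_nonzero:
  assumes "Re (herm3 X X) \<le> 0" "X \<noteq> 0"
  shows "X $ 3 \<noteq> 0"
proof
  assume 3: "X $ 3 = 0"
  then have "(cmod (X $ 1))\<^sup>2 + (cmod (X $ 2))\<^sup>2 \<le> 0" using assms(1) by (simp add: herm3_self)
  then have "X $ 1 = 0 \<and> X $ 2 = 0" by (simp add: sum_power2_le_zero_iff)
  then show False using 3 assms(2) by (simp add: vec3_eq_iff)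
qed

text \<open>A basis in which the form is again \<open>\<bar>x\<bar>\<^sup>2 + \<bar>y\<bar>\<^sup>2 - \<bar>s\<bar>\<^sup>2\<close>, i.e. a projective change of coordinates that preserves the ball.\<close>

locale frame =
  fixes E1 E2 E3 :: "complex ^ 3"
  assumes ortho: "herm3 E1 E1 = 1" "herm3 E2 E2 = 1" "herm3 E3 E3 = -1"
    "herm3 E1 E2 = 0" "herm3 E1 E3 = 0" "herm3 E2 E3 = 0"
begin

lemma ortho': "herm3 E2 E1 = 0" "herm3 E3 E1 = 0" "herm3 E3 E2 = 0"
  using ortho(4-6) herm3_cnj by (metis complex_cnj_zero)+

text \<open>The orthogonality relations say that the coefficient map is a left inverse of the matrix with columns
  \<open>E1\<close>, \<open>E2\<close>, \<open>E3\<close>; a left inverse of a square matrix is a right inverse.\<close>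

lemma expansion: "X = herm3 X E1 *s E1 + herm3 X E2 *s E2 - herm3 X E3 *s E3"
proof -
  define M :: "complex ^ 3 ^ 3" where "M = (\<chi> i. vector [E1 $ i, E2 $ i, E3 $ i])"
  define J :: "complex ^ 3 \<Rightarrow> complex ^ 3" where "J E = vector [cnj (E $ 1), cnj (E $ 2), - cnj (E $ 3)]" for E
  define R :: "complex ^ 3 ^ 3" where "R = vector [J E1, J E2, - J E3]"
  have "R ** M = mat 1"
    using ortho ortho'
    by (simp add: vec_eq_iff forall_3 matrix_matrix_mult_def mat_def R_def M_def J_def sum_3 herm3_def algebra_simps)
  then have "M ** R = mat 1" by (simp add: matrix_left_right_inverse)
  then have "X = M *v (R *v X)" by (simp add: matrix_vector_mul_assoc)
  also have "R *v X = vector [herm3 X E1, herm3 X E2, - herm3 X E3]"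
    by (simp add: vec3_eq_iff matrix_vector_mult_def R_def J_def sum_3 herm3_def algebra_simps)
  also have "M *v \<dots> = herm3 X E1 *s E1 + herm3 X E2 *s E2 - herm3 X E3 *s E3"
    by (simp add: vec3_eq_iff matrix_vector_mult_def M_def sum_3 algebra_simps)
  finally show ?thesis .
qed

lemma parseval: "Re (herm3 X X) = (cmod (herm3 X E1))\<^sup>2 + (cmod (herm3 X E2))\<^sup>2 - (cmod (herm3 X E3))\<^sup>2"
proof -
  have "herm3 X X = herm3 (herm3 X E1 *s E1 + herm3 X E2 *s E2 - herm3 X E3 *s E3) X"
    using expansion[of X] by simp
  also have "\<dots> = herm3 X E1 * cnj (herm3 X E1) + herm3 X E2 * cnj (herm3 X E2) - herm3 X E3 * cnj (herm3 X E3)"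
    by (simp add: herm3_linear herm3_cnj)
  also have "\<dots> = of_real ((cmod (herm3 X E1))\<^sup>2 + (cmod (herm3 X E2))\<^sup>2 - (cmod (herm3 X E3))\<^sup>2)"
    by (simp only: of_real_add of_real_diff complex_norm_square)
  finally show ?thesis by simp
qed

text \<open>Homogeneous coordinates of the point that has the affine coordinates \<open>(z,w)\<close> in the frame.\<close>

definition point :: "complex \<Rightarrow> complex \<Rightarrow> complex ^ 3" where
  "point z w = z *s E1 + w *s E2 + E3"

lemma herm3_point: "herm3 (point z w) E1 = z" "herm3 (point z w) E2 = w" "herm3 (point z w) E3 = -1"
  by (simp_all add: point_def herm3_linear ortho ortho')

lemma point_self: "Re (herm3 (point z w) (point z w)) = (cmod z)\<^sup>2 + (cmod w)\<^sup>2 - 1"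
  by (simp add: parseval herm3_point)

lemma point_third: "(cmod z)\<^sup>2 + (cmod w)\<^sup>2 \<le> 1 \<Longrightarrow> point z w $ 3 \<noteq> 0"
proof (rule nonpos_imp_third_nonzero)
  show "point z w \<noteq> 0" using herm3_point(3)[of z w] by (auto simp: herm3_def)
qed (simp add: point_self)

lemma norm_proj_point:
  assumes "(cmod z)\<^sup>2 + (cmod w)\<^sup>2 \<le> 1"
  shows "(norm (proj (point z w)))\<^sup>2 - 1 = ((cmod z)\<^sup>2 + (cmod w)\<^sup>2 - 1) / (cmod (point z w $ 3))\<^sup>2"
  using norm_proj[OF point_third[OF assms]] by (simp add: point_self)

lemma proj_point_sphere: "(cmod z)\<^sup>2 + (cmod w)\<^sup>2 = 1 \<Longrightarrow> proj (point z w) \<in> sphere 0 1"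
proof -
  assume l: "(cmod z)\<^sup>2 + (cmod w)\<^sup>2 = 1"
  have "(norm (proj (point z w)))\<^sup>2 = 1\<^sup>2" using norm_proj_point[of z w] l by simp
  then have "norm (proj (point z w)) = 1" by (subst (asm) power2_eq_iff_nonneg) auto
  then show ?thesis by simp
qed

lemma proj_point_ball: "(cmod z)\<^sup>2 + (cmod w)\<^sup>2 < 1 \<Longrightarrow> proj (point z w) \<in> ball 0 1"
proof -
  assume l: "(cmod z)\<^sup>2 + (cmod w)\<^sup>2 < 1"
  then have "(norm (proj (point z w)))\<^sup>2 - 1 < 0"
    using norm_proj_point[of z w] point_third[of z w] by (simp add: divide_neg_pos)
  then show ?thesis by (simp add: abs_square_less_1)
qed

definition pullback :: "(complex ^ 2 \<Rightarrow> complex) \<Rightarrow> complex \<Rightarrow> complex \<Rightarrow> complex" where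
  "pullback f z w = f (proj (point z w))"

lemma point_nth: "point z w $ i = z * E1 $ i + w * E2 $ i + E3 $ i"
  by (simp add: point_def)

lemma continuous_on_proj_point:
  assumes "continuous_on S Z" "continuous_on S W" "\<And>x. x \<in> S \<Longrightarrow> (cmod (Z x))\<^sup>2 + (cmod (W x))\<^sup>2 \<le> 1"
  shows "continuous_on S (\<lambda>x. proj (point (Z x) (W x)))"
proof -
  have c: "continuous_on S (\<lambda>x. point (Z x) (W x) $ i)" for i
    unfolding point_nth by (intro continuous_intros assms)
  have ci: "continuous_on S (\<lambda>x. if i = 1 then point (Z x) (W x) $ 1 / point (Z x) (W x) $ 3 else point (Z x) (W x) $ 2 / point (Z x) (W x) $ 3)" for i :: 2
    using c[of 1] c[of 2] c[of 3] point_third assms(3) by (cases "i = 1") (auto intro!: continuous_on_divide)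
  have "continuous_on S (\<lambda>x. \<chi> i :: 2. if i = 1 then point (Z x) (W x) $ 1 / point (Z x) (W x) $ 3 else point (Z x) (W x) $ 2 / point (Z x) (W x) $ 3)"
    by (intro continuous_on_vec_lambda ci)
  moreover have "(\<chi> i :: 2. if i = 1 then X $ 1 / X $ 3 else X $ 2 / X $ 3) = proj X" for X
    by (simp add: vec2_eq_iff)
  ultimately show ?thesis by simp
qed

lemma pullback_continuous:
  assumes "continuous_on (sphere 0 1) f"
  shows "continuous_on sphere2 (\<lambda>(z,w). pullback f z w)"
proof -
  have "continuous_on sphere2 (\<lambda>u. f (proj (point (fst u) (snd u))))"
    by (rule continuous_on_compose2[OF assms continuous_on_proj_point])
       (auto intro!: continuous_intros proj_point_sphere simp del: mem_sphere_0)
  then show ?thesis by (simp add: pullback_def split_beta)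
qed

text \<open>In the frame, the lines through \<open>a\<close> other than \<open>w = 0\<close> and the vertical one are the lines \<open>w = t (z - \<alpha>)\<close>. The point over \<open>z\<close> on
  such a line is \<open>a + s z *s v\<close> for a Moebius transformation \<open>s\<close>, along which the given extension is transported.\<close>

lemma pullback_extends_along_slopes:
  assumes a: "lift a = \<mu> *s (of_real \<alpha> *s E1 + E3)" "\<mu> \<noteq> 0"
    and f: "\<And>L. L \<in> complex_lines_through a \<Longrightarrow> extends_holomorphically_along f L"
  shows "extends_along_slopes (pullback f) \<alpha>"
  unfolding extends_along_slopes_def
proof (intro allI impI)
  fix t :: complex assume t: "t \<noteq> 0"
  define V where "V = E1 + t *s E2"
  define v :: "complex ^ 2" where "v = vector [V $ 1 - V $ 3 * a $ 1, V $ 2 - V $ 3 * a $ 2]"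
  have a3: "of_real \<alpha> * E1 $ 3 + E3 $ 3 = 1 / \<mu>"
  proof -
    have "1 = \<mu> * (of_real \<alpha> * E1 $ 3 + E3 $ 3)"
      using arg_cong[OF a(1), of "\<lambda>X. X $ 3"] by (simp add: algebra_simps)
    then show ?thesis using a(2) by (simp add: field_simps)
  qed
  have a12: "of_real \<alpha> * E1 $ 1 + E3 $ 1 = a $ 1 / \<mu>" "of_real \<alpha> * E1 $ 2 + E3 $ 2 = a $ 2 / \<mu>"
    using arg_cong[OF a(1), of "\<lambda>X. X $ 1"] arg_cong[OF a(1), of "\<lambda>X. X $ 2"] a(2) by (simp_all add: field_simps)
  have point_line: "point z (t * (z - of_real \<alpha>)) = (of_real \<alpha> *s E1 + E3) + (z - of_real \<alpha>) *s V" for z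
    by (simp add: point_def V_def vec3_eq_iff algebra_simps)
  have X3: "point z (t * (z - of_real \<alpha>)) $ 3 = 1 / \<mu> + (z - of_real \<alpha>) * V $ 3" for z
    unfolding point_line using a3 by (simp add: algebra_simps)
  define s where "s z = (z - of_real \<alpha>) / (1 / \<mu> + (z - of_real \<alpha>) * V $ 3)" for z
  have proj_line: "proj (point z (t * (z - of_real \<alpha>))) = a + s z *s v"
    if nz: "point z (t * (z - of_real \<alpha>)) $ 3 \<noteq> 0" for z
  proof -
    have D: "1 / \<mu> + (z - of_real \<alpha>) * V $ 3 \<noteq> 0" using nz X3 by simp
    have alg: "(x / \<mu> + d * p) / (1 / \<mu> + d * q) = x + d / (1 / \<mu> + d * q) * (p - q * x)"
      if "1 / \<mu> + d * q \<noteq> 0" for x d p q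
    proof -
      have "x / \<mu> + d * p = x * (1 / \<mu> + d * q) + d * (p - q * x)" by (simp add: algebra_simps)
      then show ?thesis using that by (simp add: add_divide_distrib)
    qed
    have "point z (t * (z - of_real \<alpha>)) $ 1 = a $ 1 / \<mu> + (z - of_real \<alpha>) * V $ 1"
      "point z (t * (z - of_real \<alpha>)) $ 2 = a $ 2 / \<mu> + (z - of_real \<alpha>) * V $ 2"
      unfolding point_line using a12 by (simp_all add: algebra_simps)
    then show ?thesis
      by (simp add: vec2_eq_iff X3 s_def v_def alg[OF D])
  qed
  have v0: "v \<noteq> 0"
  proof
    assume "v = 0"
    then have "V = V $ 3 *s lift a" by (simp add: v_def vec2_eq_iff vec3_eq_iff)
    then have "herm3 V E2 = V $ 3 * herm3 (lift a) E2" by (metis herm3_scale)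
    moreover have "herm3 V E2 = t" by (simp add: V_def herm3_linear ortho)
    moreover have "herm3 (lift a) E2 = 0" unfolding a(1) by (simp add: herm3_linear ortho ortho')
    ultimately show False using t by simp
  qed
  have L: "cline a v \<in> complex_lines_through a" using v0 by (auto simp: complex_lines_through_def)
  obtain G where G: "continuous_on (cline a v \<inter> cball 0 1) G" "holomorphic_on_line G (cline a v) (ball 0 1)"
    "\<And>x. x \<in> cline a v \<Longrightarrow> x \<in> sphere 0 1 \<Longrightarrow> G x = f x"
    using f[OF L] unfolding extends_holomorphically_along_def by blast
  have Ghol: "(\<lambda>\<zeta>. G (a + \<zeta> *s v)) holomorphic_on {\<zeta>. a + \<zeta> *s v \<in> ball 0 1}"
    using G(2) holomorphic_on_line_iff[OF v0] by blast
  have on_line: "a + \<zeta> *s v \<in> cline a v" for \<zeta> unfolding cline_def by (rule rangeI)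
  have sq: "(cmod z)\<^sup>2 + (cmod (t * (z - of_real \<alpha>)))\<^sup>2 = (cmod z)\<^sup>2 + (cmod t)\<^sup>2 * (cmod (z - of_real \<alpha>))\<^sup>2" for z
    by (simp add: norm_mult power_mult_distrib)
  have third: "point z (t * (z - of_real \<alpha>)) $ 3 \<noteq> 0" if "z \<in> slice_cdisc \<alpha> (cmod t)" for z
    using that by (intro point_third) (simp add: sq slice_cdisc_def)
  have sub: "slice_disc \<alpha> r \<subseteq> slice_cdisc \<alpha> r" "slice_circle \<alpha> r \<subseteq> slice_cdisc \<alpha> r" for r
    by (auto simp: slice_disc_def slice_cdisc_def slice_circle_def)
  have P: "proj (point z (t * (z - of_real \<alpha>))) = a + s z *s v" if "z \<in> slice_cdisc \<alpha> (cmod t)" for z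
    by (rule proj_line[OF third[OF that]])
  show "\<exists>H. continuous_on (slice_cdisc \<alpha> (cmod t)) H \<and> H holomorphic_on slice_disc \<alpha> (cmod t) \<and>
     (\<forall>z\<in>slice_circle \<alpha> (cmod t). H z = pullback f z (t * (z - of_real \<alpha>)))"
  proof (intro exI[of _ "\<lambda>z. G (a + s z *s v)"] conjI ballI)
    have "continuous_on (slice_cdisc \<alpha> (cmod t)) (\<lambda>z. G (proj (point z (t * (z - of_real \<alpha>)))))"
    proof (rule continuous_on_compose2[OF G(1)])
      show "continuous_on (slice_cdisc \<alpha> (cmod t)) (\<lambda>z. proj (point z (t * (z - of_real \<alpha>))))"
        by (rule continuous_on_proj_point) (auto intro!: continuous_intros simp: sq slice_cdisc_def)
      show "(\<lambda>z. proj (point z (t * (z - of_real \<alpha>)))) ` slice_cdisc \<alpha> (cmod t) \<subseteq> cline a v \<inter> cball 0 1"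
      proof (clarify, intro IntI)
        fix z assume z: "z \<in> slice_cdisc \<alpha> (cmod t)"
        show "proj (point z (t * (z - of_real \<alpha>))) \<in> cline a v" unfolding P[OF z] by (rule on_line)
        have "(cmod z)\<^sup>2 + (cmod (t * (z - of_real \<alpha>)))\<^sup>2 < 1 \<or> (cmod z)\<^sup>2 + (cmod (t * (z - of_real \<alpha>)))\<^sup>2 = 1"
          using z unfolding sq slice_cdisc_def by auto
        then show "proj (point z (t * (z - of_real \<alpha>))) \<in> cball 0 1"
          using proj_point_ball[of z "t * (z - of_real \<alpha>)"] proj_point_sphere[of z "t * (z - of_real \<alpha>)"]
          by (elim disjE) (auto simp: less_imp_le)
      qed
    qed
    then show "continuous_on (slice_cdisc \<alpha> (cmod t)) (\<lambda>z. G (a + s z *s v))"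
      by (rule continuous_on_eq) (simp add: P)
    have "(\<lambda>\<zeta>. G (a + \<zeta> *s v)) \<circ> s holomorphic_on slice_disc \<alpha> (cmod t)"
    proof (rule holomorphic_on_compose_gen[OF _ Ghol])
      show "s holomorphic_on slice_disc \<alpha> (cmod t)"
        unfolding s_def by (intro holomorphic_intros) (use third X3 sub in force)
      show "s ` slice_disc \<alpha> (cmod t) \<subseteq> {\<zeta>. a + \<zeta> *s v \<in> ball 0 1}"
      proof clarify
        fix z assume z: "z \<in> slice_disc \<alpha> (cmod t)"
        then have "z \<in> slice_cdisc \<alpha> (cmod t)" using sub by blast
        from P[OF this, symmetric] show "a + s z *s v \<in> ball 0 1"
          using z proj_point_ball[of z "t * (z - of_real \<alpha>)"] by (simp add: sq slice_disc_def)
      qed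
    qed
    then show "(\<lambda>z. G (a + s z *s v)) holomorphic_on slice_disc \<alpha> (cmod t)" by (simp add: o_def)
    fix z assume z: "z \<in> slice_circle \<alpha> (cmod t)"
    then have zc: "z \<in> slice_cdisc \<alpha> (cmod t)" using sub by blast
    have "proj (point z (t * (z - of_real \<alpha>))) \<in> sphere 0 1"
      using z by (intro proj_point_sphere) (simp add: sq slice_circle_def)
    then show "G (a + s z *s v) = pullback f z (t * (z - of_real \<alpha>))"
      unfolding pullback_def P[OF zc] by (intro G(3) on_line)
  qed
qed

end

lemma norm2_eq: "(norm (a :: complex ^ 2))\<^sup>2 = Re (hermitian_inner a a)"
  by (simp add: hermitian_inner_self)

text \<open>An affine coordinate in which the part of the line in the ball is the unit disc: the origin is at the point \<open>p\<close> of the line nearest to the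
  centre of the ball, and the unit of length is the radius of the disc.\<close>

lemma cline_unit_param:
  assumes v: "v \<noteq> 0" and meets: "cline c v \<inter> ball 0 1 \<noteq> {}"
  obtains p w \<rho> where "w \<noteq> 0" "\<rho> > 0" "cline c v = cline p w"
    "\<And>\<zeta>. (norm (p + \<zeta> *s w))\<^sup>2 - 1 = \<rho> * ((cmod \<zeta>)\<^sup>2 - 1)"
proof -
  have vv: "hermitian_inner v v = of_real ((norm v)\<^sup>2)" "(norm v)\<^sup>2 > 0" using v by (simp_all add: hermitian_inner_self)
  have vv0: "hermitian_inner v v \<noteq> 0" using vv v by simp
  define k where "k = hermitian_inner c v / hermitian_inner v v"
  define p where "p = c - k *s v"
  have pv: "hermitian_inner p v = 0"
  proof -
    have "hermitian_inner (c - k *s v) v = hermitian_inner c v - k * hermitian_inner v v" for k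
      by (simp add: hermitian_inner_def algebra_simps)
    then show ?thesis using vv0 by (simp add: p_def k_def)
  qed
  have vp: "hermitian_inner v p = 0"
  proof -
    have "hermitian_inner v p = cnj (hermitian_inner p v)" by (simp add: hermitian_inner_def mult.commute)
    then show ?thesis using pv by simp
  qed
  have np: "(norm (p + \<zeta> *s v))\<^sup>2 = (norm p)\<^sup>2 + (cmod \<zeta>)\<^sup>2 * (norm v)\<^sup>2" for \<zeta>
  proof -
    have "hermitian_inner (p + \<zeta> *s v) (p + \<zeta> *s v) = hermitian_inner p p + cnj \<zeta> * hermitian_inner p v
       + \<zeta> * hermitian_inner v p + (\<zeta> * cnj \<zeta>) * hermitian_inner v v"
      by (simp add: hermitian_inner_def algebra_simps)
    also have "\<dots> = of_real ((norm p)\<^sup>2 + (cmod \<zeta>)\<^sup>2 * (norm v)\<^sup>2)"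
      by (simp only: pv vp hermitian_inner_self of_real_add of_real_mult complex_norm_square) simp
    finally show ?thesis unfolding norm2_eq[of "p + \<zeta> *s v"] by simp
  qed
  have line: "cline c v = cline p (r *s v)" if "r \<noteq> 0" for r
  proof -
    have 1: "c + z *s v = p + ((z + k) / r) *s (r *s v)" for z
    proof -
      have "((z + k) / r) *s (r *s v) = (z + k) *s v" using that by (simp add: vector_smult_assoc)
      then show ?thesis by (simp add: p_def vec2_eq_iff algebra_simps)
    qed
    have 2: "p + z *s (r *s v) = c + (z * r - k) *s v" for z
      by (simp add: p_def vec2_eq_iff algebra_simps)
    show ?thesis unfolding cline_def
    proof (intro subset_antisym image_subsetI)
      show "c + z *s v \<in> range (\<lambda>z. p + z *s (r *s v))" for z unfolding 1 by (rule rangeI)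
      show "p + z *s (r *s v) \<in> range (\<lambda>z. c + z *s v)" for z unfolding 2 by (rule rangeI)
    qed
  qed
  have p1: "norm p < 1"
  proof -
    obtain x where x: "x \<in> cline c v" "norm x < 1" using meets by auto
    then obtain z where "x = p + z *s v" using line[of 1] by (auto simp: cline_def)
    then have "(norm p)\<^sup>2 \<le> (norm x)\<^sup>2" using np[of z] by simp
    then show ?thesis using x(2) by (meson norm_ge_zero order_le_less_trans power2_le_imp_le)
  qed
  define \<rho> where "\<rho> = 1 - (norm p)\<^sup>2"
  have \<rho>: "\<rho> > 0" using p1 by (simp add: \<rho>_def abs_square_less_1)
  define r where "r = complex_of_real (sqrt \<rho> / norm v)"
  have r: "r \<noteq> 0" "(cmod r)\<^sup>2 * (norm v)\<^sup>2 = \<rho>" using \<rho> v by (simp_all add: r_def norm_divide power_divide)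
  show ?thesis
  proof (rule that[of "r *s v" \<rho> p])
    show "r *s v \<noteq> 0" using r(1) v by simp
    show "\<rho> > 0" by (rule \<rho>)
    show "cline c v = cline p (r *s v)" by (rule line[OF r(1)])
    show "(norm (p + \<zeta> *s (r *s v)))\<^sup>2 - 1 = \<rho> * ((cmod \<zeta>)\<^sup>2 - 1)" for \<zeta>
    proof -
      have "(norm (p + \<zeta> *s (r *s v)))\<^sup>2 = (norm p)\<^sup>2 + (cmod (\<zeta> * r))\<^sup>2 * (norm v)\<^sup>2"
        using np[of "\<zeta> * r"] by (simp add: vector_smult_assoc)
      also have "\<dots> = (1 - \<rho>) + (cmod \<zeta>)\<^sup>2 * \<rho>"
        using r(2) by (simp add: \<rho>_def norm_mult power_mult_distrib mult.assoc)
      finally show ?thesis by (simp add: algebra_simps)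
    qed
  qed
qed

text \<open>The coordinate \<open>\<zeta>\<close> of a point of the line is recovered by a Hermitian product with \<open>w\<close>.\<close>

lemma extends_along_if_disc_extends:
  assumes w: "w \<noteq> 0" and \<rho>: "\<rho> > 0"
    and np: "\<And>\<zeta>. (norm (p + \<zeta> *s w))\<^sup>2 - 1 = \<rho> * ((cmod \<zeta>)\<^sup>2 - 1)"
    and ext: "disc_extends (\<lambda>\<zeta>. f (p + \<zeta> *s w))"
  shows "extends_holomorphically_along f (cline p w)"
proof -
  obtain H where H: "continuous_on (cball 0 1) H" "H holomorphic_on ball 0 1"
    "\<And>\<zeta>. \<zeta> \<in> sphere 0 1 \<Longrightarrow> H \<zeta> = f (p + \<zeta> *s w)"
    using ext unfolding disc_extends_def by blast
  have ww: "hermitian_inner w w \<noteq> 0" using w by (simp add: hermitian_inner_self)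
  define co where "co x = hermitian_inner (x - p) w / hermitian_inner w w" for x
  have co: "co (p + \<zeta> *s w) = \<zeta>" for \<zeta>
  proof -
    have "hermitian_inner (\<zeta> *s w) w = \<zeta> * hermitian_inner w w" by (simp add: hermitian_inner_def algebra_simps)
    then show ?thesis using ww by (simp add: co_def)
  qed
  have inball: "norm (p + \<zeta> *s w) < 1 \<longleftrightarrow> cmod \<zeta> < 1" "norm (p + \<zeta> *s w) \<le> 1 \<longleftrightarrow> cmod \<zeta> \<le> 1"
    "norm (p + \<zeta> *s w) = 1 \<longleftrightarrow> cmod \<zeta> = 1" for \<zeta>
  proof -
    have 1: "norm (p + \<zeta> *s w) < 1 \<longleftrightarrow> (norm (p + \<zeta> *s w))\<^sup>2 - 1 < 0" by (simp add: abs_square_less_1)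
    have 2: "cmod \<zeta> < 1 \<longleftrightarrow> (cmod \<zeta>)\<^sup>2 - 1 < 0" by (simp add: abs_square_less_1)
    show a: "norm (p + \<zeta> *s w) < 1 \<longleftrightarrow> cmod \<zeta> < 1" unfolding 1 2 np using \<rho> by (simp add: mult_less_0_iff)
    have 3: "norm (p + \<zeta> *s w) = 1 \<longleftrightarrow> (norm (p + \<zeta> *s w))\<^sup>2 - 1 = 0"
      using norm_ge_zero[of "p + \<zeta> *s w"] by (auto simp: power2_eq_1_iff simp del: norm_ge_zero)
    have 4: "cmod \<zeta> = 1 \<longleftrightarrow> (cmod \<zeta>)\<^sup>2 - 1 = 0"
      using norm_ge_zero[of \<zeta>] by (auto simp: power2_eq_1_iff simp del: norm_ge_zero)
    show b: "norm (p + \<zeta> *s w) = 1 \<longleftrightarrow> cmod \<zeta> = 1" unfolding 3 4 np using \<rho> by simp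
    show "norm (p + \<zeta> *s w) \<le> 1 \<longleftrightarrow> cmod \<zeta> \<le> 1" using a b by (auto simp: le_less)
  qed
  have comp: "continuous_on UNIV co"
    unfolding co_def hermitian_inner_def by (intro continuous_intros) (use ww in \<open>simp add: hermitian_inner_def\<close>)
  show ?thesis unfolding extends_holomorphically_along_def
  proof (intro exI[of _ "\<lambda>x. H (co x)"] conjI ballI)
    show "continuous_on (cline p w \<inter> cball 0 1) (\<lambda>x. H (co x))"
      by (rule continuous_on_compose2[OF H(1) continuous_on_subset[OF comp]])
         (auto simp: cline_def co inball)
    show "holomorphic_on_line (\<lambda>x. H (co x)) (cline p w) (ball 0 1)"
      unfolding holomorphic_on_line_iff[OF w] co
      by (rule holomorphic_on_subset[OF H(2)]) (auto simp: inball)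
    fix x assume "x \<in> cline p w \<inter> sphere 0 1"
    then obtain \<zeta> where z: "x = p + \<zeta> *s w" "norm x = 1" by (auto simp: cline_def)
    then have "\<zeta> \<in> sphere 0 1" using inball(3) by simp
    then show "H (co x) = f x" using H(3) z co by simp
  qed
qed

text \<open>Directions of lines are the points at infinity.\<close>

definition dir3 :: "complex ^ 2 \<Rightarrow> complex ^ 3" where
  "dir3 w = vector [w $ 1, w $ 2, 0]"

lemma dir3_nth [simp]: "dir3 a $ 1 = a $ 1" "dir3 a $ 2 = a $ 2" "dir3 a $ 3 = 0"
  by (simp_all add: dir3_def)

lemma lift_add: "lift (p + \<zeta> *s w) = lift p + \<zeta> *s dir3 w"
  by (simp add: vec3_eq_iff)

context frame
begin

text \<open>The homogeneous frame coordinates of a point of the line are affine functions \<open>x\<close>, \<open>y\<close>, \<open>s\<close> of the coordinate \<open>\<zeta>\<close>. The third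
  one has no zero over the closed ball, so \<open>Z = x / s\<close> and \<open>W = y / s\<close> are holomorphic, and they parametrise a line through the
  point \<open>(Z \<eta>, 0)\<close> of the axis.\<close>

lemma line_disc_extends:
  assumes f: "continuous_on (sphere 0 1) f"
    and a: "lift a = \<mu> *s (of_real \<alpha> *s E1 + E3)" "\<mu> \<noteq> 0" "\<alpha> < 0"
    and b: "lift b = \<nu> *s (of_real \<beta> *s E1 + E3)" "\<nu> \<noteq> 0" "\<beta> > 0"
    and ext: "\<And>L. L \<in> complex_lines_through a \<union> complex_lines_through b \<Longrightarrow> extends_holomorphically_along f L"
    and \<rho>: "\<rho> > 0" and np: "\<And>\<zeta>. (norm (p + \<zeta> *s w))\<^sup>2 - 1 = \<rho> * ((cmod \<zeta>)\<^sup>2 - 1)"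
    and \<eta>: "cmod \<eta> < 1" "herm3 (lift (p + \<eta> *s w)) E2 = 0" and w: "herm3 (dir3 w) E2 \<noteq> 0"
  shows "disc_extends (\<lambda>\<zeta>. f (p + \<zeta> *s w))"
proof -
  let ?Y = "\<lambda>\<zeta>. lift (p + \<zeta> *s w)"
  define x where "x \<zeta> = herm3 (?Y \<zeta>) E1" for \<zeta>
  define y where "y \<zeta> = herm3 (?Y \<zeta>) E2" for \<zeta>
  define s where "s \<zeta> = - herm3 (?Y \<zeta>) E3" for \<zeta>
  have x_aff: "x \<zeta> = herm3 (lift p) E1 + \<zeta> * herm3 (dir3 w) E1" for \<zeta> by (simp add: x_def lift_add herm3_linear)
  have y_aff: "y \<zeta> = herm3 (lift p) E2 + \<zeta> * herm3 (dir3 w) E2" for \<zeta> by (simp add: y_def lift_add herm3_linear)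
  have s_aff: "s \<zeta> = - herm3 (lift p) E3 - \<zeta> * herm3 (dir3 w) E3" for \<zeta> by (simp add: s_def lift_add herm3_linear)
  have pars: "(cmod (x \<zeta>))\<^sup>2 + (cmod (y \<zeta>))\<^sup>2 - (cmod (s \<zeta>))\<^sup>2 = \<rho> * ((cmod \<zeta>)\<^sup>2 - 1)" for \<zeta>
    using parseval[of "?Y \<zeta>"] np[of \<zeta>] by (simp add: herm3_lift_self x_def y_def s_def)
  have expand: "?Y \<zeta> = x \<zeta> *s E1 + y \<zeta> *s E2 + s \<zeta> *s E3" for \<zeta>
    using expansion[of "?Y \<zeta>"] by (simp add: x_def y_def s_def vec3_eq_iff)
  have s0: "s \<zeta> \<noteq> 0" if "cmod \<zeta> \<le> 1" for \<zeta>
  proof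
    assume s: "s \<zeta> = 0"
    have "\<rho> * ((cmod \<zeta>)\<^sup>2 - 1) \<le> 0" using \<rho> that by (simp add: mult_le_0_iff abs_square_le_1)
    then have "(cmod (x \<zeta>))\<^sup>2 + (cmod (y \<zeta>))\<^sup>2 \<le> 0" using pars[of \<zeta>] s by simp
    then have "x \<zeta> = 0" "y \<zeta> = 0" by (auto simp: sum_power2_le_zero_iff)
    then have "?Y \<zeta> = 0" using expand[of \<zeta>] s by (simp add: vec3_eq_iff)
    then show False by (metis lift_nth(3) zero_index zero_neq_one)
  qed
  define Z where "Z \<zeta> = x \<zeta> / s \<zeta>" for \<zeta>
  define W where "W \<zeta> = y \<zeta> / s \<zeta>" for \<zeta>
  have ZW: "(cmod (Z \<zeta>))\<^sup>2 + (cmod (W \<zeta>))\<^sup>2 - 1 = \<rho> * ((cmod \<zeta>)\<^sup>2 - 1) / (cmod (s \<zeta>))\<^sup>2" if "cmod \<zeta> \<le> 1" for \<zeta>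
    using s0[OF that] unfolding pars[symmetric] Z_def W_def by (simp add: norm_divide power_divide diff_divide_distrib add_divide_distrib)
  have y1: "y \<zeta> = herm3 (dir3 w) E2 * (\<zeta> - \<eta>)" for \<zeta>
  proof -
    have "herm3 (lift p) E2 + \<eta> * herm3 (dir3 w) E2 = 0" using \<eta>(2) y_aff[of \<eta>] by (simp add: y_def)
    then have "herm3 (lift p) E2 = - (\<eta> * herm3 (dir3 w) E2)" by (simp add: eq_neg_iff_add_eq_0)
    then show ?thesis unfolding y_aff by (simp add: algebra_simps)
  qed
  define \<gamma> where "\<gamma> = Z \<eta>"
  define x' where "x' = herm3 (dir3 w) E1 + \<gamma> * herm3 (dir3 w) E3"
  have x1: "x \<zeta> - \<gamma> * s \<zeta> = x' * (\<zeta> - \<eta>)" for \<zeta>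
  proof -
    have "x \<eta> - \<gamma> * s \<eta> = 0" using s0[of \<eta>] \<eta>(1) by (simp add: \<gamma>_def Z_def)
    then have "x \<zeta> - \<gamma> * s \<zeta> = (x \<zeta> - x \<eta>) - \<gamma> * (s \<zeta> - s \<eta>)" by (simp add: algebra_simps)
    then show ?thesis unfolding x_aff s_aff x'_def by (simp add: algebra_simps)
  qed
  have Z\<gamma>: "Z \<zeta> - \<gamma> = x' * (\<zeta> - \<eta>) / s \<zeta>" if "cmod \<zeta> \<le> 1" for \<zeta>
    using s0[OF that] unfolding x1[symmetric] Z_def by (simp add: diff_divide_distrib)
  have Z1: "cmod (Z \<zeta>) < 1" if z: "cmod \<zeta> \<le> 1" for \<zeta>
  proof -
    have "(cmod (Z \<zeta>))\<^sup>2 < 1"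
    proof (cases "cmod \<zeta> < 1")
      case True
      then have "\<rho> * ((cmod \<zeta>)\<^sup>2 - 1) < 0" using \<rho> by (simp add: mult_less_0_iff abs_square_less_1)
      then have "\<rho> * ((cmod \<zeta>)\<^sup>2 - 1) / (cmod (s \<zeta>))\<^sup>2 < 0" using s0[OF z] by (simp add: divide_neg_pos)
      then show ?thesis using ZW[OF z] zero_le_power2[of "cmod (W \<zeta>)"] by linarith
    next
      case False
      then have 1: "cmod \<zeta> = 1" using z by simp
      then have "\<zeta> \<noteq> \<eta>" using \<eta> by auto
      then have "W \<zeta> \<noteq> 0" using w s0[OF z] by (simp add: W_def y1)
      then have W0: "(cmod (W \<zeta>))\<^sup>2 > 0" by simp
      have "(cmod (Z \<zeta>))\<^sup>2 + (cmod (W \<zeta>))\<^sup>2 - 1 = 0" using ZW[OF z] 1 by simp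
      then show ?thesis using W0 by linarith
    qed
    then show ?thesis by (simp add: abs_square_less_1)
  qed
  have val: "f (p + \<zeta> *s w) = pullback f (Z \<zeta>) (W \<zeta>)" if z: "cmod \<zeta> \<le> 1" for \<zeta>
  proof -
    have "point (Z \<zeta>) (W \<zeta>) = (1 / s \<zeta>) *s ?Y \<zeta>"
      unfolding expand point_def Z_def W_def using s0[OF z] by (simp add: vec3_eq_iff field_simps)
    then have "proj (point (Z \<zeta>) (W \<zeta>)) = p + \<zeta> *s w" using s0[OF z] by simp
    then show ?thesis by (simp add: pullback_def)
  qed
  have hol: "Z holomorphic_on ball 0 1" "W holomorphic_on ball 0 1"
    unfolding Z_def W_def x_aff y_aff s_aff using s0 unfolding s_aff by (auto intro!: holomorphic_intros)
  have cont: "continuous_on (cball 0 1) Z" "continuous_on (cball 0 1) W"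
    unfolding Z_def W_def x_aff y_aff s_aff using s0 unfolding s_aff by (auto intro!: continuous_intros)
  have ZWs: "(cmod (Z \<zeta>))\<^sup>2 + (cmod (W \<zeta>))\<^sup>2 = 1" if "\<zeta> \<in> sphere 0 1" for \<zeta>
    using ZW[of \<zeta>] that by simp
  have line: "(\<forall>\<zeta>\<in>cball 0 1. Z \<zeta> = \<gamma>) \<or> (\<exists>t. t \<noteq> 0 \<and> (\<forall>\<zeta>\<in>cball 0 1. W \<zeta> = t * (Z \<zeta> - \<gamma>)))"
  proof (cases "x' = 0")
    case True
    then show ?thesis using Z\<gamma> by auto
  next
    case False
    then have "W \<zeta> = herm3 (dir3 w) E2 / x' * (Z \<zeta> - \<gamma>)" if "\<zeta> \<in> cball 0 1" for \<zeta>
      using Z\<gamma>[of \<zeta>] that by (simp add: W_def y1)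
    then show ?thesis using w False by (intro disjI2 exI[of _ "herm3 (dir3 w) E2 / x'"]) simp
  qed
  have "disc_extends (\<lambda>\<zeta>. pullback f (Z \<zeta>) (W \<zeta>))"
  proof (rule normal_form_disc_extends[OF pullback_continuous[OF f] a(3) b(3) _ _ cont(1) hol(1) cont(2) hol(2) ZWs _ _ line])
    show "extends_along_slopes (pullback f) \<alpha>" by (rule pullback_extends_along_slopes[OF a(1,2)]) (use ext in blast)
    show "extends_along_slopes (pullback f) \<beta>" by (rule pullback_extends_along_slopes[OF b(1,2)]) (use ext in blast)
    show "cmod (Z \<zeta>) < 1" if "\<zeta> \<in> cball 0 1" for \<zeta> using Z1 that by simp
    show "cmod \<gamma> < 1" unfolding \<gamma>_def using Z1 \<eta> by simp
  qed
  then obtain H where H: "continuous_on (cball 0 1) H" "H holomorphic_on ball 0 1"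
    "\<And>\<zeta>. \<zeta> \<in> sphere 0 1 \<Longrightarrow> H \<zeta> = pullback f (Z \<zeta>) (W \<zeta>)" unfolding disc_extends_def by blast
  then show ?thesis unfolding disc_extends_def by (intro exI[of _ H]) (auto simp: val)
qed

end

text \<open>If \<open>A < 0\<close>, the conditions confine \<open>y\<close> to the interval between \<open>max 0 (- B / H)\<close> and \<open>H / (- A)\<close>, which is nonempty
  because the determinant \<open>A B - H\<^sup>2\<close> is negative; otherwise any large \<open>y\<close> will do.\<close>

lemma positive_combination_exists:
  fixes A B H :: real
  assumes "A * B < H\<^sup>2" "H > 0"
  obtains y where "y > 0" "B + H * y > 0" "H + A * y > 0"
proof (cases "A \<ge> 0")
  case True
  have "H * (\<bar>B\<bar> / H + 1) = \<bar>B\<bar> + H" using assms(2) by (simp add: field_simps)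
  then show ?thesis using that[of "\<bar>B\<bar> / H + 1"] assms(2) True
    by (smt (verit) divide_nonneg_pos mult_nonneg_nonneg)
next
  case False
  then have A: "A < 0" by simp
  define l where "l = max 0 (- B / H)"
  define u where "u = H / (- A)"
  have "- B / H < u"
  proof -
    have "(- B) * (- A) < H * H" using assms(1) by (simp add: power2_eq_square mult.commute)
    then show ?thesis using A assms(2) by (simp add: u_def field_simps)
  qed
  then have lu: "l < u" using A assms(2) by (simp add: l_def u_def divide_pos_neg)
  define y where "y = (l + u) / 2"
  have y: "l < y" "y < u" using lu by (auto simp: y_def)
  have "y > 0" using y by (simp add: l_def)
  moreover have "- B / H < y" using y by (simp add: l_def)
  then have "B + H * y > 0" using assms(2) by (simp add: field_simps)
  moreover have "y * (- A) < H" using y A by (simp add: u_def field_simps)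
  then have "H + A * y > 0" by (simp add: mult.commute)
  ultimately show ?thesis by (rule that)
qed

text \<open>Lagrange's identity for the form \<open>herm3\<close>: minus the Gram determinant of \<open>lift a\<close> and \<open>lift b\<close> is the value of the form on their
  cross product.\<close>

lemma gram_identity:
  fixes a b :: "complex ^ 2"
  shows "(cmod (hermitian_inner a b - 1))\<^sup>2 - ((norm a)\<^sup>2 - 1) * ((norm b)\<^sup>2 - 1)
    = (norm (b - a))\<^sup>2 - (cmod ((b - a) $ 2 * a $ 1 - (b - a) $ 1 * a $ 2))\<^sup>2"
proof -
  have "complex_of_real ((cmod (hermitian_inner a b - 1))\<^sup>2 - ((norm a)\<^sup>2 - 1) * ((norm b)\<^sup>2 - 1))
    = of_real ((norm (b - a))\<^sup>2 - (cmod ((b - a) $ 2 * a $ 1 - (b - a) $ 1 * a $ 2))\<^sup>2)"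
    unfolding of_real_diff of_real_mult hermitian_inner_self[symmetric] complex_norm_square of_real_1
    by (simp add: hermitian_inner_def algebra_simps)
  then show ?thesis by (simp only: of_real_eq_iff)
qed

text \<open>The expression is \<open>\<bar>b - a\<bar>\<^sup>2\<close> times one minus the squared distance of the line from the origin. The
  distance is bounded by the norm of a point \<open>c\<close> of the line in the ball, by Lagrange's identity.\<close>

lemma gram_positive:
  fixes a b :: "complex ^ 2"
  assumes ab: "a \<noteq> b" and meets: "complex_line_join a b \<inter> ball 0 1 \<noteq> {}"
  shows "(norm (b - a))\<^sup>2 - (cmod ((b - a) $ 2 * a $ 1 - (b - a) $ 1 * a $ 2))\<^sup>2 > 0"
proof -
  obtain c where c: "c \<in> complex_line_join a b" "norm c < 1" using meets by auto
  then obtain r where r: "c = a + r *s (b - a)" by (auto simp: complex_line_join_def cline_def)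
  let ?u = "b - a"
  have u: "(norm ?u)\<^sup>2 > 0" using ab by simp
  have e: "?u $ 2 * a $ 1 - ?u $ 1 * a $ 2 = ?u $ 2 * c $ 1 - ?u $ 1 * c $ 2"
    by (simp add: r algebra_simps)
  have "(norm ?u)\<^sup>2 * (norm c)\<^sup>2 - (cmod (?u $ 2 * c $ 1 - ?u $ 1 * c $ 2))\<^sup>2 = (cmod (hermitian_inner ?u c))\<^sup>2"
  proof -
    have "complex_of_real ((norm u)\<^sup>2 * (norm c)\<^sup>2 - (cmod (u $ 2 * c $ 1 - u $ 1 * c $ 2))\<^sup>2)
       = of_real ((cmod (hermitian_inner u c))\<^sup>2)" for u :: "complex ^ 2"
      unfolding of_real_diff of_real_mult hermitian_inner_self[symmetric] complex_norm_square
      by (simp add: hermitian_inner_def algebra_simps)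
    then show ?thesis by (simp only: of_real_eq_iff)
  qed
  then have "(cmod (?u $ 2 * c $ 1 - ?u $ 1 * c $ 2))\<^sup>2 \<le> (norm ?u)\<^sup>2 * (norm c)\<^sup>2"
    using zero_le_power2[of "cmod (hermitian_inner ?u c)"] by linarith
  also have "\<dots> < (norm ?u)\<^sup>2 * 1" using u c(2) by (intro mult_strict_left_mono) (simp_all add: abs_square_less_1)
  finally show ?thesis unfolding e by simp
qed

text \<open>The plane spanned by the lifts of \<open>a\<close> and \<open>b\<close> has signature \<open>(1,1)\<close>, because the line meets the ball. After multiplying the lift of \<open>b\<close> by a
  phase \<open>\<omega>\<close> the Gram matrix is real with positive off-diagonal entry \<open>H\<close>; this is where \<open>\<langle>a|b\<rangle> \<noteq> 1\<close> is needed, and it holds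
  automatically unless one point is inside the ball and the other outside. A positive combination \<open>m\<close> of the two vectors that has positive
  products \<open>t\<close> and \<open>s\<close> with both, together with the vector \<open>n\<close> orthogonal to \<open>m\<close> in the plane, places the two points on opposite sides of the
  origin of the axis. The second frame vector is the cross product, orthogonal to the plane; its shape shows below which lines
  are transversal to \<open>\<Lambda>(a,b)\<close>.\<close>

lemma normal_frame:
  fixes a b :: "complex ^ 2"
  assumes ab: "a \<noteq> b" and meets: "complex_line_join a b \<inter> ball 0 1 \<noteq> {}"
    and cond: "(a \<in> ball 0 1 \<and> b \<in> - cball 0 1) \<or> (b \<in> ball 0 1 \<and> a \<in> - cball 0 1) \<Longrightarrow> hermitian_inner a b \<noteq> 1"
  obtains E1 E2 E3 \<alpha> \<beta> \<mu> \<nu> \<kappa> where "frame E1 E2 E3" "\<alpha> < 0" "\<beta> > 0" "\<mu> \<noteq> 0" "\<nu> \<noteq> 0" "\<kappa> \<noteq> 0"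
    "lift b = \<mu> *s (of_real \<alpha> *s E1 + E3)" "lift a = \<nu> *s (of_real \<beta> *s E1 + E3)"
    "E2 $ 1 = \<kappa> * cnj ((b - a) $ 2)" "E2 $ 2 = - \<kappa> * cnj ((b - a) $ 1)"
proof -
  define hh where "hh = hermitian_inner a b - 1"
  \<comment> \<open>\<open>A\<close>, \<open>B\<close> and \<open>hh\<close> are the entries of the Gram matrix of the lifts\<close>
  define A where "A = (norm a)\<^sup>2 - 1"
  define B where "B = (norm b)\<^sup>2 - 1"
  define H where "H = cmod hh"
  define u where "u = b - a"
  define d where "d = u $ 2 * a $ 1 - u $ 1 * a $ 2"
  define D where "D = (norm u)\<^sup>2 - (cmod d)\<^sup>2"
  have D: "D > 0" using gram_positive[OF ab meets] by (simp add: D_def u_def d_def)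
  have DH: "H\<^sup>2 - A * B = D" using gram_identity[of a b] by (simp add: H_def hh_def A_def B_def D_def u_def d_def)
  have hh0: "hh \<noteq> 0"
  proof
    assume "hh = 0"
    then have AB: "A * B < 0" using DH D by (simp add: H_def)
    have lt: "norm x < 1" if "(norm x)\<^sup>2 - 1 < 0" for x :: "complex ^ 2" using that by (simp add: abs_square_less_1)
    have gt: "norm x > 1" if "(norm x)\<^sup>2 - 1 > 0" for x :: "complex ^ 2"
      using that by (smt (verit) norm_ge_zero power_le_one)
    consider "0 < A" "B < 0" | "A < 0" "0 < B" using AB by (auto simp: mult_less_0_iff)
    then have "(a \<in> ball 0 1 \<and> b \<in> - cball 0 1) \<or> (b \<in> ball 0 1 \<and> a \<in> - cball 0 1)"
    proof cases
      case 1
      then show ?thesis using gt[of a] lt[of b] unfolding A_def B_def by simp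
    next
      case 2
      then show ?thesis using gt[of b] lt[of a] unfolding A_def B_def by simp
    qed
    then show False using cond \<open>hh = 0\<close> by (simp add: hh_def)
  qed
  then have H: "H > 0" by (simp add: H_def)
  have "A * B < H\<^sup>2" using DH D by linarith
  then obtain y where y: "y > 0" "B + H * y > 0" "H + A * y > 0" using positive_combination_exists[OF _ H] by blast
  define s where "s = B + H * y"
  define t where "t = H + A * y"
  define Q where "Q = s + t * y"
  have st: "s > 0" "t > 0" using y by (simp_all add: s_def t_def)
  have Q: "Q > 0" unfolding Q_def by (intro add_pos_pos mult_pos_pos st y(1))
  define \<omega> where "\<omega> = hh / of_real H"
  have \<omega>: "\<omega> \<noteq> 0" "\<omega> * cnj \<omega> = 1" "cnj \<omega> * hh = of_real H"
  proof -
    have hc: "hh * cnj hh = of_real H * of_real H" using complex_norm_square[of hh] by (simp add: H_def power2_eq_square)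
    show "\<omega> \<noteq> 0" using hh0 H by (simp add: \<omega>_def)
    show "\<omega> * cnj \<omega> = 1" using hc H by (simp add: \<omega>_def)
    show "cnj \<omega> * hh = of_real H" using hc H by (simp add: \<omega>_def mult.commute)
  qed
  let ?a = "lift a"
  define b' where "b' = \<omega> *s lift b"
  have aa: "herm3 ?a ?a = of_real A" by (simp add: herm3_lift_self A_def)
  have bb: "herm3 b' b' = of_real B"
  proof -
    have "herm3 b' b' = (\<omega> * cnj \<omega>) * of_real B" by (simp add: b'_def herm3_linear herm3_lift_self B_def)
    then show ?thesis by (simp add: \<omega>)
  qed
  have abh: "herm3 ?a b' = of_real H" using \<omega>(3) by (simp add: b'_def herm3_linear herm3_lift hh_def)
  have bah: "herm3 b' ?a = of_real H" using abh herm3_cnj[of ?a b'] by simp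
  define m where "m = of_real y *s ?a + b'"
  define n where "n = of_real s *s ?a - of_real t *s b'"
  have mm: "herm3 m m = of_real Q"
    by (simp add: m_def herm3_linear aa bb abh bah Q_def s_def t_def algebra_simps)
  have r1: "s * A - t * H = - D" and r2: "s * H - t * B = y * D"
    unfolding DH[symmetric] by (simp_all add: s_def t_def power2_eq_square algebra_simps)
  have nn: "herm3 n n = of_real (- (D * Q))"
  proof -
    have "herm3 n n = of_real (s * (s * A - t * H) - t * (s * H - t * B))"
      by (simp add: n_def herm3_linear aa bb abh bah algebra_simps)
    also have "s * (s * A - t * H) - t * (s * H - t * B) = - (D * Q)" unfolding r1 r2 Q_def by (simp add: algebra_simps)
    finally show ?thesis .
  qed
  have mn: "herm3 m n = 0"
  proof -
    have "herm3 m n = of_real (y * (s * A - t * H) + (s * H - t * B))"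
      by (simp add: m_def n_def herm3_linear aa bb abh bah algebra_simps)
    also have "y * (s * A - t * H) + (s * H - t * B) = 0" unfolding r1 r2 by simp
    finally show ?thesis by simp
  qed
  define e2 :: "complex ^ 3" where "e2 = vector [cnj (u $ 2), - cnj (u $ 1), cnj d]"
  have e2h: "herm3 X e2 = X $ 1 * u $ 2 - X $ 2 * u $ 1 - X $ 3 * d" for X
    by (simp add: herm3_def e2_def)
  have e2e2: "herm3 e2 e2 = of_real D"
    by (simp add: herm3_self D_def norm_complex2) (simp add: e2_def)
  have ae2: "herm3 ?a e2 = 0" by (simp add: e2h d_def algebra_simps)
  have be2: "herm3 b' e2 = 0" by (simp add: b'_def herm3_linear e2h d_def u_def algebra_simps)
  have me2: "herm3 m e2 = 0" "herm3 n e2 = 0" by (simp_all add: m_def n_def herm3_linear ae2 be2)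
  define q where "q = sqrt Q"
  define dd where "dd = sqrt D"
  have q: "q > 0" "q * q = Q" and dd: "dd > 0" "dd * dd = D" using Q D by (simp_all add: q_def dd_def)
  define E1 where "E1 = (1 / of_real q) *s m"
  define E3 where "E3 = (1 / of_real (dd * q)) *s n"
  define E2 where "E2 = (1 / of_real dd) *s e2"
  have fr: "frame E1 E2 E3"
  proof
    show "herm3 E1 E1 = 1" unfolding E1_def herm3_linear mm q(2)[symmetric] using q(1) by simp
    show "herm3 E2 E2 = 1" unfolding E2_def herm3_linear e2e2 dd(2)[symmetric] using dd(1) by simp
    show "herm3 E3 E3 = -1" unfolding E3_def herm3_linear nn q(2)[symmetric] dd(2)[symmetric] using q(1) dd(1) by simp
    show "herm3 E1 E2 = 0" unfolding E1_def E2_def herm3_linear me2 by simp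
    show "herm3 E1 E3 = 0" unfolding E1_def E3_def herm3_linear mn by simp
    have "herm3 e2 n = 0" using me2(2) herm3_cnj[of n e2] by simp
    then show "herm3 E2 E3 = 0" unfolding E2_def E3_def herm3_linear by simp
  qed
  have mE: "m = of_real q *s E1" and nE: "n = of_real (dd * q) *s E3"
    using q(1) dd(1) by (simp_all add: E1_def E3_def vector_smult_assoc)
  have Qc: "complex_of_real Q \<noteq> 0" using Q by simp
  have la: "lift a = of_real (dd * q / Q) *s (of_real (t / dd) *s E1 + E3)"
  proof -
    have "of_real Q *s ?a = of_real t *s m + n"
      by (simp add: m_def n_def Q_def vec3_eq_iff algebra_simps)
    moreover have "?a = (1 / of_real Q) *s (of_real Q *s ?a)" using Qc by (simp add: vector_smult_assoc)
    ultimately have "?a = (1 / of_real Q) *s (of_real t *s m + n)" by simp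
    also have "\<dots> = of_real (dd * q / Q) *s (of_real (t / dd) *s E1 + E3)"
      unfolding mE nE using dd(1) by (simp add: vec3_eq_iff field_simps)
    finally show ?thesis .
  qed
  have lb: "lift b = (- of_real (y * dd * q / Q) / \<omega>) *s (of_real (- s / (y * dd)) *s E1 + E3)"
  proof -
    have "of_real Q *s b' = of_real s *s m - of_real y *s n"
      by (simp add: m_def n_def Q_def vec3_eq_iff algebra_simps)
    moreover have "b' = (1 / of_real Q) *s (of_real Q *s b')" using Qc by (simp add: vector_smult_assoc)
    ultimately have "b' = (1 / of_real Q) *s (of_real s *s m - of_real y *s n)" by simp
    moreover have "lift b = (1 / \<omega>) *s b'" using \<omega>(1) by (simp add: b'_def vector_smult_assoc)
    ultimately have "lift b = (1 / \<omega>) *s ((1 / of_real Q) *s (of_real s *s m - of_real y *s n))" by simp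
    also have "\<dots> = (- of_real (y * dd * q / Q) / \<omega>) *s (of_real (- s / (y * dd)) *s E1 + E3)"
      unfolding mE nE using dd(1) y(1) \<omega>(1) Qc by (simp add: vec3_eq_iff field_simps)
    finally show ?thesis .
  qed
  show ?thesis
  proof (rule that[OF fr _ _ _ _ _ lb la])
    show "- s / (y * dd) < 0" using st y(1) dd(1) by (simp add: divide_neg_pos)
    show "t / dd > 0" using st dd(1) by simp
    show "- of_real (y * dd * q / Q) / \<omega> \<noteq> 0" using y(1) dd(1) q(1) Q \<omega>(1) by simp
    show "complex_of_real (dd * q / Q) \<noteq> 0" using dd(1) q(1) Q by simp
    show "1 / complex_of_real dd \<noteq> 0" using dd(1) by simp
    show "E2 $ 1 = 1 / of_real dd * cnj ((b - a) $ 2)" "E2 $ 2 = - (1 / of_real dd) * cnj ((b - a) $ 1)"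
      by (simp_all add: E2_def e2_def u_def diff_divide_distrib)
  qed
qed

lemma cline_shift: "cline (p + k *s w) w = cline p w"
proof -
  have 1: "p + k *s w + z *s w = p + (k + z) *s w" for z by (simp add: vec2_eq_iff algebra_simps)
  have 2: "p + z *s w = p + k *s w + (z - k) *s w" for z by (simp add: vec2_eq_iff algebra_simps)
  show ?thesis unfolding cline_def
  proof (intro subset_antisym image_subsetI)
    show "p + k *s w + z *s w \<in> range (\<lambda>z. p + z *s w)" for z unfolding 1 by (rule rangeI)
    show "p + z *s w \<in> range (\<lambda>z. p + k *s w + z *s w)" for z
      by (rule range_eqI[of _ _ "z - k"]) (rule 2)
  qed
qed

theorem theorem1p2:
  fixes a b :: "complex ^ 2" and f :: "complex ^ 2 \<Rightarrow> complex"
  assumes "a \<noteq> b"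
    and "complex_line_join a b \<inter> ball 0 1 \<noteq> {}"
    and "(a \<in> ball 0 1 \<and> b \<in> - cball 0 1) \<or> (b \<in> ball 0 1 \<and> a \<in> - cball 0 1) \<Longrightarrow>
      hermitian_inner a b \<noteq> 1"
    and "continuous_on (sphere 0 1) f"
    and "\<And>L. L \<in> complex_lines_through a \<union> complex_lines_through b \<Longrightarrow>
      extends_holomorphically_along f L"
  shows "\<forall>c \<in> complex_line_join a b \<inter> ball 0 1. \<forall>L \<in> complex_lines_through c.
    extends_holomorphically_along f L"
proof (intro ballI)
  fix c L assume c: "c \<in> complex_line_join a b \<inter> ball 0 1" and L: "L \<in> complex_lines_through c"
  obtain E1 E2 E3 \<alpha> \<beta> \<mu> \<nu> \<kappa> where fr: "frame E1 E2 E3" and sg: "\<alpha> < 0" "\<beta> > 0" "\<mu> \<noteq> 0" "\<nu> \<noteq> 0" "\<kappa> \<noteq> 0"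
    and lb: "lift b = \<mu> *s (of_real \<alpha> *s E1 + E3)" and la: "lift a = \<nu> *s (of_real \<beta> *s E1 + E3)"
    and E2: "E2 $ 1 = \<kappa> * cnj ((b - a) $ 2)" "E2 $ 2 = - \<kappa> * cnj ((b - a) $ 1)"
    by (rule normal_frame[OF assms(1-3)])
  interpret frame E1 E2 E3 by (rule fr)
  obtain v where v: "v \<noteq> 0" "L = cline c v" using L by (auto simp: complex_lines_through_def)
  have cL: "c \<in> L" unfolding v cline_def by (rule range_eqI[of _ _ 0]) simp
  have meets: "cline c v \<inter> ball 0 1 \<noteq> {}" using c cL v by blast
  obtain p w \<rho> where pw: "w \<noteq> 0" "\<rho> > 0" "cline c v = cline p w"
    "\<And>\<zeta>. (norm (p + \<zeta> *s w))\<^sup>2 - 1 = \<rho> * ((cmod \<zeta>)\<^sup>2 - 1)"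
    by (rule cline_unit_param[OF v(1) meets]) (rule that, assumption+)
  have "c \<in> cline p w" using cL v pw(3) by simp
  then obtain \<eta> where \<eta>: "c = p + \<eta> *s w" by (auto simp: cline_def)
  obtain r where r: "c = a + r *s (b - a)" using c by (auto simp: complex_line_join_def cline_def)
  have Lpw: "L = cline p w" using v pw by simp
  show "extends_holomorphically_along f L"
  proof (cases "w $ 1 * (b - a) $ 2 = w $ 2 * (b - a) $ 1")
    case True
    obtain k where k: "b - a = k *s w"
    proof (cases "w $ 1 = 0")
      case True
      then have "w $ 2 \<noteq> 0" using pw(1) by (auto simp: vec2_eq_iff)
      then show ?thesis using that[of "(b - a) $ 2 / w $ 2"] \<open>w $ 1 * (b - a) $ 2 = w $ 2 * (b - a) $ 1\<close> True
        by (simp add: vec2_eq_iff)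
    next
      case False
      then show ?thesis using that[of "(b - a) $ 1 / w $ 1"] \<open>w $ 1 * (b - a) $ 2 = w $ 2 * (b - a) $ 1\<close>
        by (simp add: vec2_eq_iff field_simps)
    qed
    have "a = p + (\<eta> - r * k) *s w"
      using r \<eta> k by (simp add: vec2_eq_iff algebra_simps)
    then have "L = cline a w" unfolding Lpw by (simp only: cline_shift)
    then have "L \<in> complex_lines_through a" using pw(1) by (auto simp: complex_lines_through_def)
    then show ?thesis using assms(5) by blast
  next
    case False
    have "disc_extends (\<lambda>\<zeta>. f (p + \<zeta> *s w))"
    proof (rule line_disc_extends[OF assms(4) lb sg(3,1) la sg(4,2) _ pw(2,4)])
      show "extends_holomorphically_along f L'" if "L' \<in> complex_lines_through b \<union> complex_lines_through a" for L'
        using assms(5) that by blast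
      have "(norm c)\<^sup>2 - 1 < 0" using c by (simp add: abs_square_less_1)
      then have "\<rho> * ((cmod \<eta>)\<^sup>2 - 1) < 0" using pw(4)[of \<eta>] \<eta> by simp
      then show "cmod \<eta> < 1" using pw(2) by (simp add: mult_less_0_iff abs_square_less_1)
      have "lift c = (1 - r) *s lift a + r *s lift b" by (simp add: r vec3_eq_iff algebra_simps)
      moreover have "herm3 (lift a) E2 = 0" "herm3 (lift b) E2 = 0"
        unfolding la lb by (simp_all add: herm3_linear ortho ortho')
      ultimately show "herm3 (lift (p + \<eta> *s w)) E2 = 0" unfolding \<eta>[symmetric] by (simp add: herm3_linear)
      have "herm3 (dir3 w) E2 = cnj \<kappa> * (w $ 1 * (b - a) $ 2 - w $ 2 * (b - a) $ 1)"
        by (simp add: herm3_def E2 algebra_simps)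
      then show "herm3 (dir3 w) E2 \<noteq> 0" using False sg(5) by simp
    qed
    then show ?thesis unfolding Lpw by (rule extends_along_if_disc_extends[OF pw(1,2,4)])
  qed
qed

end
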